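(* Let $q\ge 0$ be an integer and let $G$ be a finite simple graph, with soft Barycentric refinement $\phi(G)$. If $G$ is a $q$-manifold (without boundary), then $\phi(G)$ is a $q$-manifold. If $G$ is a $q$-manifold with boundary, then $\phi(G)$ is a $q$-manifold with boundary.
   Context: All graphs are finite and simple. A $k$-simplex of a graph $G=(V,E)$ is the (non-empty) vertex set of a complete subgraph $K_{k+1}$ of $G$. The maximal dimension $q$ of $G$ is the largest $k$ for which $G$ has a $k$-simplex. Manifolds. For $v\in V$, the unit sphere $S(v)$ is the subgraph induced by the neighbors of $v$, and $G\setminus v$ is the graph obtained by deleting $v$. Inductive definitions: $K_1$ is contractible, and $G$ is contractible if there is a vertex $v$ such that both $S(v)$ and $G\setminus v$ are contractible. The empty graph is the $(-1)$-sphere. For $q\ge 0$, a graph is a $q$-manifold if it is non-empty and every unit sphere $S(v)$ is a $(q-1)$-sphere; a $q$-manifold $G$ is a $q$-sphere if there is a vertex $v$ such that $G\setminus v$ is contractible. A $q$-ball is a graph of the form $H\setminus v$ where $H$ is a $q$-sphere and $v$ is a vertex of $H$. A $q$-manifold with boundary is a non-empty graph in which every unit sphere is either a $(q-1)$-sphere or a $(q-1)$-ball. Soft Barycentric refinement. Let $G$ have maximal dimension $q$. The facets of $G$ are its $q$-simplices. A $(q-1)$-simplex is a boundary face if it is contained in exactly one facet, and an interior face if it is contained in exactly two facets. The soft Whitney complex of $G$ is the set of all simplices of $G$ that are either $k$-simplices with $k\ne q-1$, or $(q-1)$-simplices that are boundary faces. The soft Barycentric refinement $\phi(G)$ is the graph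 whose vertices are the elements of the soft Whitney complex of $G$, two distinct elements being adjacent if one is contained in the other or if their intersection is an interior face. *)

theory Defs
  imports Main "Graph_Theory.Pair_Digraph" "Graph_Theory.Digraph_Component"
    "Graph_Theory.Digraph_Isomorphism" "Graph_Theory.Kuratowski"
begin

text \<open>
  Finite simple graphs are the library's \<^locale>\<open>pair_graph\<close>s: finite, loop-free symmetric
  digraphs without parallel arcs.  Dimensions are integers, so that \<open>q - 1\<close> makes sense for \<open>q = 0\<close>.
  The next two definitions restate the library's \<open>induce_subgraph\<close> and \<open>del_vert\<close> on the record
  type of pair digraphs; the agreement is proved below.
\<close>

definition induced :: "'a pair_pre_digraph \<Rightarrow> 'a set \<Rightarrow> 'a pair_pre_digraph" where
  "induced G S = \<lparr> pverts = S, parcs = {(u, w) \<in> parcs G. u \<in> S \<and> w \<in> S} \<rparr>"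

definition delete_vertex :: "'a pair_pre_digraph \<Rightarrow> 'a \<Rightarrow> 'a pair_pre_digraph" where
  "delete_vertex G v = \<lparr> pverts = pverts G - {v}, parcs = {(u, w) \<in> parcs G. u \<noteq> v \<and> w \<noteq> v} \<rparr>"

lemma with_proj_induced: "with_proj (induced G S) = with_proj G \<restriction> S"
  by (auto simp: induced_def with_proj_def induce_subgraph_def)

lemma with_proj_delete_vertex:
  "with_proj (delete_vertex G v) = pre_digraph.del_vert (with_proj G) v"
  by (auto simp: delete_vertex_def with_proj_def pre_digraph.del_vert_def)

definition unit_sphere :: "'a pair_pre_digraph \<Rightarrow> 'a \<Rightarrow> 'a pair_pre_digraph" where
  "unit_sphere G v = induced G {u. (v, u) \<in> parcs G}"


section \<open>Contractible graphs, spheres, balls and manifolds\<close>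

inductive contractible_graph :: "'a pair_pre_digraph \<Rightarrow> bool" where
  single: "K\<^bsub>1\<^esub> (with_proj G) \<Longrightarrow> contractible_graph G"
| step: "\<lbrakk> pair_graph G; v \<in> pverts G; contractible_graph (unit_sphere G v);
           contractible_graph (delete_vertex G v) \<rbrakk> \<Longrightarrow> contractible_graph G"

inductive q_sphere :: "int \<Rightarrow> 'a pair_pre_digraph \<Rightarrow> bool"
  and q_manifold :: "int \<Rightarrow> 'a pair_pre_digraph \<Rightarrow> bool"
where
  empty_sphere: "\<lbrakk> pair_graph G; pverts G = {} \<rbrakk> \<Longrightarrow> q_sphere (-1) G"
| manifold: "\<lbrakk> pair_graph G; q \<ge> 0; pverts G \<noteq> {};
               \<And>v. v \<in> pverts G \<Longrightarrow> q_sphere (q - 1) (unit_sphere G v) \<rbrakk> \<Longrightarrow> q_manifold q G"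
| sphere: "\<lbrakk> q_manifold q G; v \<in> pverts G; contractible_graph (delete_vertex G v) \<rbrakk>
            \<Longrightarrow> q_sphere q G"

text \<open>
  A graph is a ball if it is isomorphic to a sphere minus a vertex.  The sphere \<open>H\<close> ranges over
  graphs on \<open>nat\<close> because the vertex type of \<open>G\<close> may be finite and leave no room for the
  additional vertex; up to isomorphism every finite graph occurs on \<open>nat\<close>.
\<close>

definition q_ball :: "int \<Rightarrow> 'a pair_pre_digraph \<Rightarrow> bool" where
  "q_ball q G \<longleftrightarrow> (\<exists>(H :: nat pair_pre_digraph) v.
     q_sphere q H \<and> v \<in> pverts H \<and> digraph_iso (with_proj G) (with_proj (delete_vertex H v)))"

definition q_manifold_with_boundary :: "int \<Rightarrow> 'a pair_pre_digraph \<Rightarrow> bool" where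
  "q_manifold_with_boundary q G \<longleftrightarrow>
     pair_graph G \<and> q \<ge> 0 \<and> pverts G \<noteq> {} \<and>
     (\<forall>v \<in> pverts G. q_sphere (q - 1) (unit_sphere G v) \<or> q_ball (q - 1) (unit_sphere G v))"


section \<open>Soft barycentric refinement\<close>

definition simplices :: "'a pair_pre_digraph \<Rightarrow> int \<Rightarrow> 'a set set" where
  "simplices G k =
     {verts H | H. subgraph H (with_proj G) \<and> K\<^bsub>nat (k + 1)\<^esub> H \<and> verts H \<noteq> {}}"

definition max_dim :: "'a pair_pre_digraph \<Rightarrow> int" where
  "max_dim G = (GREATEST k. simplices G k \<noteq> {})"

definition facets :: "'a pair_pre_digraph \<Rightarrow> 'a set set" where
  "facets G = simplices G (max_dim G)"

definition boundary_faces :: "'a pair_pre_digraph \<Rightarrow> 'a set set" where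
  "boundary_faces G = {x \<in> simplices G (max_dim G - 1). card {f \<in> facets G. x \<subseteq> f} = 1}"

definition interior_faces :: "'a pair_pre_digraph \<Rightarrow> 'a set set" where
  "interior_faces G = {x \<in> simplices G (max_dim G - 1). card {f \<in> facets G. x \<subseteq> f} = 2}"

definition soft_complex :: "'a pair_pre_digraph \<Rightarrow> 'a set set" where
  "soft_complex G = (\<Union>k \<in> - {max_dim G - 1}. simplices G k) \<union> boundary_faces G"

definition soft_refinement :: "'a pair_pre_digraph \<Rightarrow> 'a set pair_pre_digraph" where
  "soft_refinement G =
     \<lparr> pverts = soft_complex G,
       parcs = {(x, y) \<in> soft_complex G \<times> soft_complex G.
                  x \<noteq> y \<and> (x \<subseteq> y \<or> y \<subseteq> x \<or> x \<inter> y \<in> interior_faces G)} \<rparr>"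

lemma simplices_eq:
  assumes "pair_graph G"
  shows "simplices G k = {x. x \<subseteq> pverts G \<and> x \<noteq> {} \<and> int (card x) = k + 1 \<and>
           (\<forall>u \<in> x. \<forall>w \<in> x. u \<noteq> w \<longrightarrow> (u, w) \<in> parcs G)}" (is "_ = ?R")
proof (intro subset_antisym subsetI)
  interpret pair_graph G by fact
  fix x assume "x \<in> simplices G k"
  then obtain H :: "('a, 'a \<times> 'a) pre_digraph"
    where x: "x = verts H" and sub: "subgraph H (with_proj G)"
      and K: "K\<^bsub>nat (k + 1)\<^esub> H" and ne: "verts H \<noteq> {}"
    unfolding simplices_def by blast
  have fin: "finite x" and sub_x: "x \<subseteq> pverts G"
    using sub x pair_finite_verts by (auto simp: subgraph_def with_proj_def intro: finite_subset)
  have "card x = nat (k + 1)" using K x by (simp add: complete_digraph_def)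
  moreover have "card x \<noteq> 0" using fin ne x by simp
  ultimately have "int (card x) = k + 1" by simp
  moreover have "(u, w) \<in> parcs G" if "u \<in> x" "w \<in> x" "u \<noteq> w" for u w
  proof -
    have "(u, w) \<in> arcs_ends H" using K x that by (auto simp: complete_digraph_def)
    then show ?thesis using sub
      by (auto simp: arcs_ends_def arc_to_ends_def subgraph_def compatible_def with_proj_def)
  qed
  ultimately show "x \<in> ?R" using sub_x ne x by blast
next
  interpret pair_graph G by fact
  fix x assume x: "x \<in> ?R"
  let ?H = "with_proj (induced G x)"
  have "subgraph ?H (with_proj G)"
    unfolding with_proj_induced using x by (intro induced_imp_subgraph induced_induce) auto
  moreover have "K\<^bsub>nat (k + 1)\<^esub> ?H"
    using x finite_subset[OF _ pair_finite_verts, of x]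
    unfolding complete_digraph_pair_def by (auto simp: induced_def dest: no_loops')
  moreover have "verts ?H = x" by (simp add: induced_def)
  ultimately show "x \<in> simplices G k" using x unfolding simplices_def by blast
qed

end

theory Submission
  imports Defs
begin

text \<open>
  Write \<open>\<phi>(G)\<close> for the soft refinement.  In \<open>\<phi>(G)\<close>, the neighbours of a simplex \<open>x\<close> that is not a
  facet are the proper faces of \<open>x\<close> and the cells \<open>y \<supset> x\<close>; every cell of the first kind is adjacent
  to every cell of the second.  So the unit sphere of \<open>x\<close> is a join of the barycentric subdivision
  of the boundary of a simplex, which is a sphere (\<open>sph_proper_subsets\<close>), with \<open>\<phi>\<close> of the link of
  \<open>x\<close>.  If \<open>x\<close> is a facet, then the neighbouring facets take the places of the missing interior faces
  of \<open>x\<close>, and the unit sphere is again the subdivided boundary of a simplex (\<open>facet_iso\<close>).  Joins of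
  spheres are spheres (\<open>sph_join\<close>), so everything reduces to the claim that \<open>\<phi>\<close> maps spheres to
  spheres and balls to balls.

  Both halves of this claim are one statement about a graph \<open>H\<close> with a marked vertex \<open>v\<close>, which may
  or may not belong to \<open>H\<close>, and with a bound \<open>n\<close> on the size of its cliques.  The cells of
  \<open>(H, n, v)\<close> are chosen such that

  \<^item> for a sphere \<open>H\<close> with \<open>v \<notin> H\<close> and \<open>n\<close> the size of its facets, they form \<open>\<phi>(H)\<close>;
  \<^item> for \<open>v \<notin> H\<close> and \<open>n\<close> larger than the size of any clique by at least two, they form the ordinary
    barycentric refinement of \<open>H\<close>;
  \<^item> for a sphere \<open>H\<close> with \<open>v \<in> H\<close> and \<open>n\<close> the size of its facets, they form \<open>\<phi>(H - v)\<close> together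
    with one further vertex, the cell \<open>{v}\<close>, coned over the boundary of the ball \<open>H - v\<close>.

  The cells of a marked sphere form a sphere (\<open>sph_refinement\<close>).  With \<open>v \<in> H\<close> this exhibits
  \<open>\<phi>(H - v)\<close> as a sphere minus a vertex, that is, as a ball.  The proof is an induction on the
  dimension: the unit sphere of \<open>{v}\<close> is an ordinary refinement of the unit sphere of \<open>v\<close>, and the
  other unit spheres are joins as above.

  It remains to find a cell whose deletion leaves a contractible graph.  This rests on the fact that
  refinement preserves contractibility (\<open>contr_refinement\<close>), proved by following a sequence of
  vertex deletions that contracts \<open>H\<close>.  To pass from \<open>H\<close> to \<open>H - u\<close>, the cells containing \<open>u\<close> are
  removed by increasing size (\<open>delete_contr\<close>).  When its turn comes, a cell \<open>x\<close> has a contractible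
  unit sphere, because \<open>x - {u}\<close> is adjacent to (almost) everything else in it.  The difficult point
  is a face \<open>f\<close> for which \<open>f \<union> {u}\<close> is the only facet above: in \<open>H - u\<close> this face is a cell, while in
  \<open>H\<close> it need not be one.  The facet \<open>f \<union> {u}\<close> is therefore not removed, but kept as a proxy for
  \<open>f\<close>.  Two proxies may be adjacent, unlike the faces they stand for, and so the refinements in the
  induction are allowed to have arbitrary extra edges between such faces, provided that the faces
  share all but one of their vertices.
\<close>

section \<open>Contractible graphs and spheres inside a fixed graph\<close>

text \<open>
  All graphs that occur below are induced subgraphs of a few ambient graphs.  A graph is therefore a
  vertex set together with an adjacency relation on the whole type, and passing to a unit sphere or
  deleting a vertex changes the vertex set only.
\<close>
definition nbrs :: "('a \<Rightarrow> 'a \<Rightarrow> bool) \<Rightarrow> 'a set \<Rightarrow> 'a \<Rightarrow> 'a set" where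
  "nbrs E V v = {u \<in> V. E v u}"

inductive contractible :: "('a \<Rightarrow> 'a \<Rightarrow> bool) \<Rightarrow> 'a set \<Rightarrow> bool" for E where
  single: "contractible E {v}"
| step: "finite V \<Longrightarrow> v \<in> V \<Longrightarrow> contractible E (nbrs E V v) \<Longrightarrow> contractible E (V - {v}) \<Longrightarrow> contractible E V"

text \<open>
  The natural number is the dimension plus one, which is also the size of the facets; it adds up
  under joins, and the empty sphere gets the number 0.
\<close>
fun sph :: "('a \<Rightarrow> 'a \<Rightarrow> bool) \<Rightarrow> nat \<Rightarrow> 'a set \<Rightarrow> bool" where
  "sph E 0 V \<longleftrightarrow> V = {}"
| "sph E (Suc m) V \<longleftrightarrow> finite V \<and> V \<noteq> {} \<and> (\<forall>v\<in>V. sph E m (nbrs E V v)) \<and>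
     (\<exists>v\<in>V. contractible E (V - {v}))"

definition graph_iso :: "('a \<Rightarrow> 'b) \<Rightarrow> ('a \<Rightarrow> 'a \<Rightarrow> bool) \<Rightarrow> 'a set \<Rightarrow> ('b \<Rightarrow> 'b \<Rightarrow> bool) \<Rightarrow> 'b set \<Rightarrow> bool" where
  "graph_iso h E V F W \<longleftrightarrow> bij_betw h V W \<and> (\<forall>x\<in>V. \<forall>y\<in>V. F (h x) (h y) \<longleftrightarrow> E x y)"

lemma contr_nonempty: "contractible E V \<Longrightarrow> V \<noteq> {}"
  by (induction rule: contractible.induct) auto

lemma sph_finite: "sph E m V \<Longrightarrow> finite V"
  by (cases m) auto

lemma nbrs_subset: "nbrs E V v \<subseteq> V"
  by (auto simp: nbrs_def)

lemma graph_iso_subset: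
  assumes "graph_iso h E V F W" "U \<subseteq> V"
  shows "graph_iso h E U F (h ` U)"
  using assms unfolding graph_iso_def bij_betw_def by (meson inj_on_subset subsetD)

lemma graph_iso_nbrs:
  assumes "graph_iso h E V F W" "v \<in> V"
  shows "graph_iso h E (nbrs E V v) F (nbrs F W (h v))"
proof -
  have "h ` nbrs E V v = nbrs F W (h v)"
    using assms unfolding graph_iso_def nbrs_def bij_betw_def by auto
  then show ?thesis using graph_iso_subset[OF assms(1) nbrs_subset[of E V v]] by simp
qed

lemma graph_iso_delete:
  assumes "graph_iso h E V F W" "v \<in> V"
  shows "graph_iso h E (V - {v}) F (W - {h v})"
proof -
  have "h ` (V - {v}) = W - {h v}"
    using assms unfolding graph_iso_def bij_betw_def inj_on_def by auto
  then show ?thesis using graph_iso_subset[OF assms(1), of "V - {v}"] by simp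
qed

lemma graph_iso_contr: "contractible E V \<Longrightarrow> graph_iso h E V F W \<Longrightarrow> contractible F W"
proof (induction arbitrary: W rule: contractible.induct)
  case (single v)
  then have "W = {h v}" by (auto simp: graph_iso_def bij_betw_def)
  then show ?case by (simp add: contractible.single)
next
  case (step V v)
  have "finite W" "h v \<in> W"
    using step.prems step.hyps bij_betw_finite unfolding graph_iso_def bij_betw_def by auto
  then show ?case
    using step.IH(1)[OF graph_iso_nbrs[OF step.prems step.hyps(2)]]
      step.IH(2)[OF graph_iso_delete[OF step.prems step.hyps(2)]] contractible.step by metis
qed

lemma graph_iso_sph: "sph E m V \<Longrightarrow> graph_iso h E V F W \<Longrightarrow> sph F m W"
proof (induction m arbitrary: V W)
  case 0
  then show ?case by (auto simp: graph_iso_def bij_betw_def)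
next
  case (Suc m)
  have W: "W = h ` V" using Suc.prems(2) by (auto simp: graph_iso_def bij_betw_def)
  have "sph F m (nbrs F W w)" if "w \<in> W" for w
    using Suc.IH[OF _ graph_iso_nbrs[OF Suc.prems(2)]] Suc.prems(1) that W by auto
  moreover obtain v where "v \<in> V" "contractible E (V - {v})" using Suc.prems(1) by auto
  then have "h v \<in> W \<and> contractible F (W - {h v})"
    using graph_iso_contr[OF _ graph_iso_delete[OF Suc.prems(2)]] W by auto
  ultimately show ?case using Suc.prems W by auto
qed

lemma graph_iso_inv:
  assumes "graph_iso h E V F W" shows "graph_iso (inv_into V h) F W E V"
proof -
  have bij: "bij_betw h V W" using assms by (simp add: graph_iso_def)
  have "E (inv_into V h x) (inv_into V h y) \<longleftrightarrow> F x y" if "x \<in> W" "y \<in> W" for x y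
  proof -
    have "inv_into V h x \<in> V" "inv_into V h y \<in> V" "h (inv_into V h x) = x" "h (inv_into V h y) = y"
      using that bij by (auto simp: bij_betw_def inv_into_into f_inv_into_f)
    then show ?thesis using assms unfolding graph_iso_def by metis
  qed
  then show ?thesis using bij_betw_inv_into[OF bij] by (simp add: graph_iso_def)
qed

lemma graph_iso_trans: "graph_iso h E V F W \<Longrightarrow> graph_iso k F W G X \<Longrightarrow> graph_iso (k \<circ> h) E V G X"
  unfolding graph_iso_def by (auto intro: bij_betw_trans dest: bij_betwE)

text \<open>
  The order of the removals need not be fixed in advance: it suffices that every intermediate set
  offers some removable vertex outside the target.
\<close>
lemma contr_dismantle:
  assumes "finite A" "B \<subseteq> A" "contractible E B"
    and *: "\<And>C. B \<subset> C \<Longrightarrow> C \<subseteq> A \<Longrightarrow> \<exists>x\<in>C - B. contractible E (nbrs E C x)"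
  shows "contractible E A"
proof -
  have "contractible E C" if "B \<subseteq> C" "C \<subseteq> A" for C
    using that
  proof (induction "card (C - B)" arbitrary: C rule: less_induct)
    case less
    show ?case
    proof (cases "B = C")
      case True then show ?thesis using assms by simp
    next
      case False
      then obtain x where x: "x \<in> C - B" "contractible E (nbrs E C x)" using * less.prems by blast
      have fin: "finite C" using less.prems assms finite_subset by blast
      have "C - {x} - B \<subset> C - B" using x by blast
      then have "card (C - {x} - B) < card (C - B)" using fin by (intro psubset_card_mono) auto
      then have "contractible E (C - {x})" using less.hyps[of "C - {x}"] less.prems x by blast
      then show ?thesis using contractible.step[of C x E] fin x by auto
    qed
  qed
  then show ?thesis using assms by blast
qed

locale sgraph =
  fixes E :: "'a \<Rightarrow> 'a \<Rightarrow> bool"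
  assumes sym: "E x y \<Longrightarrow> E y x" and irr: "\<not> E x x"
begin

text \<open>
  Every vertex \<open>b\<close> of a cone other than its apex can be removed, because the unit sphere of \<open>b\<close>
  is a smaller cone with the same apex.
\<close>
lemma cone_contr:
  assumes "finite V" "c \<in> V" "\<And>y. y \<in> V \<Longrightarrow> y \<noteq> c \<Longrightarrow> E c y"
  shows "contractible E V"
  using assms
proof (induction "card V" arbitrary: V rule: less_induct)
  case less
  show ?case
  proof (cases "V = {c}")
    case True then show ?thesis by (simp add: contractible.single)
  next
    case False
    then obtain b where b: "b \<in> V" "b \<noteq> c" using less.prems by blast
    have "contractible E (V - {b})"
      using less.prems b by (intro less.hyps card_Diff1_less) auto
    moreover have "contractible E (nbrs E V b)"
    proof (rule less.hyps)
      show "card (nbrs E V b) < card V"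
        using less.prems b irr by (intro psubset_card_mono) (auto simp: nbrs_def)
    qed (use less.prems b sym in \<open>auto simp: nbrs_def\<close>)
    ultimately show ?thesis using contractible.step[of V b E] less.prems b by auto
  qed
qed

text \<open>
  Here \<open>a\<close> is an apex except for some vertices \<open>t\<close>, each of which has a cone as its unit
  sphere.  Removing all of these leaves a cone with apex \<open>a\<close>; the local apex \<open>e\<close> of \<open>t\<close>
  survives until then, being equal or adjacent to \<open>a\<close>.
\<close>
lemma near_cone_contr:
  assumes "finite L" "a \<in> L"
    and far: "\<And>t. t \<in> L \<Longrightarrow> t \<noteq> a \<Longrightarrow> \<not> E a t \<Longrightarrow>
      \<exists>e\<in>L. (e = a \<or> E a e) \<and> E t e \<and> (\<forall>r\<in>L. E t r \<longrightarrow> r = e \<or> E e r)"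
  shows "contractible E L"
proof (rule contr_dismantle[where B = "{t\<in>L. t = a \<or> E a t}"])
  show "contractible E {t \<in> L. t = a \<or> E a t}"
    using assms by (intro cone_contr[of _ a]) auto
  fix C assume C: "{t \<in> L. t = a \<or> E a t} \<subset> C" "C \<subseteq> L"
  then obtain t where t: "t \<in> C" "t \<in> L" "t \<noteq> a" "\<not> E a t" by blast
  then obtain e where e: "e \<in> L" "e = a \<or> E a e" "E t e" "\<forall>r\<in>L. E t r \<longrightarrow> r = e \<or> E e r"
    using far by blast
  have "finite C" using C assms finite_subset by blast
  then have "contractible E (nbrs E C t)"
    using C t e by (intro cone_contr[of _ e]) (auto simp: nbrs_def)
  then show "\<exists>x\<in>C - {t \<in> L. t = a \<or> E a t}. contractible E (nbrs E C x)" using t by blast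
qed (use assms in auto)

lemma contr_join:
  assumes "contractible E C" "finite B" "C \<inter> B = {}" "\<And>c b. c \<in> C \<Longrightarrow> b \<in> B \<Longrightarrow> E c b"
  shows "contractible E (C \<union> B)"
  using assms
proof (induction rule: contractible.induct)
  case (single v)
  then show ?case by (intro cone_contr[of _ v]) auto
next
  case (step V v)
  have "nbrs E (V \<union> B) v = nbrs E V v \<union> B" "V \<union> B - {v} = (V - {v}) \<union> B"
    using step.hyps step.prems by (auto simp: nbrs_def)
  moreover have "contractible E (nbrs E V v \<union> B)" "contractible E ((V - {v}) \<union> B)"
    using step.prems nbrs_subset[of E V v] by (intro step.IH; blast)+
  ultimately show ?case using contractible.step[of "V \<union> B" v E] step.hyps step.prems by auto
qed

text \<open>
  The unit sphere of a vertex in one factor is the join of its unit sphere in that factor with the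
  other factor, so the sum of the two numbers drops by one.
\<close>
lemma sph_join:
  assumes "sph E i A" "sph E j B" "A \<inter> B = {}" "\<And>a b. a \<in> A \<Longrightarrow> b \<in> B \<Longrightarrow> E a b"
  shows "sph E (i + j) (A \<union> B)"
  using assms
proof (induction "i + j" arbitrary: i j A B rule: less_induct)
  case less
  show ?case
  proof (cases i)
    case 0 then show ?thesis using less.prems by simp
  next
    case (Suc i')
    show ?thesis
    proof (cases j)
      case 0 then show ?thesis using less.prems by simp
    next
      case j: (Suc j')
      have fin: "finite A" "finite B" using less.prems(1,2) sph_finite by blast+
      have a: "sph E (i' + j) (nbrs E (A \<union> B) a)" if "a \<in> A" for a
      proof -
        have eq: "nbrs E (A \<union> B) a = nbrs E A a \<union> B" using less.prems that by (auto simp: nbrs_def)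
        show ?thesis unfolding eq
          using less.prems that Suc by (intro less.hyps) (auto simp: nbrs_def)
      qed
      have b: "sph E (i + j') (nbrs E (A \<union> B) b)" if "b \<in> B" for b
      proof -
        have eq: "nbrs E (A \<union> B) b = A \<union> nbrs E B b"
          using less.prems that sym by (auto simp: nbrs_def)
        show ?thesis unfolding eq
          using less.prems that j by (intro less.hyps) (auto simp: nbrs_def)
      qed
      obtain v where v: "v \<in> A" "contractible E (A - {v})" using less.prems Suc by auto
      have "A \<union> B - {v} = (A - {v}) \<union> B" using v less.prems by auto
      moreover have "contractible E ((A - {v}) \<union> B)"
        using v less.prems fin by (intro contr_join) auto
      ultimately have "contractible E (A \<union> B - {v})" by simp
      then have "\<exists>v\<in>A \<union> B. contractible E (A \<union> B - {v})" using v by blast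
      moreover have "i + j = Suc (i' + j)" "i' + j = i + j'" using Suc j by auto
      moreover have "sph E (i' + j) (nbrs E (A \<union> B) w)" if "w \<in> A \<union> B" for w
        using that a b \<open>i' + j = i + j'\<close> by (elim UnE) simp_all
      ultimately show ?thesis using fin v(1) by (simp only: sph.simps) blast
    qed
  qed
qed

end

definition comparable :: "'a set \<Rightarrow> 'a set \<Rightarrow> bool" where
  "comparable y z \<longleftrightarrow> y \<subset> z \<or> z \<subset> y"

interpretation comparable: sgraph comparable
  by unfold_locales (auto simp: comparable_def)

text \<open>
  The subdivided boundary of a simplex is a sphere.  The sets comparable to \<open>y\<close> are the proper
  subsets of \<open>y\<close> and the sets between \<open>y\<close> and \<open>x\<close>; the latter correspond to the proper subsets
  of \<open>x - y\<close>, and the two families form a join.  For the contractibility, fix \<open>a \<in> x\<close> and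
  delete \<open>x - {a}\<close>.  The other sets without \<open>a\<close> can then be removed from the largest to the
  smallest, as \<open>y\<close> has the apex \<open>insert a y\<close> in its unit sphere, and the sets containing \<open>a\<close>
  form a cone with apex \<open>{a}\<close>.
\<close>
lemma sph_proper_subsets:
  "finite x \<Longrightarrow> x \<noteq> {} \<Longrightarrow> sph comparable (card x - 1) {y. y \<noteq> {} \<and> y \<subset> x}"
proof (induction "card x" arbitrary: x rule: less_induct)
  case (less x)
  let ?S = "{y. y \<noteq> {} \<and> y \<subset> x}"
  have fin: "finite ?S" using less.prems by (auto intro: finite_subset[of _ "Pow x"])
  obtain a where a: "a \<in> x" using less.prems by blast
  show ?case
  proof (cases "x = {a}")
    case True
    then have "?S = {}" by auto
    then show ?thesis using True by simp
  next
    case False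
    then have a': "{a} \<in> ?S" "x - {a} \<in> ?S" using a by auto
    have "card x \<noteq> 0" "card x \<noteq> 1"
      using less.prems False a by (auto simp: card_1_singleton_iff)
    then obtain m where m: "card x = Suc (Suc m)" by (metis One_nat_def not0_implies_Suc)
    have "sph comparable m (nbrs comparable ?S y)" if y: "y \<in> ?S" for y
    proof -
      have fy: "finite y" using y less.prems finite_subset by blast
      have cy: "card y < card x" using y less.prems by (auto intro: psubset_card_mono)
      have cxy: "card (x - y) = card x - card y" using y fy by (intro card_Diff_subset) auto
      have cy0: "card y > 0" using y fy by auto
      let ?U = "{z. y \<subset> z \<and> z \<subset> x}"
      have "sph comparable (card (x - y) - 1) {z. z \<noteq> {} \<and> z \<subset> x - y}"
        using less.prems y cxy cy cy0 by (intro less.hyps) auto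
      moreover have "graph_iso (\<lambda>z. y \<union> z) comparable {z. z \<noteq> {} \<and> z \<subset> x - y} comparable ?U"
        unfolding graph_iso_def
      proof (intro conjI ballI)
        show "bij_betw (\<lambda>z. y \<union> z) {z. z \<noteq> {} \<and> z \<subset> x - y} ?U"
          by (rule bij_betw_byWitness[where f' = "\<lambda>z. z - y"]) (use y in auto)
      qed (auto simp: comparable_def)
      ultimately have U: "sph comparable (card (x - y) - 1) ?U" by (rule graph_iso_sph)
      have D: "sph comparable (card y - 1) {z. z \<noteq> {} \<and> z \<subset> y}"
        using less.hyps[of y] cy fy y by auto
      have "sph comparable ((card y - 1) + (card (x - y) - 1)) ({z. z \<noteq> {} \<and> z \<subset> y} \<union> ?U)"
        by (rule comparable.sph_join[OF D U]) (auto simp: comparable_def)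
      moreover have "nbrs comparable ?S y = {z. z \<noteq> {} \<and> z \<subset> y} \<union> ?U"
        using y by (auto simp: nbrs_def comparable_def)
      moreover have "(card y - 1) + (card (x - y) - 1) = m" using m cxy cy cy0 by linarith
      ultimately show ?thesis by simp
    qed
    moreover have "contractible comparable (?S - {x - {a}})"
    proof (rule contr_dismantle[where B = "{y\<in>?S. a \<in> y}"])
      show "contractible comparable {y\<in>?S. a \<in> y}"
      proof (rule comparable.cone_contr[of _ "{a}"])
        show "finite {y\<in>?S. a \<in> y}" by (rule finite_subset[OF _ fin]) auto
      qed (use a' in \<open>auto simp: comparable_def\<close>)
      fix C assume C: "{y\<in>?S. a \<in> y} \<subset> C" "C \<subseteq> ?S - {x - {a}}"
      have finC: "finite C" by (rule finite_subset[OF _ fin]) (use C in blast)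
      let ?D = "C - {y\<in>?S. a \<in> y}"
      have "finite ?D" using finC by (rule finite_Diff)
      moreover have "?D \<noteq> {}" using C(1) by blast
      ultimately obtain y where y: "y \<in> ?D" and max: "\<forall>z\<in>?D. y \<subseteq> z \<longrightarrow> y = z"
        using finite_has_maximal[of ?D] by blast
      have "y \<in> ?S - {x - {a}}" using y C(2) by blast
      then have y': "y \<in> C" "y \<noteq> {}" "y \<subset> x" "y \<noteq> x - {a}" "a \<notin> y" using y by simp_all
      have "contractible comparable (nbrs comparable C y)"
      proof (rule comparable.cone_contr[of _ "insert a y"])
        have "insert a y \<subseteq> x" using y' a by blast
        moreover have "insert a y \<noteq> x" using y' by (metis Diff_insert_absorb)
        ultimately have "insert a y \<in> {y\<in>?S. a \<in> y}" by blast
        then have "insert a y \<in> C" by (rule subsetD[OF psubset_imp_subset[OF C(1)]])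
        then show "insert a y \<in> nbrs comparable C y"
          using y' by (auto simp: nbrs_def comparable_def)
        fix z assume z: "z \<in> nbrs comparable C y" "z \<noteq> insert a y"
        then consider "z \<subset> y" | "y \<subset> z" by (auto simp: nbrs_def comparable_def)
        then show "comparable (insert a y) z"
        proof cases
          case 1 then show ?thesis by (auto simp: comparable_def)
        next
          case 2
          then have "z \<notin> ?D" using max by blast
          then have "a \<in> z" using z by (simp add: nbrs_def)
          then show ?thesis using 2 z by (auto simp: comparable_def)
        qed
      qed (rule finite_subset[OF nbrs_subset finC])
      then show "\<exists>y\<in>?D. contractible comparable (nbrs comparable C y)" using y by blast
    qed (use fin a in auto)
    ultimately have "sph comparable (Suc m) ?S"
      using a' fin by (simp only: sph.simps) blast
    then show ?thesis using m by simp
  qed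
qed

lemma sph_boundary:
  assumes "graph_iso h F L comparable {y. y \<noteq> {} \<and> y \<subset> x}" "finite x" "x \<noteq> {}"
  shows "sph F (card x - 1) L"
  using graph_iso_sph[OF sph_proper_subsets[OF assms(2,3)] graph_iso_inv[OF assms(1)]] .

section \<open>Refinements of a graph with a marked vertex\<close>
definition clique :: "('a \<Rightarrow> 'a \<Rightarrow> bool) \<Rightarrow> 'a set \<Rightarrow> 'a set \<Rightarrow> bool" where
  "clique E V x \<longleftrightarrow> x \<subseteq> V \<and> x \<noteq> {} \<and> finite x \<and> (\<forall>a\<in>x. \<forall>b\<in>x. a \<noteq> b \<longrightarrow> E a b)"

text \<open>
  Apart from avoiding \<open>v\<close>, a bare set is a maximal clique with one vertex less than a facet.  It
  is neither an interior nor a boundary face, and yet it has to be a cell, since nothing else covers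
  it.  Bare sets appear when vertices of a sphere are deleted.
\<close>
definition bare :: "('a \<Rightarrow> 'a \<Rightarrow> bool) \<Rightarrow> 'a set \<Rightarrow> nat \<Rightarrow> 'a \<Rightarrow> 'a set \<Rightarrow> bool" where
  "bare E V n v x \<longleftrightarrow> v \<notin> x \<and> clique E V x \<and> card x + 1 = n \<and> (\<forall>w\<in>V. clique E V (insert w x) \<longrightarrow> w \<in> x)"

text \<open>
  If \<open>v\<close> is a vertex, then its star is collapsed to the single cell \<open>{v}\<close>.  The faces opposite to
  \<open>v\<close> in the facets containing \<open>v\<close> are the cells of size \<open>n - 1\<close> that avoid \<open>v\<close> and are not
  bare; if \<open>V\<close> is a sphere with facets of size \<open>n\<close>, they are exactly the boundary faces of the
  ball \<open>V - {v}\<close>.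
\<close>
definition cell :: "('a \<Rightarrow> 'a \<Rightarrow> bool) \<Rightarrow> 'a set \<Rightarrow> nat \<Rightarrow> 'a \<Rightarrow> 'a set \<Rightarrow> bool" where
  "cell E V n v x \<longleftrightarrow> (x = {v} \<and> v \<in> V) \<or>
     (v \<notin> x \<and> clique E V x \<and> (card x + 2 \<le> n \<or> card x = n \<or> card x + 1 = n \<and> clique E V (insert v x))) \<or>
     bare E V n v x"

text \<open>
  The last clause joins two facets that share a face of codimension one.  It asks for a non-empty
  intersection since two isolated vertices (\<open>n = 1\<close>) share only the empty face, which is no
  simplex.
\<close>
definition cell_adj :: "('a \<Rightarrow> 'a \<Rightarrow> bool) \<Rightarrow> 'a set \<Rightarrow> nat \<Rightarrow> 'a \<Rightarrow> 'a set \<Rightarrow> 'a set \<Rightarrow> bool" where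
  "cell_adj E V n v x y \<longleftrightarrow> x \<subset> y \<or> y \<subset> x \<or>
     (x = {v} \<and> v \<notin> y \<and> clique E V (insert v y)) \<or> (y = {v} \<and> v \<notin> x \<and> clique E V (insert v x)) \<or>
     (card x = n \<and> card y = n \<and> x \<inter> y \<noteq> {} \<and> card (x \<inter> y) + 1 = n)"

text \<open>
  A refinement is given by a graph \<open>P\<close> and a map \<open>\<beta>\<close> naming the cell that each of its vertices
  stands for.  The indirection lets a facet serve as a proxy for one of its faces without being
  renamed.  Adjacency of two bare cells is left open, except that adjacent ones must share all
  but one of their vertices.
\<close>
definition model :: "('b \<Rightarrow> 'b \<Rightarrow> bool) \<Rightarrow> 'b set \<Rightarrow> ('b \<Rightarrow> 'a set) \<Rightarrow>
    ('a \<Rightarrow> 'a \<Rightarrow> bool) \<Rightarrow> 'a set \<Rightarrow> nat \<Rightarrow> 'a \<Rightarrow> bool" where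
  "model F P \<beta> E V n v \<longleftrightarrow> bij_betw \<beta> P {x. cell E V n v x} \<and>
     (\<forall>s\<in>P. \<forall>t\<in>P. if bare E V n v (\<beta> s) \<and> bare E V n v (\<beta> t)
        then F s t \<longrightarrow> card (\<beta> s \<inter> \<beta> t) + 2 = n else F s t \<longleftrightarrow> cell_adj E V n v (\<beta> s) (\<beta> t))"

lemma cell_adj_sym: "cell_adj E V n v x y \<longleftrightarrow> cell_adj E V n v y x"
  unfolding cell_adj_def by (simp only: Int_commute[of y x]) blast

lemma cliqueD:
  assumes "clique E V x" shows "x \<subseteq> V" "x \<noteq> {}" "finite x" "a \<in> x \<Longrightarrow> b \<in> x \<Longrightarrow> a \<noteq> b \<Longrightarrow> E a b"
  using assms by (auto simp: clique_def)

lemma clique_subset: "clique E V x \<Longrightarrow> y \<subseteq> x \<Longrightarrow> y \<noteq> {} \<Longrightarrow> clique E V y"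
  unfolding clique_def by (meson finite_subset order_trans subsetD)

lemma clique_delete: "clique E (V - {u}) x \<longleftrightarrow> clique E V x \<and> u \<notin> x"
  by (auto simp: clique_def)

lemma bareD:
  assumes "bare E V n v x"
  shows "v \<notin> x" "clique E V x" "card x + 1 = n" "w \<in> V \<Longrightarrow> clique E V (insert w x) \<Longrightarrow> w \<in> x"
  using assms by (auto simp: bare_def)

lemma bare_maximal: "bare E V n v x \<Longrightarrow> clique E V y \<Longrightarrow> \<not> x \<subset> y"
proof
  assume a: "bare E V n v x" "clique E V y" "x \<subset> y"
  then obtain w where w: "w \<in> y" "w \<notin> x" by blast
  then have "clique E V (insert w x)" using a by (auto intro!: clique_subset[OF a(2)])
  then show False using a w bareD(4)[of E V n v x w] cliqueD(1)[of E V y] by blast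
qed

lemma (in sgraph) clique_insert:
  assumes "clique E V x" "w \<in> V" "\<And>b. b \<in> x \<Longrightarrow> b \<noteq> w \<Longrightarrow> E w b"
  shows "clique E V (insert w x)"
  using assms sym unfolding clique_def by auto

text \<open>
  Three cliques of the same size that pairwise share all but one vertex have a common face of
  codimension one unless some vertex \<open>p\<close> completes the first of them to a larger clique: if the
  shared faces \<open>x \<inter> y\<close> and \<open>x \<inter> z\<close> differ, then \<open>y\<close> and \<open>z\<close> arise from \<open>x\<close> by
  exchanging different vertices for the same \<open>p\<close>, which is thus adjacent to all of \<open>x\<close>.
\<close>
lemma (in sgraph) clique_triangle:
  assumes clique: "clique E V x" "clique E V y" "clique E V z" and card: "card y = card x" "card z = card x"
    and meet: "card (x \<inter> y) + 1 = card x" "card (x \<inter> z) + 1 = card x" "card (y \<inter> z) + 1 = card x"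
    and neq: "x \<inter> y \<noteq> x \<inter> z"
  shows "\<exists>p\<in>V. p \<notin> x \<and> clique E V (insert p x)"
proof -
  have fin: "finite x" "finite y" "finite z" using clique cliqueD(3) by auto
  have "card (x - y) = 1" "card (x - z) = 1" "card (y - x) = 1" "card (z - x) = 1"
    using meet card fin by (simp_all add: card_Diff_subset_Int Int_commute)
  then obtain w w' p q where wp: "x - y = {w}" "x - z = {w'}" "y - x = {p}" "z - x = {q}"
    by (metis card_1_singletonE)
  have w: "w \<in> x" "w \<notin> y" "\<And>a. a \<in> x \<Longrightarrow> a \<noteq> w \<Longrightarrow> a \<in> y" using wp(1) by auto
  have w': "w' \<in> x" "w' \<notin> z" "\<And>a. a \<in> x \<Longrightarrow> a \<noteq> w' \<Longrightarrow> a \<in> z" using wp(2) by auto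
  have p: "p \<in> y" "p \<notin> x" "\<And>a. a \<in> y \<Longrightarrow> a \<noteq> p \<Longrightarrow> a \<in> x" using wp(3) by auto
  have q: "q \<in> z" "q \<notin> x" "\<And>a. a \<in> z \<Longrightarrow> a \<noteq> q \<Longrightarrow> a \<in> x" using wp(4) by auto
  have ww: "w \<noteq> w'"
  proof
    assume "w = w'"
    then have "x \<inter> y = x \<inter> z" using w w' by blast
    then show False using neq by contradiction
  qed
  have "p = q"
  proof (rule ccontr)
    assume "p \<noteq> q"
    then have "y \<inter> z \<subseteq> x - {w, w'}" using w(2) w'(2) p(3) q(3) by blast
    then have "card (y \<inter> z) \<le> card (x - {w, w'})" using fin by (intro card_mono) auto
    also have "\<dots> = card x - 2" using ww w(1) w'(1) fin by (subst card_Diff_subset) auto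
    finally show False using meet card_mono[of x "{w,w'}"] ww w(1) w'(1) fin by auto
  qed
  have "clique E V (insert p x)"
  proof (rule clique_insert)
    show "p \<in> V" using p cliqueD(1)[OF clique(2)] by blast
    fix b assume b: "b \<in> x" "b \<noteq> p"
    show "E p b"
    proof (cases "b = w")
      case True
      then show ?thesis using cliqueD(4)[OF clique(3), of p b] b q(1) w'(3) ww \<open>p = q\<close> by auto
    next
      case False
      then show ?thesis using cliqueD(4)[OF clique(2), of p b] b p(1) w(3) by auto
    qed
  qed (rule clique)
  then show ?thesis using p(2) cliqueD(1)[of E V "insert p x"] by blast
qed

locale refinement = base: sgraph E + ref: sgraph F
  for E :: "'a \<Rightarrow> 'a \<Rightarrow> bool" and F :: "'b \<Rightarrow> 'b \<Rightarrow> bool" +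
  fixes P :: "'b set" and \<beta> :: "'b \<Rightarrow> 'a set" and V :: "'a set" and n :: nat and v :: 'a
  assumes finV: "finite V" and bound: "clique E V x \<Longrightarrow> card x \<le> n" and model: "model F P \<beta> E V n v"
begin

abbreviation "K \<equiv> clique E V"
abbreviation "bar \<equiv> bare E V n v"
abbreviation "cel \<equiv> cell E V n v"
abbreviation "adj \<equiv> cell_adj E V n v"

lemma bij: "bij_betw \<beta> P {x. cel x}"
  using model by (simp add: model_def)

lemma cell_of: "s \<in> P \<Longrightarrow> cel (\<beta> s)"
  using bij_betwE[OF bij] by simp

lemma inj: "s \<in> P \<Longrightarrow> t \<in> P \<Longrightarrow> \<beta> s = \<beta> t \<Longrightarrow> s = t"
  using inj_onD[OF bij_betw_imp_inj_on[OF bij]] by simp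

lemma ex_cell: assumes "cel x" shows "\<exists>s\<in>P. \<beta> s = x"
proof -
  have "x \<in> \<beta> ` P" using bij_betw_imp_surj_on[OF bij] assms by simp
  then show ?thesis by (metis imageE)
qed

lemma model_adj: "s \<in> P \<Longrightarrow> t \<in> P \<Longrightarrow> if bar (\<beta> s) \<and> bar (\<beta> t)
        then F s t \<longrightarrow> card (\<beta> s \<inter> \<beta> t) + 2 = n else F s t \<longleftrightarrow> adj (\<beta> s) (\<beta> t)"
  using model unfolding model_def by (elim conjE) (drule bspec, assumption, drule bspec)

lemma adj_iff: "s \<in> P \<Longrightarrow> t \<in> P \<Longrightarrow> \<not> (bar (\<beta> s) \<and> bar (\<beta> t)) \<Longrightarrow> F s t \<longleftrightarrow> adj (\<beta> s) (\<beta> t)"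
  using model_adj[of s t] by (simp only: if_False)

lemma bare_adj: "s \<in> P \<Longrightarrow> t \<in> P \<Longrightarrow> bar (\<beta> s) \<Longrightarrow> bar (\<beta> t) \<Longrightarrow> F s t \<Longrightarrow> card (\<beta> s \<inter> \<beta> t) + 2 = n"
  using model_adj[of s t] by simp

lemma clique_singleton: "w \<in> V \<Longrightarrow> K {w}"
  by (simp add: clique_def)

lemma cell_clique: "cel x \<Longrightarrow> K x"
  using clique_singleton by (auto simp: cell_def bare_def)

lemma cell_v: "cel x \<Longrightarrow> v \<in> x \<Longrightarrow> x = {v}"
  by (auto simp: cell_def bare_def)

lemma clique_of: "s \<in> P \<Longrightarrow> K (\<beta> s)"
  using cell_of cell_clique by blast

lemma finP: "finite P"
proof -
  have "{x. cel x} \<subseteq> Pow V" using cliqueD(1)[OF cell_clique] by blast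
  then have "finite {x. cel x}" by (rule finite_subset) (simp add: finV)
  then show ?thesis using bij_betw_finite[OF bij] by simp
qed

lemma facet_maximal: assumes "K x" "K y" "card x = n" shows "\<not> x \<subset> y"
proof
  assume "x \<subset> y"
  then have "card x < card y" using cliqueD(3)[OF assms(2)] by (rule psubset_card_mono[rotated])
  then show False using bound[OF assms(2)] assms(3) by simp
qed

lemma no_bigger: "K x \<Longrightarrow> card x = n \<Longrightarrow> w \<notin> x \<Longrightarrow> \<not> K (insert w x)"
  using facet_maximal[of x "insert w x"] by blast

text \<open>
  The facet \<open>x\<close> is the only one above its face \<open>x - {u}\<close>, which therefore becomes bare when
  \<open>u\<close> is deleted.
\<close>
definition proxy :: "'a \<Rightarrow> 'a set \<Rightarrow> bool" where
  "proxy u x \<longleftrightarrow> u \<in> x \<and> card x = n \<and> bare E (V - {u}) n v (x - {u})"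

lemma small_cell: "K x \<Longrightarrow> v \<notin> x \<Longrightarrow> card x + 2 \<le> n \<Longrightarrow> cel x"
  and facet_cell: "K x \<Longrightarrow> v \<notin> x \<Longrightarrow> card x = n \<Longrightarrow> cel x"
  and bdry_cell: "K x \<Longrightarrow> v \<notin> x \<Longrightarrow> card x + 1 = n \<Longrightarrow> K (insert v x) \<Longrightarrow> cel x"
  by (auto simp: cell_def)

lemma facet_not_bare: "card x = n \<Longrightarrow> \<not> bar x"
  by (auto simp: bare_def)

lemma bdry_not_bare: "K (insert v x) \<Longrightarrow> \<not> bar x"
  using cliqueD(1)[of E V "insert v x"] by (auto simp: bare_def)

section \<open>Deleting a vertex of the refined graph\<close>
text \<open>
  The cells avoiding \<open>u\<close>, together with the proxies, form a refinement of the graph without \<open>u\<close>.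
  Two adjacent proxies are facets that share a face of codimension one containing \<open>u\<close>, so the
  faces that they stand for share all but one of their vertices, as a model requires.
\<close>
lemma delete_model:
  assumes u: "u \<in> V" "u \<noteq> v"
  shows "model F {s\<in>P. u \<notin> \<beta> s \<or> proxy u (\<beta> s)} (\<lambda>s. \<beta> s - {u}) E (V - {u}) n v"
proof -
  let ?B = "{s\<in>P. u \<notin> \<beta> s \<or> proxy u (\<beta> s)}"
  let ?bar = "bare E (V - {u}) n v"
  let ?cel = "cell E (V - {u}) n v"
  have bareI: "?bar x" if "bar x" "u \<notin> x" for x
    using that by (simp add: bare_def clique_delete)
  have K': "clique E (V - {u}) x \<longleftrightarrow> K x \<and> u \<notin> x" for x by (rule clique_delete)
  have bareE: "bar x" if "?bar x" "cel x" "u \<notin> x" for x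
  proof (rule ccontr)
    assume nb: "\<not> bar x"
    have x: "v \<notin> x" "card x + 1 = n" using bareD[OF that(1)] by auto
    then have "x \<noteq> {v}" by blast
    then have "K (insert v x)" using that(2) x nb unfolding cell_def by linarith
    moreover have "v \<in> V - {u}" using cliqueD(1)[OF calculation] u by blast
    ultimately have "v \<in> x" using bareD(4)[OF that(1), of v] u that(3) unfolding K' by simp
    then show False using x(1) by contradiction
  qed
  \<comment> \<open>the face below a proxy is no cell of the old graph\<close>
  have below: "\<not> cel (\<beta> t - {u})" if "t \<in> P" "proxy u (\<beta> t)" for t
  proof
    assume c: "cel (\<beta> t - {u})"
    have "insert u (\<beta> t - {u}) = \<beta> t" using that by (auto simp: proxy_def)
    moreover have "bar (\<beta> t - {u})" using bareE[OF _ c] that by (auto simp: proxy_def)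
    ultimately show False using bareD(4)[of E V n v "\<beta> t - {u}" u] u clique_of[OF that(1)] by auto
  qed
  have v_proxy: "v \<notin> \<beta> t" if "proxy u (\<beta> t)" for t
    using that u by (auto simp: proxy_def bare_def)
  have "inj_on (\<lambda>s. \<beta> s - {u}) ?B"
  proof (rule inj_onI)
    fix s t assume s: "s \<in> ?B" and t: "t \<in> ?B" and eq: "\<beta> s - {u} = \<beta> t - {u}"
    have "u \<in> \<beta> s \<longleftrightarrow> u \<in> \<beta> t"
    proof -
      have "\<not> (u \<in> \<beta> a \<and> u \<notin> \<beta> b)" if "a \<in> ?B" "b \<in> ?B" "\<beta> a - {u} = \<beta> b - {u}" for a b
      proof
        assume c: "u \<in> \<beta> a \<and> u \<notin> \<beta> b"
        then have "\<beta> a - {u} = \<beta> b" "proxy u (\<beta> a)" "a \<in> P" "b \<in> P" using that by auto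
        then show False using below[of a] cell_of[of b] by simp
      qed
      from this[OF s t eq] this[OF t s eq[symmetric]] show ?thesis by blast
    qed
    then have "\<beta> s = \<beta> t" using eq by blast
    then show "s = t" using inj s t by blast
  qed
  moreover have "(\<lambda>s. \<beta> s - {u}) ` ?B = {x. ?cel x}"
  proof (intro equalityI subsetI)
    fix x assume "x \<in> (\<lambda>s. \<beta> s - {u}) ` ?B"
    then obtain s where s: "s \<in> P" "u \<notin> \<beta> s \<or> proxy u (\<beta> s)" "x = \<beta> s - {u}" by blast
    show "x \<in> {x. ?cel x}"
    proof (cases "u \<in> \<beta> s")
      case True
      then show ?thesis using s by (auto simp: proxy_def cell_def)
    next
      case False
      then have x: "x = \<beta> s" using s by auto
      have "cel x" using cell_of s x by simp
      then show ?thesis using bareI[of x] False u x unfolding cell_def K' by auto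
    qed
  next
    fix x assume "x \<in> {x. ?cel x}"
    then have x: "?cel x" by simp
    then have ux: "u \<notin> x" using u by (auto simp: cell_def bare_def K')
    show "x \<in> (\<lambda>s. \<beta> s - {u}) ` ?B"
    proof (cases "cel x")
      case True
      then obtain s where "s \<in> P" "\<beta> s = x" using ex_cell by blast
      then show ?thesis using ux by (intro image_eqI[of _ _ s]) auto
    next
      case False
      then have b: "?bar x" using x by (auto simp: cell_def K')
      have "\<not> bar x" using False by (auto simp: cell_def)
      then have "K (insert u x)"
        using b ux unfolding bare_def K' by (metis DiffI insertE singletonD)
      moreover have "card (insert u x) = n" using b ux by (simp add: bare_def clique_def)
      moreover have "v \<notin> insert u x" using b u by (auto simp: bare_def)
      ultimately have "cel (insert u x)" by (intro facet_cell)
      then obtain s where s: "s \<in> P" "\<beta> s = insert u x" using ex_cell by blast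
      then have "proxy u (\<beta> s)" using b ux \<open>card (insert u x) = n\<close> by (simp add: proxy_def)
      then show ?thesis using s ux by (intro image_eqI[of _ _ s]) auto
    qed
  qed
  moreover have "if ?bar (\<beta> s - {u}) \<and> ?bar (\<beta> t - {u})
        then F s t \<longrightarrow> card ((\<beta> s - {u}) \<inter> (\<beta> t - {u})) + 2 = n
        else F s t \<longleftrightarrow> cell_adj E (V - {u}) n v (\<beta> s - {u}) (\<beta> t - {u})"
    if s: "s \<in> ?B" and t: "t \<in> ?B" for s t
  proof -
    \<comment> \<open>a cell that avoids \<open>u\<close> against a proxy; adjacency being symmetric, one order suffices\<close>
    have mixed: "(?bar x \<longrightarrow> \<not> adj x y) \<and> (\<not> ?bar x \<longrightarrow> (adj x y \<longleftrightarrow> cell_adj E (V - {u}) n v x (y - {u})))"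
      if x: "cel x" "u \<notin> x" and y: "y = \<beta> r" "r \<in> P" "proxy u y" for x y r
    proof -
      let ?f = "y - {u}"
      have uy: "u \<in> y" and cy: "card y = n" and bf: "?bar ?f" using y by (auto simp: proxy_def)
      have Ky: "K y" and fy: "finite y" using clique_of y cliqueD(3) by auto
      have Kx: "K x" using cell_clique x by simp
      have xf: "x \<noteq> ?f" 
      proof
        assume "x = ?f"
        then show False using below[of r, folded y(1), OF y(2,3)] x(1) by metis
      qed
      have cf: "card ?f + 1 = n" by (rule bareD(3)[OF bf])
      have fx: "\<not> ?f \<subset> x" using bare_maximal[OF bf, of x] Kx x K' by auto
      have vy: "v \<notin> y" using v_proxy y by auto
      have 1: "x \<subset> y \<longleftrightarrow> x \<subset> ?f" using x uy xf by blast
      have 2: "\<not> y \<subset> x" using uy x by blast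
      have 3: "\<not> (x = {v} \<and> v \<notin> y \<and> K (insert v y))" using no_bigger[OF Ky cy vy] by blast
      have 4: "y \<noteq> {v}" "?f \<noteq> {v}" using vy by auto
      have 5: "\<not> (card x = n \<and> card y = n \<and> x \<inter> y \<noteq> {} \<and> card (x \<inter> y) + 1 = n)"
      proof
        assume a: "card x = n \<and> card y = n \<and> x \<inter> y \<noteq> {} \<and> card (x \<inter> y) + 1 = n"
        have "x \<inter> y \<subseteq> ?f" using x by blast
        moreover have "card (x \<inter> y) = card ?f" using a cf by linarith
        moreover have "finite ?f" using fy by simp
        ultimately have "x \<inter> y = ?f" by (intro card_subset_eq) simp_all
        then have "?f \<subseteq> x" by blast
        then show False using fx xf by blast
      qed
      have 6: "\<not> (x = {v} \<and> v \<notin> ?f \<and> clique E (V - {u}) (insert v ?f))"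
      proof
        assume h: "x = {v} \<and> v \<notin> ?f \<and> clique E (V - {u}) (insert v ?f)"
        then have "v \<in> V - {u}" using cliqueD(1)[of E "V - {u}" "insert v ?f"] by simp
        then show False using bareD(4)[OF bf, of v] h by simp
      qed
      have a: "adj x y \<longleftrightarrow> x \<subset> ?f" unfolding cell_adj_def using 1 2 3 4(1) 5 by metis
      have b: "cell_adj E (V - {u}) n v x ?f \<longleftrightarrow> x \<subset> ?f" 
      proof -
        have "\<not> (card x = n \<and> card ?f = n)" using cf by linarith
        then show ?thesis using fx 4 6 unfolding cell_adj_def by blast
      qed
      have "\<not> (?bar x \<and> x \<subset> ?f)" using bare_maximal[of E "V - {u}" n v x ?f] bareD(2)[OF bf] by blast
      then show ?thesis using a b by blast
    qed
    have Fsym: "F s t \<longleftrightarrow> F t s" using ref.sym[of s t] ref.sym[of t s] by (rule iffI)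
    have nb: "\<not> bar (\<beta> r)" if "r \<in> P" "proxy u (\<beta> r)" for r
      using that(2) facet_not_bare[of "\<beta> r"] unfolding proxy_def by blast
    have pb: "?bar (\<beta> r - {u})" if "proxy u (\<beta> r)" for r using that by (simp add: proxy_def)
    consider "u \<notin> \<beta> s" "u \<notin> \<beta> t" | "u \<notin> \<beta> s" "proxy u (\<beta> t)" "u \<in> \<beta> t"
      | "proxy u (\<beta> s)" "u \<notin> \<beta> t" "u \<in> \<beta> s" | "proxy u (\<beta> s)" "proxy u (\<beta> t)"
      using s t by blast
    then show ?thesis
    proof cases
      case 1
      then have e: "\<beta> s - {u} = \<beta> s" "\<beta> t - {u} = \<beta> t" by auto
      have b: "?bar (\<beta> s) \<longleftrightarrow> bar (\<beta> s)" "?bar (\<beta> t) \<longleftrightarrow> bar (\<beta> t)"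
        using 1 s t bareI bareE cell_of by auto
      have "cell_adj E (V - {u}) n v (\<beta> s) (\<beta> t) \<longleftrightarrow> adj (\<beta> s) (\<beta> t)"
        using 1 u unfolding cell_adj_def K' by auto
      then show ?thesis unfolding e b using adj_iff[of s t] bare_adj[of s t] s t by auto
    next
      case 2
      then have e: "\<beta> s - {u} = \<beta> s" by auto
      show ?thesis using mixed[of "\<beta> s" "\<beta> t" t] adj_iff[of s t] nb[of t] pb[of t] 2 s t cell_of[of s]
        unfolding e by auto
    next
      case 3
      then have e: "\<beta> t - {u} = \<beta> t" by auto
      show ?thesis using mixed[of "\<beta> t" "\<beta> s" s] adj_iff[of t s] nb[of s] pb[of s] 3 s t cell_of[of t]
        unfolding e Fsym cell_adj_sym[of _ _ _ _ "\<beta> s - {u}"] by auto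
    next
      case 4
      have "card ((\<beta> s - {u}) \<inter> (\<beta> t - {u})) + 2 = n" if "F s t"
      proof -
        have a: "adj (\<beta> s) (\<beta> t)" using adj_iff[of s t] nb[of s] 4 s t that by auto
        have c: "card (\<beta> s) = n" "card (\<beta> t) = n" "u \<in> \<beta> s \<inter> \<beta> t" using 4 by (auto simp: proxy_def)
        have f: "finite (\<beta> s \<inter> \<beta> t)" using cliqueD(3)[OF clique_of] s by blast
        have "card (\<beta> s \<inter> \<beta> t) + 1 = n"
          using a c facet_maximal[OF clique_of clique_of, of s t] facet_maximal[OF clique_of clique_of, of t s]
            s t v_proxy[of s] v_proxy[of t] 4 unfolding cell_adj_def by auto
        moreover have "(\<beta> s - {u}) \<inter> (\<beta> t - {u}) = \<beta> s \<inter> \<beta> t - {u}" by blast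
        moreover have "card (\<beta> s \<inter> \<beta> t) > 0" using f c by (auto simp: card_gt_0_iff)
        ultimately show ?thesis using f c by simp
      qed
      then show ?thesis using pb 4 by auto
    qed
  qed
  ultimately show ?thesis unfolding model_def bij_betw_def by blast
qed

lemma adjI_sub: "x \<subset> y \<or> y \<subset> x \<Longrightarrow> adj x y"
  by (auto simp: cell_adj_def)

text \<open>
  The remaining cells containing \<open>u\<close> can be removed by increasing size.  The assumption \<open>far\<close>
  excludes neighbours \<open>s\<close>, \<open>t\<close> of equal size that have only \<open>u\<close> in common: the argument below
  needs a cell inside the rest of their intersection.
\<close>
lemma delete_contr:
  assumes u: "u \<in> V" "u \<noteq> v" and A: "A \<subseteq> P" "{s\<in>P. u \<notin> \<beta> s \<or> proxy u (\<beta> s)} \<subseteq> A"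
    and no_u: "\<And>s. s \<in> A \<Longrightarrow> \<beta> s \<noteq> {u}"
    and far: "\<And>s t. s \<in> A \<Longrightarrow> t \<in> A \<Longrightarrow> F s t \<Longrightarrow> card (\<beta> s) = card (\<beta> t) \<Longrightarrow>
      u \<in> \<beta> s \<Longrightarrow> u \<in> \<beta> t \<Longrightarrow> \<beta> s \<inter> \<beta> t \<noteq> {u}"
    and contractible: "contractible F {s\<in>P. u \<notin> \<beta> s \<or> proxy u (\<beta> s)}"
  shows "contractible F A"
proof (rule contr_dismantle[OF _ A(2) contractible])
  show "finite A" using A(1) finP by (rule finite_subset)
  define B where "B = {s\<in>P. u \<notin> \<beta> s \<or> proxy u (\<beta> s)}"
  fix C assume C0: "{s\<in>P. u \<notin> \<beta> s \<or> proxy u (\<beta> s)} \<subset> C" "C \<subseteq> A"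
  have BC: "B \<subseteq> C" and neBC: "B \<noteq> C" and CP: "C \<subseteq> P" using C0 A(1) unfolding B_def by auto
  obtain k where "k \<in> C - B" using BC neBC by blast
  then obtain s where sD: "s \<in> C - B" and smin: "\<And>t. t \<in> C - B \<Longrightarrow> card (\<beta> s) \<le> card (\<beta> t)"
    using ex_has_least_nat[of "\<lambda>s. s \<in> C - B" k "\<lambda>s. card (\<beta> s)"] by blast
  have sC: "s \<in> C" and sP: "s \<in> P" and sA: "s \<in> A" using sD CP C0(2) by auto
  have CA: "t \<in> A" if "t \<in> C" for t using that C0(2) by blast
  define x where "x = \<beta> s"
  define g where "g = x - {u}"
  have ux: "u \<in> x" and npx: "\<not> proxy u x" using sD sP unfolding B_def x_def by auto
  have cx: "cel x" and Kx: "K x" using cell_of[OF sP] clique_of[OF sP] unfolding x_def by auto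
  have finx: "finite x" using cliqueD(3)[OF Kx] .
  have xu: "x \<noteq> {u}" using no_u[OF sA] unfolding x_def .
  have vx: "v \<notin> x" using cell_v[OF cx] ux u by blast
  have gne: "g \<noteq> {}" and gx: "g \<subset> x" and ug: "u \<notin> g" and vg: "v \<notin> g" and xg: "x = insert u g"
    using ux xu vx unfolding g_def by auto
  have fing: "finite g" using finx gx finite_subset by blast
  have cg: "card x = card g + 1" using xg ug fing by simp
  have cg0: "card g \<ge> 1" using gne fing by (simp add: Suc_le_eq card_gt_0_iff)
  have Kg: "K g" using clique_subset[OF Kx _ gne] gx by blast
  have cxn: "card x \<le> n" using bound[OF Kx] .
  define L where "L = nbrs F C s"
  have finL: "finite L" unfolding L_def using finite_subset[OF subset_trans[OF nbrs_subset CP] finP] .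
  have LD: "t \<in> C" "t \<in> P" "F s t" if "t \<in> L" for t using that CP unfolding L_def nbrs_def by auto
  have LI: "t \<in> L" if "t \<in> P" "u \<notin> \<beta> t" "F s t" for t
    using that BC unfolding L_def nbrs_def B_def by auto
  \<comment> \<open>faces of \<open>x\<close> that contain \<open>u\<close> are smaller than \<open>x\<close> and hence gone already\<close>
  have down: "\<beta> t \<subseteq> g" if "t \<in> C" "\<beta> t \<subset> x" for t
  proof -
    have less: "card (\<beta> t) < card x" using psubset_card_mono[OF finx that(2)] .
    then have "t \<in> B" using smin[of t] that(1) unfolding x_def by force
    moreover have "\<not> proxy u (\<beta> t)" using less cxn unfolding proxy_def by linarith
    ultimately have "u \<notin> \<beta> t" unfolding B_def by blast
    then show ?thesis using that(2) unfolding g_def by blast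
  qed
  have nb_sub: "\<not> bar y" if "y \<subset> x" for y using bare_maximal[OF _ Kx] that by blast
  have F_sub: "F a t" if "a \<in> P" "t \<in> P" "\<not> bar (\<beta> a)" "\<beta> a \<subset> \<beta> t \<or> \<beta> t \<subset> \<beta> a" for a t
    using adj_iff[OF that(1,2)] adjI_sub[OF that(4)] that(3) by blast
  have sub_cell: "\<exists>t\<in>L. \<beta> t = y" if y: "y \<subseteq> g" "y \<noteq> {}" "cel y" for y
  proof -
    obtain t where t: "t \<in> P" "\<beta> t = y" using ex_cell[OF y(3)] by blast
    have yx: "y \<subset> x" using y gx by blast
    have "F t s" using F_sub[OF t(1) sP] nb_sub[OF yx] yx t(2) unfolding x_def by blast
    then have "t \<in> L" using LI[OF t(1)] ref.sym ug y t by blast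
    then show ?thesis using t by blast
  qed
  have contrL: "contractible F L"
  proof (cases "bar x \<or> card x = n")
    \<comment> \<open>a small cell, or a face opposite to \<open>v\<close>: the unit sphere is a cone with apex \<open>x - {u}\<close>\<close>
    case False
    then have cxs: "card x + 1 \<le> n" and bx: "card x + 2 \<le> n \<or> K (insert v x)"
      using cx vx unfolding cell_def by auto
    have nbx: "\<not> bar (\<beta> s)" using False unfolding x_def by blast
    have "cel g" using small_cell[OF Kg vg] cxs cg by linarith
    then obtain a where a: "a \<in> L" "\<beta> a = g" using sub_cell[OF _ gne] by blast
    show ?thesis
    proof (rule ref.cone_contr[OF finL a(1)])
      fix t assume t: "t \<in> L" "t \<noteq> a"
      define y where "y = \<beta> t"
      have yg: "y \<noteq> g" using inj[OF LD(2)[OF t(1)] LD(2)[OF a(1)]] t(2) a(2) unfolding y_def by blast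
      have "adj x y" using adj_iff[OF sP LD(2)[OF t(1)]] LD(3)[OF t(1)] nbx unfolding x_def y_def by blast
      then consider "x \<subset> y" | "y \<subset> x" | "y = {v}" "K (insert v x)"
        unfolding cell_adj_def using vx False by blast
      then have "adj g y"
      proof cases
        case 1 then show ?thesis using gx by (intro adjI_sub) blast
      next
        case 2 then show ?thesis using down[OF LD(1)[OF t(1)]] yg unfolding y_def by (intro adjI_sub) blast
      next
        case 3
        then have "K (insert v g)" using clique_subset[OF 3(2), of "insert v g"] gx by blast
        then show ?thesis using 3 vg unfolding cell_adj_def by blast
      qed
      then show "F a t" using adj_iff[OF LD(2)[OF a(1)] LD(2)[OF t(1)]] nb_sub[OF gx] a(2)
        unfolding y_def by simp
    qed
  next
    case True
    have maxi: "\<not> K (insert w x)" if "w \<notin> x" for w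
    proof
      assume "K (insert w x)"
      moreover from this have "w \<in> V" using cliqueD(1) by blast
      ultimately show False using True no_bigger[OF Kx _ that] bareD(4)[of E V n v x w] that by blast
    qed
    have not_sub: "\<not> x \<subset> y" if Ky: "K y" for y
    proof
      assume xy: "x \<subset> y"
      then obtain w where "w \<in> y" "w \<notin> x" by blast
      then show False using maxi[of w] clique_subset[OF Ky, of "insert w x"] xy by blast
    qed
    \<comment> \<open>besides faces of \<open>x - {u}\<close>, only cells of the same kind that share a face of codimension
      one with \<open>x\<close> are left around \<open>x\<close>\<close>
    have cls: "\<beta> t \<subseteq> g \<or> (card (\<beta> t) = card x \<and> card (x \<inter> \<beta> t) + 1 = card x \<and> (bar (\<beta> t) \<longleftrightarrow> bar x))"
      if t: "t \<in> L" for t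
    proof (cases "bar x \<and> bar (\<beta> t)")
      case b: True
      have "card (x \<inter> \<beta> t) + 2 = n" using bare_adj[OF sP LD(2)[OF t]] b LD(3)[OF t] unfolding x_def by blast
      moreover have "card x + 1 = n" "card (\<beta> t) + 1 = n" using b bareD(3)[of E V n v] by auto
      ultimately show ?thesis using b by simp
    next
      case nb: False
      have "adj x (\<beta> t)" using adj_iff[OF sP LD(2)[OF t]] LD(3)[OF t] nb unfolding x_def by blast
      then consider "\<beta> t \<subset> x" | "card x = n" "card (\<beta> t) = n" "card (x \<inter> \<beta> t) + 1 = n"
        unfolding cell_adj_def using vx maxi[OF vx] not_sub[OF clique_of[OF LD(2)[OF t]]] by blast
      then show ?thesis
      proof cases
        case 1 then show ?thesis using down[OF LD(1)[OF t]] by blast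
      next
        case 2 then show ?thesis using facet_not_bare by simp
      qed
    qed
    \<comment> \<open>The apex is \<open>g = x - {u}\<close> if this is a cell.  Otherwise \<open>x\<close> is a facet, and as it is not
      a proxy, there is another facet above \<open>g\<close>, not containing \<open>u\<close>, which serves as the apex.\<close>
    have "\<exists>a\<in>L. \<not> bar (\<beta> a) \<and> (\<forall>t\<in>L. t \<noteq> a \<longrightarrow> \<beta> t \<subseteq> g \<longrightarrow> F a t) \<and>
        (\<forall>t\<in>L. t \<noteq> a \<longrightarrow> card (\<beta> t) = card x \<longrightarrow> x \<inter> \<beta> t = g \<longrightarrow> F a t)"
    proof (cases "cel g")
      case True
      then obtain a where a: "a \<in> L" "\<beta> a = g" using sub_cell[OF _ gne] by blast
      have nba: "\<not> bar (\<beta> a)" using nb_sub[OF gx] a(2) by simp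
      have "F a t" if t: "t \<in> L" "t \<noteq> a" "\<beta> t \<subseteq> g" for t
        using F_sub[OF LD(2)[OF a(1)] LD(2)[OF t(1)] nba] inj[OF LD(2)[OF a(1)] LD(2)[OF t(1)]] t a(2) by blast
      moreover have "F a t" if t: "t \<in> L" "t \<noteq> a" "card (\<beta> t) = card x" "x \<inter> \<beta> t = g" for t
      proof -
        have "g \<subseteq> \<beta> t" using t(4) by blast
        moreover have "\<beta> t \<noteq> g" using t(3) cg by auto
        ultimately show ?thesis using F_sub[OF LD(2)[OF a(1)] LD(2)[OF t(1)] nba] a(2) by blast
      qed
      ultimately show ?thesis using a nba by blast
    next
      case ncg: False
      have nbar: "\<not> bar x"
      proof
        assume "bar x"
        then have "card g + 2 = n" using bareD(3)[of E V n v x] cg by linarith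
        then show False using small_cell[OF Kg vg] ncg by simp
      qed
      then have cxn': "card x = n" using True by blast
      have "clique E (V - {u}) g" using Kg ug clique_delete[of E V u g] by blast
      then obtain w where w: "w \<in> V" "w \<noteq> u" "K (insert w g)" "w \<notin> g"
        using npx ux vg cxn' cg unfolding proxy_def bare_def g_def[symmetric] clique_delete by force
      have wv: "w \<noteq> v" using bdry_cell[OF Kg vg] w(3) ncg cg cxn' by auto
      define z where "z = insert w g"
      have vz: "v \<notin> z" and uz: "u \<notin> z" and gz: "g \<subset> z" using wv vg w ug unfolding z_def by auto
      have cz: "card z = n" using w(4) fing cg cxn' unfolding z_def by simp
      have Kz: "K z" using w(3) unfolding z_def .
      have finz: "finite z" using cliqueD(3)[OF Kz] .
      obtain a where a: "a \<in> P" "\<beta> a = z" using ex_cell[OF facet_cell[OF Kz vz cz]] by blast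
      have nba: "\<not> bar (\<beta> a)" using facet_not_bare cz a(2) by simp
      have xz: "x \<inter> z = g" using xg uz gz by blast
      have "adj z x" using xz cz cxn' cg gne unfolding cell_adj_def by (simp add: Int_commute)
      then have "F a s" using adj_iff[OF a(1) sP] nba a(2) unfolding x_def by simp
      then have aL: "a \<in> L" using LI[OF a(1)] uz a(2) ref.sym by blast
      have "F a t" if t: "t \<in> L" "\<beta> t \<subseteq> g" for t
        using F_sub[OF a(1) LD(2)[OF t(1)] nba] t(2) gz a(2) by blast
      moreover have "F a t" if t: "t \<in> L" "t \<noteq> a" "card (\<beta> t) = card x" "x \<inter> \<beta> t = g" for t
      proof -
        have neq: "\<beta> t \<noteq> z" using inj[OF LD(2)[OF t(1)] a(1)] t(2) a(2) by blast
        have cy: "card (\<beta> t) = n" using t(3) cxn' by simp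
        have "\<not> z \<subseteq> \<beta> t" using card_subset_eq[of "\<beta> t" z] cliqueD(3)[OF clique_of[OF LD(2)[OF t(1)]]] cy cz neq by metis
        then have "z \<inter> \<beta> t \<subset> z" by blast
        then have "card (z \<inter> \<beta> t) < n" using psubset_card_mono[OF finz] cz by metis
        moreover have g: "g \<subseteq> z \<inter> \<beta> t" using gz t(4) by blast
        then have "card g \<le> card (z \<inter> \<beta> t)" using finz by (intro card_mono) auto
        ultimately have "card (z \<inter> \<beta> t) + 1 = n" using cg cxn' by linarith
        then have "adj z (\<beta> t)" using cz cy g gne unfolding cell_adj_def by blast
        then show ?thesis using adj_iff[OF a(1) LD(2)[OF t(1)]] nba a(2) by simp
      qed
      ultimately show ?thesis using aL nba by blast
    qed
    then obtain a where a: "a \<in> L" "\<not> bar (\<beta> a)" and a1: "\<And>t. t \<in> L \<Longrightarrow> t \<noteq> a \<Longrightarrow> \<beta> t \<subseteq> g \<Longrightarrow> F a t"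
      and a2: "\<And>t. t \<in> L \<Longrightarrow> t \<noteq> a \<Longrightarrow> card (\<beta> t) = card x \<Longrightarrow> x \<inter> \<beta> t = g \<Longrightarrow> F a t"
      by blast
    show ?thesis
    proof (rule ref.near_cone_contr[OF finL a(1)])
      fix t assume t: "t \<in> L" "t \<noteq> a" "\<not> F a t"
      define y where "y = \<beta> t"
      have tP: "t \<in> P" and tA: "t \<in> A" using LD[OF t(1)] CA by auto
      have y: "card y = card x" "card (x \<inter> y) + 1 = card x" "bar y \<longleftrightarrow> bar x"
        using cls[OF t(1)] a1[OF t(1,2)] t(3) unfolding y_def by blast+
      have xyg: "x \<inter> y \<noteq> g" using a2[OF t(1,2)] y(1) t(3) unfolding y_def by blast
      have Ky: "K y" using clique_of[OF tP] unfolding y_def .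
      have finy: "finite y" using cliqueD(3)[OF Ky] .
      have uxy: "u \<in> x \<inter> y"
      proof (rule ccontr)
        assume "u \<notin> x \<inter> y"
        then have "x \<inter> y \<subseteq> g" unfolding g_def by blast
        moreover have "card (x \<inter> y) = card g" using y(2) cg by linarith
        ultimately show False using card_subset_eq[OF fing] xyg by metis
      qed
      have vy: "y \<noteq> {v}" using uxy u by blast
      \<comment> \<open>a neighbour that meets \<open>x\<close> in a face containing \<open>u\<close> has the local apex \<open>c\<close>\<close>
      have xyu: "x \<inter> y \<noteq> {u}" using far[OF sA tA LD(3)[OF t(1)]] y(1) uxy unfolding x_def y_def by auto
      define c where "c = x \<inter> y - {u}"
      have cne: "c \<noteq> {}" using xyu uxy unfolding c_def by blast
      have csg: "c \<subseteq> g" unfolding c_def g_def by blast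
      have uc: "u \<notin> c" by (simp only: c_def Diff_iff singleton_iff simp_thms)
      moreover have cy0: "c \<subseteq> y" by (simp only: c_def) (rule subset_trans[OF Diff_subset Int_lower2])
      moreover have "u \<in> y" using uxy by simp
      ultimately have cy: "c \<subset> y" by (metis psubsetI)
      have "x \<inter> y = insert u c" using insert_Diff[OF uxy] unfolding c_def by (rule sym)
      then have "card (x \<inter> y) = card c + 1"
        using uc finite_subset[OF csg fing] by (metis card_insert_disjoint Suc_eq_plus1)
      then have cc: "card c + 2 = card x" using y(2) by simp
      have Kc: "K c" using clique_subset[OF Kg csg cne] .
      have vc: "v \<notin> c" using csg vg by blast
      have "cel c" using small_cell[OF Kc vc] cc cxn by simp
      then obtain e where e: "e \<in> L" "\<beta> e = c" using sub_cell[OF csg cne] by blast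
      have nbe: "\<not> bar (\<beta> e)" using nb_sub[of c] csg gx e(2) by blast
      have ae: "e = a \<or> F a e" using a1[OF e(1)] e(2) csg by blast
      have te: "F t e" using F_sub[OF LD(2)[OF e(1)] tP nbe] cy e(2) ref.sym unfolding y_def by blast
      have "r = e \<or> F e r" if r: "r \<in> L" "F t r" for r
      proof -
        define z where "z = \<beta> r"
        have rP: "r \<in> P" using LD[OF r(1)] by auto
        have Kz: "K z" using clique_of[OF rP] unfolding z_def .
        have Fe: "F e r" if "z \<subset> c \<or> c \<subset> z"
          using F_sub[OF LD(2)[OF e(1)] rP nbe] that e(2) unfolding z_def by blast
        show ?thesis
        proof (cases "z \<subseteq> g")
          case zg: True
          have cz: "card z < card x" using psubset_card_mono[OF finx] zg gx by blast
          have nbz: "\<not> bar z" using nb_sub zg gx by blast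
          have "adj y z" using adj_iff[OF tP rP] r(2) nbz unfolding y_def z_def by blast
          moreover have "\<not> y \<subset> z"
            using psubset_card_mono[OF cliqueD(3)[OF Kz], of y] y(1) cz by linarith
          moreover have "\<not> card z = n" using cz cxn by linarith
          moreover have "z \<noteq> {v}" using zg vg by blast
          ultimately have "z \<subset> y" using vy unfolding cell_adj_def by blast
          then have "z \<subseteq> c" using zg gx ug unfolding c_def by blast
          then show ?thesis using Fe inj[OF rP LD(2)[OF e(1)]] e(2) unfolding z_def by blast
        next
          case False
          then have z: "card z = card x" "card (x \<inter> z) + 1 = card x" "bar z \<longleftrightarrow> bar x"
            using cls[OF r(1)] unfolding z_def by blast+
          have "card (y \<inter> z) + 1 = card x"
          proof (cases "bar x")
            case b: True
            then have "card (y \<inter> z) + 2 = n" using bare_adj[OF tP rP _ _ r(2)] y(3) z(3) unfolding y_def z_def by blast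
            then show ?thesis using bareD(3)[OF b] by linarith
          next
            case nb: False
            have "adj y z" using adj_iff[OF tP rP] r(2) nb y(3) unfolding y_def z_def by blast
            moreover have "\<not> y \<subset> z" "\<not> z \<subset> y"
              using psubset_card_mono[OF cliqueD(3)[OF Kz], of y] psubset_card_mono[OF finy, of z] y(1) z(1) by linarith+
            moreover have "z \<noteq> {v}" using z(1) cg cg0 by auto
            ultimately have "card (y \<inter> z) + 1 = n" using vy unfolding cell_adj_def by blast
            then show ?thesis using True nb by simp
          qed
          \<comment> \<open>\<open>x\<close> is a maximal clique, so three such cells share one face\<close>
          then have "x \<inter> y = x \<inter> z"
            using base.clique_triangle[OF Kx Ky Kz y(1) z(1) y(2) z(2)] maxi by blast
          then have "c \<subseteq> z" unfolding c_def by blast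
          moreover have "c \<noteq> z" using cc z(1) by auto
          ultimately show ?thesis using Fe by blast
        qed
      qed
      then show "\<exists>e\<in>L. (e = a \<or> F a e) \<and> F t e \<and> (\<forall>r\<in>L. F t r \<longrightarrow> r = e \<or> F e r)"
        using e(1) ae te by blast
    qed
  qed
  show "\<exists>s\<in>C - {s\<in>P. u \<notin> \<beta> s \<or> proxy u (\<beta> s)}. contractible F (nbrs F C s)"
    using sD contrL unfolding B_def L_def by blast
qed

end

section \<open>Links of simplices\<close>
definition link :: "('a \<Rightarrow> 'a \<Rightarrow> bool) \<Rightarrow> 'a set \<Rightarrow> 'a set \<Rightarrow> 'a set" where
  "link E V x = {w \<in> V. w \<notin> x \<and> (\<forall>a\<in>x. E a w)}"

context sgraph
begin

lemma link_subset: "link E V x \<subseteq> V"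
  by (auto simp: link_def)

lemma link_singleton: "link E V {u} = nbrs E V u"
  using irr by (auto simp: link_def nbrs_def)

lemma clique_link:
  assumes x: "clique E V x"
  shows "clique E (link E V x) z \<longleftrightarrow> z \<noteq> {} \<and> z \<inter> x = {} \<and> clique E V (x \<union> z)"
proof (intro iffI)
  assume z: "clique E (link E V x) z"
  have zL: "w \<in> V" "w \<notin> x" "a \<in> x \<Longrightarrow> E a w" if "w \<in> z" for w a
    using cliqueD(1)[OF z] that unfolding link_def by blast+
  have "E a b" if "a \<in> x \<union> z" "b \<in> x \<union> z" "a \<noteq> b" for a b
    using that cliqueD(4)[OF x] cliqueD(4)[OF z] zL(3) sym by (elim UnE) blast+
  moreover have "x \<union> z \<subseteq> V" using cliqueD(1)[OF x] zL(1) by blast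
  ultimately have "clique E V (x \<union> z)" using cliqueD(2,3)[OF z] cliqueD(3)[OF x] unfolding clique_def by simp
  then show "z \<noteq> {} \<and> z \<inter> x = {} \<and> clique E V (x \<union> z)" using cliqueD(2)[OF z] zL(2) by blast
next
  assume z: "z \<noteq> {} \<and> z \<inter> x = {} \<and> clique E V (x \<union> z)"
  then have K: "clique E V (x \<union> z)" by blast
  have "w \<in> link E V x" if w: "w \<in> z" for w
  proof -
    have "w \<in> V" "w \<notin> x" using cliqueD(1)[OF K] z w by blast+
    moreover have "E a w" if "a \<in> x" for a using cliqueD(4)[OF K, of a w] that w \<open>w \<notin> x\<close> by blast
    ultimately show ?thesis unfolding link_def by blast
  qed
  then have "z \<subseteq> link E V x" by blast
  moreover have "E a b" if "a \<in> z" "b \<in> z" "a \<noteq> b" for a b using cliqueD(4)[OF K] that by blast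
  ultimately show "clique E (link E V x) z" using z cliqueD(3)[OF K] unfolding clique_def by blast
qed

lemma clique_insert_link:
  assumes "clique E V x" "w \<notin> x"
  shows "clique E V (insert w x) \<longleftrightarrow> w \<in> link E V x"
proof -
  have "clique E (link E V x) {w} \<longleftrightarrow> w \<in> link E V x" by (simp add: clique_def)
  then show ?thesis using clique_link[OF assms(1), of "{w}"] assms(2) by simp
qed

lemma clique_peel:
  assumes x: "clique E V x" and a: "a \<in> x" "x \<noteq> {a}"
  shows "clique E (nbrs E V a) (x - {a})" and "link E (nbrs E V a) (x - {a}) = link E V x"
    and "card x = Suc (card (x - {a}))"
proof -
  show "clique E (nbrs E V a) (x - {a})"
    unfolding clique_def nbrs_def using a cliqueD(1,3,4)[OF x] by auto
  show "link E (nbrs E V a) (x - {a}) = link E V x"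
    unfolding link_def nbrs_def using a(1) irr by auto
  show "card x = Suc (card (x - {a}))" by (rule card.remove[OF cliqueD(3)[OF x] a(1)])
qed

text \<open>
  The link of a simplex is reached by taking unit spheres one vertex after the other, so a property
  that descends to unit spheres descends to links.
\<close>
lemma clique_descent:
  assumes step: "\<And>k U a. Q (Suc k) U \<Longrightarrow> a \<in> U \<Longrightarrow> Q k (nbrs E U a)"
    and zero: "\<And>U. Q 0 U \<Longrightarrow> U = {}"
  shows "Q m V \<Longrightarrow> clique E V x \<Longrightarrow> card x \<le> m \<and> Q (m - card x) (link E V x)"
proof (induction m arbitrary: V x)
  case 0
  then show ?case using cliqueD(1,2)[OF 0(2)] zero by blast
next
  case (Suc m)
  obtain a where a: "a \<in> x" using cliqueD(2)[OF Suc.prems(2)] by blast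
  have "a \<in> V" using a cliqueD(1)[OF Suc.prems(2)] by blast
  then have Q: "Q m (nbrs E V a)" using step Suc.prems(1) by blast
  show ?case
  proof (cases "x = {a}")
    case True then show ?thesis using Q by (simp add: link_singleton)
  next
    case False
    note peel = clique_peel[OF Suc.prems(2) a False]
    show ?thesis using Suc.IH[OF Q peel(1)] peel(2,3) by simp
  qed
qed

text \<open>
  A face whose link is \<open>{w, w'}\<close> lies in one facet besides \<open>insert w f\<close>, and in none if the two
  vertices coincide.
\<close>
lemma facet_across:
  assumes f: "clique E V f" "link E V f = {w, w'}"
    and y: "clique E V y" "card y = card f + 1" "y \<inter> insert w f = f"
  shows "y = insert w' f \<and> w' \<noteq> w"
proof -
  have fy: "f \<subseteq> y" using y(3) by blast
  then have "card (y - f) = 1" using y(2) cliqueD(3)[OF f(1)] by (simp add: card_Diff_subset)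
  then obtain u where "y - f = {u}" by (rule card_1_singletonE)
  then have u: "u \<notin> f" "y = insert u f" using fy by blast+
  have "u \<in> {w, w'}" using clique_insert_link[OF f(1) u(1)] y(1) u(2) f(2) by simp
  moreover have "u \<noteq> w" using y(3) u by blast
  ultimately show ?thesis using u(2) by auto
qed

text \<open>
  A contractible graph is connected.  In the case needed here: an isolated vertex has an empty unit
  sphere, which is not contractible, and it stays isolated when other vertices are removed.
\<close>
lemma contr_isolated:
  "contractible E W \<Longrightarrow> a \<in> W \<Longrightarrow> (\<And>b. b \<in> W \<Longrightarrow> \<not> E a b) \<Longrightarrow> W = {a}"
proof (induction rule: contractible.induct)
  case (single v) then show ?case by simp
next
  case (step V w)
  have "w \<noteq> a"
  proof
    assume "w = a"
    then have "nbrs E V w = {}" using step.prems by (simp add: nbrs_def)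
    then show False using contr_nonempty[OF step.hyps(3)] by contradiction
  qed
  then have "V - {w} = {a}" using step.IH(2) step.prems by simp
  then have "V = {a, w}" using step.hyps(2) by blast
  then have "nbrs E V w = {}" using step.prems(2)[OF step.hyps(2)] sym irr by (auto simp: nbrs_def)
  then show ?case using contr_nonempty[OF step.hyps(3)] by contradiction
qed

end

context refinement
begin

section \<open>Removing the mark and the unit spheres of cells\<close>
text \<open>
  Faces that are cells only on account of \<open>v\<close>: they lie in a facet through \<open>v\<close> and in another
  one.  Once \<open>v\<close> is gone, they are no longer opposite to \<open>v\<close> and not bare either.
\<close>
definition two_sided :: "'a set \<Rightarrow> bool" where
  "two_sided x \<longleftrightarrow> card x + 1 = n \<and> K (insert v x) \<and> (\<exists>p\<in>V. p \<noteq> v \<and> p \<notin> x \<and> K (insert p x))"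

lemma unmark_model: "model F {s\<in>P. v \<notin> \<beta> s \<and> \<not> two_sided (\<beta> s)} \<beta> E (V - {v}) n v"
proof -
  let ?B = "{s\<in>P. v \<notin> \<beta> s \<and> \<not> two_sided (\<beta> s)}"
  let ?bar = "bare E (V - {v}) n v"
  let ?cel = "cell E (V - {v}) n v"
  have K': "clique E (V - {v}) x \<longleftrightarrow> K x \<and> v \<notin> x" for x by (rule clique_delete)
  have bar_iff: "?bar x \<longleftrightarrow> v \<notin> x \<and> K x \<and> card x + 1 = n \<and> \<not> (\<exists>p\<in>V. p \<noteq> v \<and> p \<notin> x \<and> K (insert p x))" for x
    unfolding bare_def K' by blast
  have bar_iff2: "bar x \<longleftrightarrow> v \<notin> x \<and> K x \<and> card x + 1 = n \<and> \<not> (\<exists>p\<in>V. p \<noteq> v \<and> p \<notin> x \<and> K (insert p x)) \<and> \<not> K (insert v x)" for x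
  proof -
    have "(\<forall>w\<in>V. K (insert w x) \<longrightarrow> w \<in> x) \<longleftrightarrow>
        \<not> (\<exists>p\<in>V. p \<noteq> v \<and> p \<notin> x \<and> K (insert p x)) \<and> \<not> K (insert v x)" if "v \<notin> x"
      using that cliqueD(1)[of E V "insert v x"] by (metis insertI1 subsetD)
    then show ?thesis unfolding bare_def by blast
  qed
  have cel_iff: "?cel x \<longleftrightarrow> cel x \<and> v \<notin> x \<and> \<not> two_sided x" for x
  proof (cases "card x + 1 = n")
    case True
    then have c: "\<not> card x + 2 \<le> n" "card x \<noteq> n" by auto
    show ?thesis unfolding cell_def bar_iff bar_iff2 two_sided_def K' using c True by blast
  next
    case False
    then show ?thesis unfolding cell_def bar_iff bar_iff2 two_sided_def K' by blast
  qed
  have "\<beta> ` ?B = {x. ?cel x}"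
  proof (intro equalityI subsetI)
    fix x assume "x \<in> \<beta> ` ?B"
    then obtain s where "s \<in> P" "v \<notin> \<beta> s" "\<not> two_sided (\<beta> s)" "x = \<beta> s" by (elim imageE CollectE conjE)
    then show "x \<in> {x. ?cel x}" using cel_iff[of x] cell_of[of s] by simp
  next
    fix x assume "x \<in> {x. ?cel x}"
    then have x: "cel x" "v \<notin> x" "\<not> two_sided x" using cel_iff by blast+
    then obtain s where "s \<in> P" "\<beta> s = x" using ex_cell by blast
    then show "x \<in> \<beta> ` ?B" using x by (intro image_eqI[of _ _ s]) simp_all
  qed
  moreover have "inj_on \<beta> ?B" using inj by (intro inj_onI) blast
  moreover have "if ?bar (\<beta> s) \<and> ?bar (\<beta> t) then F s t \<longrightarrow> card (\<beta> s \<inter> \<beta> t) + 2 = n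
      else F s t \<longleftrightarrow> cell_adj E (V - {v}) n v (\<beta> s) (\<beta> t)" if s: "s \<in> ?B" and t: "t \<in> ?B" for s t
  proof -
    have sP: "s \<in> P" and tP: "t \<in> P" and vs: "v \<notin> \<beta> s" and vt: "v \<notin> \<beta> t" using s t by blast+
    have nv: "\<beta> s \<noteq> {v}" "\<beta> t \<noteq> {v}" using vs vt by blast+
    have ad: "cell_adj E (V - {v}) n v (\<beta> s) (\<beta> t) \<longleftrightarrow> adj (\<beta> s) (\<beta> t)"
      by (simp add: cell_adj_def nv)
    have b: "?bar x" if "bar x" for x using that bar_iff bar_iff2 by blast
    show ?thesis
    proof (cases "bar (\<beta> s) \<and> bar (\<beta> t)")
      case True
      then show ?thesis using bare_adj[OF sP tP] b by auto
    next
      case False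
      have F: "F s t \<longleftrightarrow> adj (\<beta> s) (\<beta> t)" by (rule adj_iff[OF sP tP False])
      have "\<not> adj (\<beta> s) (\<beta> t)" if bb: "?bar (\<beta> s)" "?bar (\<beta> t)"
      proof -
        have c: "card (\<beta> s) = card (\<beta> t)" "card (\<beta> s) \<noteq> n" 
          using bareD(3)[OF bb(1)] bareD(3)[OF bb(2)] by simp_all
        have "\<not> \<beta> s \<subset> \<beta> t" "\<not> \<beta> t \<subset> \<beta> s"
          using psubset_card_mono[OF cliqueD(3)[OF clique_of[OF sP]], of "\<beta> t"]
            psubset_card_mono[OF cliqueD(3)[OF clique_of[OF tP]], of "\<beta> s"] c(1) by linarith+
        then show ?thesis unfolding cell_adj_def using nv c by blast
      qed
      then show ?thesis using F ad by presburger
    qed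
  qed
  ultimately show ?thesis unfolding model_def bij_betw_def by blast
qed

text \<open>
  A two-sided face \<open>x\<close> can be removed once \<open>{v}\<close> is gone, because any facet above it that
  avoids \<open>v\<close> is then an apex of its unit sphere.
\<close>
lemma unmark_contr:
  assumes ap: "ap \<in> P" "\<beta> ap = {v}" and contractible: "contractible F {s\<in>P. v \<notin> \<beta> s \<and> \<not> two_sided (\<beta> s)}"
  shows "contractible F (P - {ap})"
proof (rule contr_dismantle[OF _ _ contractible])
  let ?B = "{s\<in>P. v \<notin> \<beta> s \<and> \<not> two_sided (\<beta> s)}"
  show "finite (P - {ap})" using finP by simp
  show "?B \<subseteq> P - {ap}" using ap by auto
  fix C assume BC: "?B \<subset> C" and CP: "C \<subseteq> P - {ap}"
  obtain s where sD: "s \<in> C - ?B" using BC by blast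
  then have sC: "s \<in> C" and sP: "s \<in> P" and so: "s \<noteq> ap" using CP by blast+
  define x where "x = \<beta> s"
  have cx: "cel x" and Kx: "K x" using cell_of[OF sP] clique_of[OF sP] unfolding x_def by blast+
  have vx: "v \<notin> x" using cell_v[OF cx] inj[OF sP ap(1)] so ap(2) unfolding x_def by metis
  then have cl: "two_sided x" using sD sP unfolding x_def by blast
  then obtain p where p: "p \<in> V" "p \<noteq> v" "p \<notin> x" "K (insert p x)" unfolding two_sided_def by blast
  have cn: "card x + 1 = n" and nb: "\<not> bar x" using cl bdry_not_bare unfolding two_sided_def by blast+
  define y where "y = insert p x"
  have cy: "card y = n" using p(3) cn cliqueD(3)[OF Kx] unfolding y_def by simp
  have vy: "v \<notin> y" using vx p(2) unfolding y_def by blast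
  have Ky: "K y" using p(4) unfolding y_def .
  obtain a where a: "a \<in> P" "\<beta> a = y" using ex_cell[OF facet_cell[OF Ky vy cy]] by blast
  have nba: "\<not> bar (\<beta> a)" using facet_not_bare cy a(2) by simp
  have "\<not> two_sided y" using cy unfolding two_sided_def by simp
  then have aC: "a \<in> C" using BC a vy by blast
  have xy: "x \<subset> y" using p(3) unfolding y_def by blast
  have "F a s" using adj_iff[OF a(1) sP] nba a(2) adjI_sub[of y x] xy unfolding x_def by blast
  then have sa: "F s a" using ref.sym by blast
  have "contractible F (nbrs F C s)"
  proof (rule ref.cone_contr)
    show "finite (nbrs F C s)" using finP CP by (meson Diff_subset finite_subset nbrs_subset subset_trans)
    show "a \<in> nbrs F C s" using aC sa by (simp add: nbrs_def)
    fix t assume t: "t \<in> nbrs F C s" "t \<noteq> a"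
    have tP: "t \<in> P" and st: "F s t" and to: "t \<noteq> ap" using t(1) CP by (auto simp: nbrs_def)
    define z where "z = \<beta> t"
    have Kz: "K z" using clique_of[OF tP] unfolding z_def .
    have zv: "z \<noteq> {v}" using inj[OF tP ap(1)] to ap(2) unfolding z_def by metis
    have zy: "z \<noteq> y" using inj[OF tP a(1)] t(2) a(2) unfolding z_def by metis
    have "adj x z" using adj_iff[OF sP tP] st nb unfolding x_def z_def by blast
    then consider "x \<subset> z" | "z \<subset> x" unfolding cell_adj_def using zv vx cn by fastforce
    then have "adj y z"
    proof cases
      case 1
      have cz: "card z = n" using psubset_card_mono[OF cliqueD(3)[OF Kz] 1] bound[OF Kz] cn by linarith
      have fy: "finite y" using cliqueD(3)[OF Ky] .
      have "\<not> y \<subseteq> z" using card_subset_eq[OF cliqueD(3)[OF Kz], of y] cz cy zy by metis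
      then have "y \<inter> z \<subset> y" by blast
      then have "card (y \<inter> z) < n" using psubset_card_mono[OF fy] cy by metis
      moreover have xyz: "x \<subseteq> y \<inter> z" using xy 1 by blast
      then have "card x \<le> card (y \<inter> z)" using fy by (intro card_mono) auto
      ultimately have "card (y \<inter> z) + 1 = n" using cn by linarith
      moreover have "y \<inter> z \<noteq> {}" using xyz cliqueD(2)[OF Kx] by blast
      ultimately show ?thesis using cy cz unfolding cell_adj_def by blast
    next
      case 2 then show ?thesis using xy by (intro adjI_sub) blast
    qed
    then show "F a t" using adj_iff[OF a(1) tP] nba a(2) unfolding z_def by blast
  qed
  then show "\<exists>x\<in>C - ?B. contractible F (nbrs F C x)" using sD by blast
qed

text \<open>
  Around the cell \<open>{v}\<close> one sees all simplices of the unit sphere of \<open>v\<close>, ordered by inclusion.  This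
  is a refinement for the bound \<open>n + 1\<close>: the simplices have at most \<open>n - 1\<close> vertices, so none of
  them reaches the sizes \<open>n\<close> and \<open>n + 1\<close> of the special cells.
\<close>
lemma apex_link_model:
  assumes ap: "ap \<in> P" "\<beta> ap = {v}"
  shows "model F (nbrs F P ap) \<beta> E (nbrs E V v) (n + 1) v"
    and "\<And>x. clique E (nbrs E V v) x \<Longrightarrow> card x + 1 \<le> n"
proof -
  let ?L = "nbrs E V v"
  have vV: "v \<in> V" using cliqueD(1)[OF clique_of[OF ap(1)]] ap(2) by blast
  have KL: "clique E ?L x \<longleftrightarrow> x \<noteq> {} \<and> v \<notin> x \<and> K (insert v x)" for x
    using base.clique_link[OF clique_singleton[OF vV], of x] base.link_singleton[of V v] by auto
  show small: "card x + 1 \<le> n" if "clique E ?L x" for x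
  proof -
    have "K (insert v x)" "v \<notin> x" using that KL by blast+
    then show ?thesis using bound[of "insert v x"] cliqueD(3)[OF that] by simp
  qed
  have vL: "v \<notin> ?L" using base.irr by (simp add: nbrs_def)
  have nob: "\<not> bare E ?L (n + 1) v x" for x using small unfolding bare_def by fastforce
  have cells: "cell E ?L (n + 1) v x \<longleftrightarrow> clique E ?L x" for x
    using small[of x] nob[of x] vL KL[of x] unfolding cell_def by auto
  have clique_cel: "cel x \<and> \<not> bar x" if "clique E ?L x" for x
  proof -
    have x: "v \<notin> x" "K (insert v x)" "x \<noteq> {}" using that KL by blast+
    have "K x" using clique_subset[OF x(2) _ x(3)] by blast
    then have "cel x" using small[OF that] x small_cell[of x] bdry_cell[of x] by linarith
    then show ?thesis using bdry_not_bare[OF x(2)] by blast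
  qed
  have nbo: "\<not> bar (\<beta> ap)" using ap(2) by (simp add: bare_def)
  have Fo: "F ap t \<longleftrightarrow> clique E ?L (\<beta> t)" if t: "t \<in> P" for t
  proof -
    have "F ap t \<longleftrightarrow> adj {v} (\<beta> t)" using adj_iff[OF ap(1) t] nbo ap(2) by auto
    moreover have "\<beta> t \<noteq> {}" using cliqueD(2)[OF clique_of[OF t]] .
    moreover have "v \<in> \<beta> t \<Longrightarrow> \<beta> t = {v}" using cell_v[OF cell_of[OF t]] .
    ultimately show ?thesis unfolding KL cell_adj_def by fastforce
  qed
  have "\<beta> ` nbrs F P ap = {x. cell E ?L (n + 1) v x}"
  proof (intro equalityI subsetI)
    fix x assume "x \<in> \<beta> ` nbrs F P ap"
    then show "x \<in> {x. cell E ?L (n + 1) v x}" using Fo cells by (auto simp: nbrs_def)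
  next
    fix x assume "x \<in> {x. cell E ?L (n + 1) v x}"
    then have x: "clique E ?L x" using cells by blast
    then obtain t where "t \<in> P" "\<beta> t = x" using clique_cel ex_cell by blast
    then show "x \<in> \<beta> ` nbrs F P ap" using Fo x by (intro image_eqI[of _ _ t]) (simp_all add: nbrs_def)
  qed
  moreover have "inj_on \<beta> (nbrs F P ap)" using inj nbrs_subset[of F P ap] by (intro inj_onI) blast
  moreover have "F s t \<longleftrightarrow> cell_adj E ?L (n + 1) v (\<beta> s) (\<beta> t)" if "s \<in> nbrs F P ap" "t \<in> nbrs F P ap" for s t
  proof -
    have sP: "s \<in> P" and tP: "t \<in> P" and s: "clique E ?L (\<beta> s)" and t: "clique E ?L (\<beta> t)"
      using that Fo by (auto simp: nbrs_def)
    have nv: "\<beta> s \<noteq> {v}" "\<beta> t \<noteq> {v}" using s t KL by blast+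
    have c: "card (\<beta> s) \<noteq> n" "card (\<beta> s) \<noteq> Suc n" using small[OF s] by linarith+
    have "F s t \<longleftrightarrow> adj (\<beta> s) (\<beta> t)" using adj_iff[OF sP tP] clique_cel[OF s] by blast
    then show ?thesis by (simp add: cell_adj_def nv c)
  qed
  ultimately show "model F (nbrs F P ap) \<beta> E ?L (n + 1) v"
    unfolding model_def bij_betw_def using nob by simp
qed

definition upper :: "'a set \<Rightarrow> 'b set" where
  "upper x = {t\<in>P. x \<subset> \<beta> t \<or> \<beta> t = {v} \<and> K (insert v x)}"

definition lower :: "'a set \<Rightarrow> 'b set" where
  "lower x = {t\<in>P. \<beta> t \<subset> x}"

text \<open>
  The unit sphere of a cell that is neither bare nor a facet is a join.  All proper faces of such a
  cell are cells, so the lower factor is a subdivided boundary of a simplex.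
\<close>
lemma link_split:
  assumes s: "s \<in> P" "\<beta> s = x" "v \<notin> x" "\<not> bar x" "card x < n"
  shows "nbrs F P s = lower x \<union> upper x" and "lower x \<inter> upper x = {}"
    and "\<And>a b. a \<in> lower x \<Longrightarrow> b \<in> upper x \<Longrightarrow> F a b"
    and "sph F (card x - 1) (lower x)"
proof -
  have Kx: "K x" using clique_of s by blast
  have nv: "x \<noteq> {v}" using s(3) by blast
  have Fs: "F s t \<longleftrightarrow> \<beta> t \<subset> x \<or> (x \<subset> \<beta> t \<or> \<beta> t = {v} \<and> K (insert v x))" if t: "t \<in> P" for t
  proof -
    have "F s t \<longleftrightarrow> adj x (\<beta> t)" using adj_iff[OF s(1) t] s by blast
    then show ?thesis unfolding cell_adj_def using nv s(3,5) by auto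
  qed
  show "nbrs F P s = lower x \<union> upper x"
    unfolding nbrs_def lower_def upper_def using Fs by blast
  show "lower x \<inter> upper x = {}" unfolding lower_def upper_def using s(3) by auto
  have nbl: "\<not> bar (\<beta> a)" if "a \<in> lower x" for a
    using that bare_maximal[OF _ Kx] unfolding lower_def by blast
  show "F a b" if a: "a \<in> lower x" and b: "b \<in> upper x" for a b
  proof -
    have aP: "a \<in> P" and bP: "b \<in> P" and ax: "\<beta> a \<subset> x" using a b unfolding lower_def upper_def by blast+
    have "adj (\<beta> a) (\<beta> b)"
    proof (cases "x \<subset> \<beta> b")
      case True then show ?thesis using ax by (intro adjI_sub) blast
    next
      case False
      then have bv: "\<beta> b = {v}" "K (insert v x)" using b unfolding upper_def by blast+
      then have "K (insert v (\<beta> a))" using clique_subset[OF bv(2), of "insert v (\<beta> a)"] ax by blast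
      then show ?thesis unfolding cell_adj_def using bv ax s(3) by blast
    qed
    then show ?thesis using adj_iff[OF aP bP] nbl[OF a] by blast
  qed
  have iso: "graph_iso \<beta> F (lower x) comparable {y. y \<noteq> {} \<and> y \<subset> x}"
    unfolding graph_iso_def
  proof (intro conjI ballI)
    have "\<beta> ` lower x = {y. y \<noteq> {} \<and> y \<subset> x}"
    proof (intro equalityI subsetI)
      fix y assume "y \<in> \<beta> ` lower x"
      then show "y \<in> {y. y \<noteq> {} \<and> y \<subset> x}" using cliqueD(2)[OF clique_of] unfolding lower_def by blast
    next
      fix y assume "y \<in> {y. y \<noteq> {} \<and> y \<subset> x}"
      then have y: "y \<noteq> {}" "y \<subset> x" by blast+
      have "K y" using clique_subset[OF Kx _ y(1)] y(2) by blast
      moreover have "card y + 2 \<le> n" using psubset_card_mono[OF cliqueD(3)[OF Kx] y(2)] s(5) by linarith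
      ultimately have "cel y" using small_cell y(2) s(3) by blast
      then obtain t where "t \<in> P" "\<beta> t = y" using ex_cell by blast
      then show "y \<in> \<beta> ` lower x" using y(2) unfolding lower_def by (intro image_eqI[of _ _ t]) simp_all
    qed
    moreover have "inj_on \<beta> (lower x)" using inj unfolding lower_def by (intro inj_onI) blast
    ultimately show "bij_betw \<beta> (lower x) {y. y \<noteq> {} \<and> y \<subset> x}" unfolding bij_betw_def by blast
    fix a b assume ab: "a \<in> lower x" "b \<in> lower x"
    then have P: "a \<in> P" "b \<in> P" and sub: "\<beta> a \<subset> x" "\<beta> b \<subset> x" unfolding lower_def by blast+
    have "card (\<beta> a) < n" using psubset_card_mono[OF cliqueD(3)[OF Kx] sub(1)] s(5) by linarith
    moreover have "\<beta> a \<noteq> {v}" "\<beta> b \<noteq> {v}" using sub s(3) by blast+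
    ultimately have "adj (\<beta> a) (\<beta> b) \<longleftrightarrow> comparable (\<beta> a) (\<beta> b)"
      unfolding cell_adj_def comparable_def by auto
    then show "comparable (\<beta> a) (\<beta> b) = F a b" using adj_iff[OF P] nbl[OF ab(1)] by blast
  qed
  show "sph F (card x - 1) (lower x)" by (rule sph_boundary[OF iso cliqueD(3,2)[OF Kx]])
qed

text \<open>
  Subtracting \<open>x\<close> turns the cells above \<open>x\<close> into the cells of the link, with the same marked
  vertex.  The condition \<open>single\<close> concerns faces \<open>x\<close> of codimension one: two facets above \<open>x\<close> are
  adjacent, but in the link they are two isolated vertices.
\<close>
lemma link_model:
  assumes s: "s \<in> P" "\<beta> s = x" "v \<notin> x" "\<not> bar x" "card x < n"
    and single: "\<And>p q. card x + 1 = n \<Longrightarrow> p \<in> link E V x \<Longrightarrow> q \<in> link E V x \<Longrightarrow> p \<noteq> v \<Longrightarrow> q \<noteq> v \<Longrightarrow> p = q"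
  shows "model F (upper x) (\<lambda>t. \<beta> t - x) E (link E V x) (n - card x) v"
    and "\<And>z. clique E (link E V x) z \<Longrightarrow> card z \<le> n - card x"
proof -
  let ?L = "link E V x" and ?n = "n - card x"
  have Kx: "K x" using clique_of s by blast
  have finx: "finite x" and xne: "x \<noteq> {}" using cliqueD(2,3)[OF Kx] by blast+
  have KL: "clique E ?L z \<longleftrightarrow> z \<noteq> {} \<and> z \<inter> x = {} \<and> K (x \<union> z)" for z by (rule base.clique_link[OF Kx])
  have cU: "card (x \<union> z) = card x + card z" if "z \<inter> x = {}" "K (x \<union> z)" for z
    using that cliqueD(3)[OF that(2)] by (intro card_Un_disjoint) auto
  have xz_v: "v \<in> x \<union> z \<longleftrightarrow> v \<in> z" for z using s(3) by blast
  show bnd: "card z \<le> ?n" if "clique E ?L z" for z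
    using that cU[of z] bound[of "x \<union> z"] unfolding KL by linarith
  have vL: "v \<in> ?L \<longleftrightarrow> K (insert v x)" using base.clique_insert_link[OF Kx s(3)] by blast
  have ins: "clique E ?L (insert w z) \<longleftrightarrow> K (insert w (x \<union> z))" if "w \<notin> x" "z \<inter> x = {}" for w z
    using that unfolding KL by (simp add: insert_commute)
  have bareL: "bare E ?L ?n v z \<longleftrightarrow> z \<noteq> {} \<and> z \<inter> x = {} \<and> bar (x \<union> z)" for z
  proof (cases "clique E ?L z")
    case True
    then have z: "z \<noteq> {}" "z \<inter> x = {}" "K (x \<union> z)" unfolding KL by blast+
    have c: "card z + 1 = ?n \<longleftrightarrow> card (x \<union> z) + 1 = n" using cU[OF z(2,3)] s(5) by linarith
    have e: "(\<forall>w\<in>?L. clique E ?L (insert w z) \<longrightarrow> w \<in> z) \<longleftrightarrow>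
        (\<forall>w\<in>V. K (insert w (x \<union> z)) \<longrightarrow> w \<in> x \<union> z)"
    proof (intro iffI ballI impI)
      fix w assume a: "\<forall>w\<in>?L. clique E ?L (insert w z) \<longrightarrow> w \<in> z" "w \<in> V" "K (insert w (x \<union> z))"
      show "w \<in> x \<union> z"
      proof (cases "w \<in> x")
        case False
        then have "clique E ?L (insert w z)" using ins[OF False z(2)] a(3) by blast
        moreover from this have "w \<in> ?L" using cliqueD(1) by blast
        ultimately show ?thesis using a(1) by blast
      qed simp
    next
      fix w assume a: "\<forall>w\<in>V. K (insert w (x \<union> z)) \<longrightarrow> w \<in> x \<union> z" "w \<in> ?L" "clique E ?L (insert w z)"
      have w: "w \<in> V" "w \<notin> x" using a(2) unfolding link_def by blast+
      have "K (insert w (x \<union> z))" using ins[OF w(2) z(2)] a(3) by blast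
      then show "w \<in> z" using a(1) w by blast
    qed
    show ?thesis unfolding bare_def c e xz_v using True z by blast
  next
    case False
    then show ?thesis using bareD(2)[of E ?L ?n v z] bareD(2)[of E V n v "x \<union> z"] KL by metis
  qed
  have cellL: "cell E ?L ?n v z \<longleftrightarrow>
      (z = {v} \<and> K (insert v x)) \<or> (z \<noteq> {} \<and> z \<inter> x = {} \<and> v \<notin> z \<and> cel (x \<union> z))" for z
  proof (cases "clique E ?L z")
    case True
    then have z: "z \<noteq> {}" "z \<inter> x = {}" "K (x \<union> z)" unfolding KL by blast+
    have c: "card z + 1 = ?n \<longleftrightarrow> card (x \<union> z) + 1 = n" "card z + 2 \<le> ?n \<longleftrightarrow> card (x \<union> z) + 2 \<le> n"
      "card z = ?n \<longleftrightarrow> card (x \<union> z) = n" unfolding cU[OF z(2,3)] using s(5) by auto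
    have nv: "x \<union> z \<noteq> {v}" using xne s(3) Un_upper1[of x z] by (metis insertI1 subset_singletonD)
    have nb: "\<not> bar (x \<union> z)" if "v \<in> z" using that unfolding bare_def by blast
    show ?thesis
    proof (cases "v \<in> z")
      case vz: True
      show ?thesis unfolding cell_def bareL xz_v vL
        by (simp only: vz nb[OF vz] not_True_eq_False simp_thms)
    next
      case vz: False
      then have "z \<noteq> {v}" by blast
      then show ?thesis unfolding cell_def bareL c xz_v vL ins[OF s(3) z(2)]
        using True z nv vz by simp
    qed
  next
    case False
    have "z = {v} \<Longrightarrow> \<not> K (insert v x)" using False s(3) unfolding KL by auto
    moreover have "\<not> (z \<noteq> {} \<and> z \<inter> x = {} \<and> cel (x \<union> z))" using False cell_clique unfolding KL by blast
    moreover have "\<not> cell E ?L ?n v z"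
      using False calculation(1) vL bareD(2)[of E ?L ?n v z] unfolding cell_def by metis
    ultimately show ?thesis by blast
  qed
  have up: "x \<subset> \<beta> t \<and> v \<notin> \<beta> t \<and> \<beta> t - x \<noteq> {} \<and> x \<union> (\<beta> t - x) = \<beta> t \<or> \<beta> t = {v} \<and> \<beta> t - x = {v} \<and> K (insert v x)"
    if t: "t \<in> upper x" for t
  proof -
    have tP: "t \<in> P" and d: "x \<subset> \<beta> t \<or> \<beta> t = {v} \<and> K (insert v x)" using t unfolding upper_def by blast+
    show ?thesis
    proof (cases "x \<subset> \<beta> t")
      case True
      have "v \<notin> \<beta> t"
      proof
        assume "v \<in> \<beta> t"
        then have "x \<subset> {v}" using cell_v[OF cell_of[OF tP]] True by simp
        then show False using xne by blast
      qed
      then show ?thesis using True by blast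
    next
      case False
      then show ?thesis using d s(3) by blast
    qed
  qed
  have "(\<lambda>t. \<beta> t - x) ` upper x = {z. cell E ?L ?n v z}"
  proof (intro equalityI subsetI)
    fix z assume "z \<in> (\<lambda>t. \<beta> t - x) ` upper x"
    then obtain t where t: "t \<in> upper x" "z = \<beta> t - x" by blast
    have tP: "t \<in> P" using t(1) unfolding upper_def by blast
    have "cell E ?L ?n v z" unfolding cellL using up[OF t(1)] cell_of[OF tP] t(2) by auto
    then show "z \<in> {z. cell E ?L ?n v z}" by blast
  next
    fix z assume "z \<in> {z. cell E ?L ?n v z}"
    then consider "z = {v}" "K (insert v x)" | "z \<noteq> {}" "z \<inter> x = {}" "v \<notin> z" "cel (x \<union> z)"
      unfolding cellL by blast
    then show "z \<in> (\<lambda>t. \<beta> t - x) ` upper x"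
    proof cases
      case 1
      then have "v \<in> V" using cliqueD(1)[OF 1(2)] by blast
      then obtain t where t: "t \<in> P" "\<beta> t = {v}" using ex_cell[of "{v}"] unfolding cell_def by blast
      then have "t \<in> upper x" using 1 unfolding upper_def by blast
      then show ?thesis using t(2) 1(1) s(3) by (intro image_eqI[of _ _ t]) auto
    next
      case 2
      then obtain t where t: "t \<in> P" "\<beta> t = x \<union> z" using ex_cell by blast
      then have "t \<in> upper x" using 2 unfolding upper_def by blast
      then show ?thesis using t(2) 2(2) by (intro image_eqI[of _ _ t]) auto
    qed
  qed
  moreover have "inj_on (\<lambda>t. \<beta> t - x) (upper x)"
  proof (rule inj_onI)
    fix t r assume tr: "t \<in> upper x" "r \<in> upper x" "\<beta> t - x = \<beta> r - x"
    have "\<beta> t = \<beta> r" using up[OF tr(1)] up[OF tr(2)] tr(3) by auto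
    then show "t = r" using inj tr(1,2) unfolding upper_def by blast
  qed
  moreover have "if bare E ?L ?n v (\<beta> t - x) \<and> bare E ?L ?n v (\<beta> r - x)
      then F t r \<longrightarrow> card ((\<beta> t - x) \<inter> (\<beta> r - x)) + 2 = ?n
      else F t r \<longleftrightarrow> cell_adj E ?L ?n v (\<beta> t - x) (\<beta> r - x)" if tr: "t \<in> upper x" "r \<in> upper x" for t r
  proof -
    have tP: "t \<in> P" and rP: "r \<in> P" using tr unfolding upper_def by blast+
    have nbv: "\<not> bar {v}" "\<not> bare E ?L ?n v {v}" unfolding bare_def by blast+
    have half: "adj {v} z \<longleftrightarrow> cell_adj E ?L ?n v {v} (z - x)"
      if z: "x \<subset> z \<and> v \<notin> z \<and> z - x \<noteq> {} \<and> x \<union> (z - x) = z" for z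
    proof -
      have "adj {v} z \<longleftrightarrow> K (insert v z)" using z xne s(3) unfolding cell_adj_def by blast
      moreover have "cell_adj E ?L ?n v {v} (z - x) \<longleftrightarrow> clique E ?L (insert v (z - x))"
        using z unfolding cell_adj_def by blast
      moreover have "clique E ?L (insert v (z - x)) \<longleftrightarrow> K (insert v z)"
        using ins[of v "z - x"] s(3) z by auto
      ultimately show ?thesis by blast
    qed
    show ?thesis
    proof (cases "\<beta> t = {v} \<or> \<beta> r = {v}")
      case True
      have nb: "\<not> (bar (\<beta> t) \<and> bar (\<beta> r))" using True nbv by metis
      have v: "\<beta> q - x = {v}" if "\<beta> q = {v}" for q using that s(3) by auto
      have nb': "\<not> (bare E ?L ?n v (\<beta> t - x) \<and> bare E ?L ?n v (\<beta> r - x))" using True nbv v by metis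
      have "adj (\<beta> t) (\<beta> r) \<longleftrightarrow> cell_adj E ?L ?n v (\<beta> t - x) (\<beta> r - x)"
      proof (cases "\<beta> t = {v}")
        case t: True
        show ?thesis
        proof (cases "\<beta> r = {v}")
          case r: True
          have "\<not> cell_adj E W k v {v} {v}" for W k unfolding cell_adj_def by auto
          then show ?thesis using t r v by metis
        next
          case False
          then show ?thesis using half[of "\<beta> r"] up[OF tr(2)] t v[OF t] by simp
        qed
      next
        case False
        then have r: "\<beta> r = {v}" using True by blast
        then show ?thesis using half[of "\<beta> t"] up[OF tr(1)] False v[OF r]
          cell_adj_sym[of E V n v "\<beta> t"] cell_adj_sym[of E ?L ?n v "\<beta> t - x"] by simp
      qed
      then show ?thesis using adj_iff[OF tP rP nb] nb' by argo
    next
      case False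
      define y z where "y = \<beta> t - x" and "z = \<beta> r - x"
      have y: "\<beta> t = x \<union> y" "v \<notin> y" "y \<noteq> {}" and z: "\<beta> r = x \<union> z" "v \<notin> z" "z \<noteq> {}"
        using up[OF tr(1)] up[OF tr(2)] False unfolding y_def z_def by blast+
      have dy: "y \<inter> x = {}" and dz: "z \<inter> x = {}" unfolding y_def z_def by blast+
      have K: "K (x \<union> y)" "K (x \<union> z)" using clique_of[OF tP] clique_of[OF rP] y(1) z(1) by simp_all
      have fin: "finite y" "finite z" using cliqueD(3)[OF K(1)] cliqueD(3)[OF K(2)] by simp_all
      have b: "bare E ?L ?n v y \<longleftrightarrow> bar (x \<union> y)" "bare E ?L ?n v z \<longleftrightarrow> bar (x \<union> z)"
        unfolding bareL using y z dy dz by blast+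
      have "(x \<union> y) \<inter> (x \<union> z) = x \<union> (y \<inter> z)" by blast
      moreover have "card (x \<union> (y \<inter> z)) = card x + card (y \<inter> z)"
        using finx fin dy by (intro card_Un_disjoint) auto
      ultimately have ci: "card ((x \<union> y) \<inter> (x \<union> z)) = card x + card (y \<inter> z)" by simp
      have cy: "card (x \<union> y) = card x + card y" "card (x \<union> z) = card x + card z"
        using cU dy dz K by blast+
      have meet: "y \<inter> z \<noteq> {}" if h: "card (x \<union> y) = n" "card (x \<union> z) = n" "card ((x \<union> y) \<inter> (x \<union> z)) + 1 = n"
      proof
        assume e: "y \<inter> z = {}"
        then have cx: "card x + 1 = n" using h(3) ci by simp
        then have "card y = 1" "card z = 1" using h(1,2) cy by linarith+
        then obtain p q where pq: "y = {p}" "z = {q}" by (metis card_1_singletonE)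
        have "clique E ?L y" "clique E ?L z" unfolding KL using y z dy dz K by blast+
        then have "p \<in> ?L" "q \<in> ?L" using cliqueD(1) pq by blast+
        then have "p = q" using single[OF cx, of p q] y(2) z(2) pq by blast
        then show False using e pq by blast
      qed
      have ne: "(x \<union> y) \<inter> (x \<union> z) \<noteq> {}" using xne by blast
      have sub: "x \<union> y \<subset> x \<union> z \<longleftrightarrow> y \<subset> z" "x \<union> z \<subset> x \<union> y \<longleftrightarrow> z \<subset> y" using dy dz by blast+
      have nv: "x \<union> y \<noteq> {v}" "x \<union> z \<noteq> {v}" "y \<noteq> {v}" "z \<noteq> {v}" using xne s(3) y(2) z(2) by blast+
      have top: "(card (x \<union> y) = n \<and> card (x \<union> z) = n \<and> (x \<union> y) \<inter> (x \<union> z) \<noteq> {} \<and> card ((x \<union> y) \<inter> (x \<union> z)) + 1 = n)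
        \<longleftrightarrow> (card y = ?n \<and> card z = ?n \<and> y \<inter> z \<noteq> {} \<and> card (y \<inter> z) + 1 = ?n)" (is "?A \<longleftrightarrow> ?B")
      proof
        assume a: ?A
        then have "y \<inter> z \<noteq> {}" using meet by blast
        moreover have "card y = ?n" "card z = ?n" "card (y \<inter> z) + 1 = ?n" using a ci cy by linarith+
        ultimately show ?B by blast
      next
        assume b: ?B
        have "card (x \<union> y) = n" "card (x \<union> z) = n" "card ((x \<union> y) \<inter> (x \<union> z)) + 1 = n"
          using b ci cy s(5) by linarith+
        then show ?A using ne by blast
      qed
      have "adj (x \<union> y) (x \<union> z) \<longleftrightarrow> cell_adj E ?L ?n v y z"
        unfolding cell_adj_def sub top by (simp only: nv simp_thms)
      moreover have "card ((x \<union> y) \<inter> (x \<union> z)) + 2 = n \<longleftrightarrow> card (y \<inter> z) + 2 = ?n"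
        using ci s(5) by linarith
      moreover note model_adj[OF tP rP, unfolded y(1) z(1)]
      ultimately show ?thesis unfolding y_def[symmetric] z_def[symmetric] b by argo
    qed
  qed
  ultimately show "model F (upper x) (\<lambda>t. \<beta> t - x) E ?L ?n v"
    unfolding model_def bij_betw_def by blast
qed

end

section \<open>Refining a contractible graph\<close>
text \<open>
  Let \<open>V\<close> contract by removing \<open>u\<close> first.  If \<open>{u}\<close> is a cell, then its unit sphere refines the
  unit sphere of \<open>u\<close> and is contractible by induction, so \<open>{u}\<close> can be removed; after that (or at
  once, if \<open>{u}\<close> is no cell) the other cells containing \<open>u\<close> are removed.  If \<open>u\<close> is the marked
  vertex, then the cell \<open>{u}\<close> is followed by the two-sided faces.
\<close>
lemma contr_refinement:
  assumes "contractible E V" "sgraph E" "sgraph F" "\<And>x. clique E V x \<Longrightarrow> card x \<le> n" "model F P \<beta> E V n v"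
  shows "contractible F P"
  using assms(1,4,5)
proof (induction arbitrary: P \<beta> n v rule: contractible.induct)
  case (single g P \<beta> n v)
  interpret sgraph E by fact
  interpret Fg: sgraph F by fact
  interpret refinement E F P \<beta> "{g}" n v
    by unfold_locales (use single in auto)
  have Kg: "clique E {g} x \<longleftrightarrow> x = {g}" for x by (auto simp: clique_def)
  have n: "n \<ge> 1" using bound[of "{g}"] Kg by simp
  have "cel x \<longleftrightarrow> x = {g}" for x
  proof
    show "x = {g}" if "cel x" using cell_clique[OF that] Kg by blast
    show "cel x" if x: "x = {g}"
    proof (cases "g = v")
      case True then show ?thesis using x by (simp add: cell_def)
    next
      case False
      then have "bar x" if "n = 2" using that x Kg by (auto simp: bare_def)
      moreover have "card x = 1" "v \<notin> x" "K x" using x False Kg by auto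
      moreover consider "n = 1" | "n = 2" | "card x + 2 \<le> n" using n calculation(2) by linarith
      ultimately show ?thesis unfolding cell_def by metis
    qed
  qed
  then have "bij_betw \<beta> P {{g}}" using bij by simp
  then have "card P = 1" by (simp add: bij_betw_same_card)
  then obtain s where "P = {s}" by (rule card_1_singletonE)
  then show ?case by (simp add: contractible.single)
next
  case (step V u P \<beta> n v)
  interpret sgraph E by fact
  interpret Fg: sgraph F by fact
  interpret refinement E F P \<beta> V n v
    by unfold_locales (use step in auto)
  obtain p where p: "p \<in> nbrs E V u" using contr_nonempty[OF step.hyps(3)] by blast
  then have pu: "p \<in> V" "E u p" "p \<noteq> u" using irr by (auto simp: nbrs_def)
  then have Kup: "K {u, p}" using step.hyps(2) sym by (auto simp: clique_def)
  have n2: "n \<ge> 2" using bound[OF Kup] pu(3) by simp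
  have bd: "card x \<le> n" if "clique E (V - {u}) x" for x using bound that clique_delete by metis
  show ?case
  proof (cases "u = v")
    case True
    then obtain ap where ap: "ap \<in> P" "\<beta> ap = {v}" using ex_cell[of "{v}"] step.hyps(2) by (auto simp: cell_def)
    have "contractible F (nbrs F P ap)"
      using apex_link_model[OF ap] by (intro step.IH(1)[of "n + 1" _ \<beta> v]) (force simp: True)+
    moreover have "contractible F (P - {ap})"
      using unmark_model by (intro unmark_contr[OF ap] step.IH(2)[of n _ \<beta> v] bd) (simp_all add: True)
    ultimately show ?thesis using contractible.step[OF finP ap(1)] by blast
  next
    case uv: False
    have B: "contractible F {s\<in>P. u \<notin> \<beta> s \<or> proxy u (\<beta> s)}"
      using delete_model[OF step.hyps(2) uv] bd by (rule step.IH(2)[rotated])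
    \<comment> \<open>Two such cells would be edges \<open>{u, a}\<close> and \<open>{u, b}\<close> that lie in no larger clique, so that
      \<open>a\<close> would be isolated in the contractible unit sphere of \<open>u\<close>.\<close>
    have far: "\<beta> s \<inter> \<beta> t \<noteq> {u}"
      if st: "s \<in> P" "t \<in> P" "F s t" and card: "card (\<beta> s) = card (\<beta> t)" and u: "u \<in> \<beta> s" "u \<in> \<beta> t" for s t
    proof
      assume m: "\<beta> s \<inter> \<beta> t = {u}"
      define x y where "x = \<beta> s" and "y = \<beta> t"
      have Kx: "K x" and Ky: "K y" using clique_of st unfolding x_def y_def by blast+
      have fin: "finite x" "finite y" using cliqueD(3) Kx Ky by blast+
      have ns: "\<not> x \<subset> y" "\<not> y \<subset> x"
        using psubset_card_mono[OF fin(2), of x] psubset_card_mono[OF fin(1), of y] card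
        unfolding x_def y_def by linarith+
      have nv: "x \<noteq> {v}" "y \<noteq> {v}" using u uv unfolding x_def y_def by blast+
      have top: "card x = 2 \<and> (\<forall>w. w \<notin> x \<longrightarrow> \<not> K (insert w x))"
      proof (cases "bar x \<and> bar y")
        case True
        then have "card (x \<inter> y) + 2 = n" using bare_adj[OF st(1,2)] st(3) unfolding x_def y_def by blast
        moreover have "card x + 1 = n" using True bareD(3)[of E V n v x] by blast
        ultimately have "card x = 2" using m unfolding x_def y_def by simp
        moreover have "\<not> K (insert w x)" if "w \<notin> x" for w
          using True that bareD(4)[of E V n v x w] cliqueD(1)[of E V "insert w x"] by blast
        ultimately show ?thesis by blast
      next
        case False
        then have "adj x y" using adj_iff[OF st(1,2)] st(3) unfolding x_def y_def by blast
        then have c: "card x = n" "card (x \<inter> y) + 1 = n" unfolding cell_adj_def using ns nv by blast+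
        then have "card x = 2" using m unfolding x_def y_def by simp
        then show ?thesis using no_bigger[OF Kx c(1)] by blast
      qed
      have "card (x - {u}) = 1" using top u(1) fin unfolding x_def by simp
      then obtain a where "x - {u} = {a}" by (rule card_1_singletonE)
      then have a: "x = {u, a}" "a \<noteq> u" using u(1) unfolding x_def by blast+
      have "card (y - {u}) = 1" using top card u(2) fin unfolding x_def y_def by simp
      then obtain b where "y - {u} = {b}" by (rule card_1_singletonE)
      then have b: "y = {u, b}" "b \<noteq> u" using u(2) unfolding y_def by blast+
      have an: "a \<in> nbrs E V u" using Kx a by (auto simp: clique_def nbrs_def)
      have bn: "b \<in> nbrs E V u" using Ky b by (auto simp: clique_def nbrs_def)
      have "nbrs E V u = {a}"
      proof (rule contr_isolated[OF step.hyps(3) an])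
        fix c assume c: "c \<in> nbrs E V u"
        show "\<not> E a c"
        proof
          assume ac: "E a c"
          then have "c \<notin> x" using a c irr by (auto simp: nbrs_def)
          moreover have "K (insert c x)"
            using c ac a by (intro clique_insert[OF Kx]) (auto simp: nbrs_def sym)
          ultimately show False using top by blast
        qed
      qed
      then have "b = a" using bn by simp
      then have "x = y" using a(1) b(1) by simp
      then have "s = t" using inj[OF st(1,2)] unfolding x_def y_def by blast
      then show False using st(3) Fg.irr by blast
    qed
    show ?thesis
    proof (cases "cel {u}")
      case False
      then show ?thesis
        using far cell_of by (intro delete_contr[OF step.hyps(2) uv _ _ _ _ B]) (blast, blast, metis, metis)
    next
      case True
      then obtain ap where ap: "ap \<in> P" "\<beta> ap = {u}" using ex_cell by blast
      have nb: "\<not> bar {u}" using Kup bareD(4)[of E V n v "{u}" p] pu by (auto simp: insert_commute)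
      have vu: "v \<notin> {u}" using uv by simp
      have cu: "card {u} < n" using n2 by simp
      have single: "a = b" if "card {u} + 1 = n" "a \<in> link E V {u}" "b \<in> link E V {u}" "a \<noteq> v" "b \<noteq> v" for a b
      proof -
        have "K {v, u}" using True nb uv that(1) unfolding cell_def by auto
        then have vn: "v \<in> nbrs E V u" using uv by (auto simp: clique_def nbrs_def)
        have "nbrs E V u = {v}"
        proof (rule contr_isolated[OF step.hyps(3) vn])
          fix c assume c: "c \<in> nbrs E V u"
          show "\<not> E v c"
          proof
            assume vc: "E v c"
            then have "K {c, v, u}" using c by (intro clique_insert[OF \<open>K {v, u}\<close>]) (auto simp: nbrs_def sym)
            moreover have "card {c, v, u} = 3" using vc c irr uv by (auto simp: nbrs_def card_insert_if)
            ultimately show False using bound[of "{c, v, u}"] that(1) by simp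
          qed
        qed
        then show ?thesis using that link_singleton by simp
      qed
      have lm: "model F (upper {u}) (\<lambda>t. \<beta> t - {u}) E (link E V {u}) (n - card {u}) v"
        "\<And>z. clique E (link E V {u}) z \<Longrightarrow> card z \<le> n - card {u}"
        using link_model[OF ap vu nb cu single] by blast+
      have "lower {u} = {}" using cliqueD(2)[OF clique_of] unfolding lower_def by blast
      then have "nbrs F P ap = upper {u}" using link_split(1)[OF ap vu nb cu] by simp
      moreover have "contractible F (upper {u})"
        using step.IH(1)[OF _ lm(1)[unfolded link_singleton]] lm(2)[unfolded link_singleton] by blast
      moreover have "contractible F (P - {ap})"
      proof (rule delete_contr[OF step.hyps(2) uv _ _ _ _ B])
        show "{s \<in> P. u \<notin> \<beta> s \<or> proxy u (\<beta> s)} \<subseteq> P - {ap}"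
          using ap(2) n2 unfolding proxy_def by auto
        show "\<And>s. s \<in> P - {ap} \<Longrightarrow> \<beta> s \<noteq> {u}" using inj ap by (metis DiffD1 DiffD2 singletonI)
      qed (use far in auto)
      ultimately show ?thesis using contractible.step[OF finP ap(1)] by simp
    qed
  qed
qed

section \<open>Refining a sphere\<close>
lemma (in sgraph) sph_clique:
  "sph E m V \<Longrightarrow> clique E V x \<Longrightarrow> card x \<le> m \<and> sph E (m - card x) (link E V x)"
  by (rule clique_descent) simp_all

lemma (in sgraph) sph_facet: "sph E (Suc m) V \<Longrightarrow> \<exists>x. clique E V x \<and> card x = Suc m"
proof (induction m arbitrary: V)
  case 0
  then obtain w where "w \<in> V" by auto
  then show ?case by (intro exI[of _ "{w}"]) (simp add: clique_def)
next
  case (Suc m)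
  then obtain w where w: "w \<in> V" "sph E (Suc m) (nbrs E V w)" by auto
  then obtain x where x: "clique E (nbrs E V w) x" "card x = Suc m" using Suc.IH by blast
  have xw: "w \<notin> x" "\<And>b. b \<in> x \<Longrightarrow> E w b" "x \<subseteq> V" using cliqueD(1)[OF x(1)] irr by (auto simp: nbrs_def)
  then have "clique E V x" using x(1) unfolding clique_def by blast
  then have "clique E V (insert w x)" using clique_insert[OF _ w(1)] xw by blast
  moreover have "card (insert w x) = Suc (Suc m)" using xw x cliqueD(3)[OF x(1)] by simp
  ultimately show ?case by blast
qed

lemma (in sgraph) sph_1: assumes "sph E 1 V" shows "\<exists>a b. V = {a, b} \<and> a \<noteq> b \<and> \<not> E a b"
proof -
  have nb: "nbrs E V w = {}" if "w \<in> V" for w using assms that by simp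
  obtain v where v: "v \<in> V" "contractible E (V - {v})" using assms by auto
  obtain a where a: "a \<in> V - {v}" using contr_nonempty[OF v(2)] by blast
  have "V - {v} = {a}" using contr_isolated[OF v(2) a] nb[of a] a unfolding nbrs_def by blast
  then have "V = {v, a}" "v \<noteq> a" using v(1) by blast+
  moreover have "\<not> E v a" using nb[OF v(1)] a unfolding nbrs_def by blast
  ultimately show ?thesis by blast
qed

text \<open>
  Around a facet \<open>x\<close>, a neighbour \<open>t\<close> is either a face of \<open>x\<close> or a facet, and both are
  determined by the face \<open>\<beta> t \<inter> x\<close>.  Two facets around \<open>x\<close> are never adjacent: otherwise the
  three would lie in a larger clique.
\<close>
lemma (in sgraph) facet_iso:
  assumes x: "clique E V x" "card x = n" and bound: "\<And>y. clique E V y \<Longrightarrow> card y \<le> n"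
    and inj: "\<And>s t. s \<in> L \<Longrightarrow> t \<in> L \<Longrightarrow> \<beta> s = \<beta> t \<Longrightarrow> s = t"
    and clique: "\<And>t. t \<in> L \<Longrightarrow> clique E V (\<beta> t)"
    and L: "\<And>t. t \<in> L \<Longrightarrow> \<beta> t \<subset> x \<or> card (\<beta> t) = n \<and> \<beta> t \<inter> x \<noteq> {} \<and> card (\<beta> t \<inter> x) + 1 = n"
    and small: "\<And>y. y \<noteq> {} \<Longrightarrow> y \<subseteq> x \<Longrightarrow> card y + 2 \<le> n \<Longrightarrow> \<exists>t\<in>L. \<beta> t = y"
    and face: "\<And>f. f \<noteq> {} \<Longrightarrow> f \<subseteq> x \<Longrightarrow> card f + 1 = n \<Longrightarrow> \<exists>!t. t \<in> L \<and> \<beta> t \<inter> x = f"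
    and adj: "\<And>s t. s \<in> L \<Longrightarrow> t \<in> L \<Longrightarrow> F s t \<longleftrightarrow> \<beta> s \<subset> \<beta> t \<or> \<beta> t \<subset> \<beta> s \<or>
      (card (\<beta> s) = n \<and> card (\<beta> t) = n \<and> \<beta> s \<inter> \<beta> t \<noteq> {} \<and> card (\<beta> s \<inter> \<beta> t) + 1 = n)"
  shows "graph_iso (\<lambda>t. \<beta> t \<inter> x) F L comparable {y. y \<noteq> {} \<and> y \<subset> x}"
proof -
  define h where "h t = \<beta> t \<inter> x" for t
  have finx: "finite x" using cliqueD(3)[OF x(1)] .
  have fin: "finite (\<beta> t)" if "t \<in> L" for t using cliqueD(3)[OF clique[OF that]] .
  have lower: "card (\<beta> t) < n \<and> h t = \<beta> t" if "\<beta> t \<subset> x" for t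
    using psubset_card_mono[OF finx that] x(2) that unfolding h_def by blast
  have upper: "card (\<beta> t) = n \<and> card (h t) + 1 = n \<and> h t \<subset> \<beta> t" if t: "t \<in> L" "\<not> \<beta> t \<subset> x" for t
  proof -
    have c: "card (\<beta> t) = n" "card (h t) + 1 = n" using L[OF t(1)] t(2) unfolding h_def by blast+
    then have "h t \<noteq> \<beta> t" by auto
    then show ?thesis using c unfolding h_def by blast
  qed
  have h_in: "h t \<noteq> {} \<and> h t \<subset> x" if t: "t \<in> L" for t
  proof (cases "\<beta> t \<subset> x")
    case True
    then show ?thesis using lower[OF True] cliqueD(2)[OF clique[OF t]] by auto
  next
    case False
    then have "h t \<noteq> x" using upper[OF t False] x(2) by auto
    then show ?thesis using L[OF t] False unfolding h_def by blast
  qed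
  have h_inj: "s = t" if st: "s \<in> L" "t \<in> L" "h s = h t" for s t
  proof (cases "card (h s) + 1 = n")
    case True
    have "h s \<noteq> {}" "h s \<subseteq> x" using h_in[OF st(1)] by blast+
    then show ?thesis using face[OF _ _ True] st unfolding h_def by blast
  next
    case False
    then have "\<beta> s \<subset> x" "\<beta> t \<subset> x" using upper[OF st(1)] upper[OF st(2)] st(3) by metis+
    then show ?thesis using lower inj[OF st(1,2)] st(3) by metis
  qed
  have "h ` L = {y. y \<noteq> {} \<and> y \<subset> x}"
  proof (intro equalityI subsetI)
    fix y assume "y \<in> h ` L"
    then show "y \<in> {y. y \<noteq> {} \<and> y \<subset> x}" using h_in by blast
  next
    fix y assume "y \<in> {y. y \<noteq> {} \<and> y \<subset> x}"
    then have y: "y \<noteq> {}" "y \<subset> x" by blast+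
    have "card y < n" using psubset_card_mono[OF finx y(2)] x(2) by simp
    then consider "card y + 2 \<le> n" | "card y + 1 = n" by linarith
    then show "y \<in> h ` L"
    proof cases
      case 1
      then obtain t where t: "t \<in> L" "\<beta> t = y" using small[of y] y by blast
      then have "h t = y" using y(2) unfolding h_def by blast
      then show ?thesis using t(1) by blast
    next
      case 2
      then obtain t where "t \<in> L" "h t = y" using face[of y] y unfolding h_def by blast
      then show ?thesis by blast
    qed
  qed
  then have bij: "bij_betw h L {y. y \<noteq> {} \<and> y \<subset> x}"
    using h_inj unfolding bij_betw_def by (simp add: inj_on_def)
  have mixed: "F s t \<longleftrightarrow> comparable (h s) (h t)" if st: "s \<in> L" "t \<in> L" "\<beta> s \<subset> x" "\<not> \<beta> t \<subset> x" for s t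
  proof -
    have s: "card (\<beta> s) < n" "h s = \<beta> s" using lower[OF st(3)] by blast+
    have t: "card (\<beta> t) = n" "card (h t) + 1 = n" "h t \<subset> \<beta> t" using upper[OF st(2,4)] by blast+
    have "s \<noteq> t" using st(3,4) by blast
    then have ne: "h s \<noteq> h t" using h_inj[OF st(1,2)] by blast
    have "\<not> \<beta> t \<subset> \<beta> s" using psubset_card_mono[OF fin[OF st(1)], of "\<beta> t"] s t by linarith
    moreover have "\<not> h t \<subset> h s" using psubset_card_mono[OF fin[OF st(1)], of "h t"] s t by auto
    moreover have "\<beta> s \<subset> \<beta> t \<longleftrightarrow> h s \<subset> h t"
    proof
      assume "\<beta> s \<subset> \<beta> t"
      then have "h s \<subseteq> h t" unfolding h_def by blast
      then show "h s \<subset> h t" using ne by blast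
    next
      assume "h s \<subset> h t"
      then show "\<beta> s \<subset> \<beta> t" unfolding s(2)[symmetric] using t(3) by (rule psubset_trans)
    qed
    ultimately show ?thesis using adj[OF st(1,2)] s(1) unfolding comparable_def by auto
  qed
  have Fsym: "F s t \<longleftrightarrow> F t s" if st: "s \<in> L" "t \<in> L" for s t
    unfolding adj[OF st] adj[OF st(2,1)] by (simp only: Int_commute[of "\<beta> t"]) blast
  have "F s t \<longleftrightarrow> comparable (h s) (h t)" if st: "s \<in> L" "t \<in> L" for s t
  proof (cases "\<beta> s \<subset> x"; cases "\<beta> t \<subset> x")
    assume sub: "\<beta> s \<subset> x" "\<beta> t \<subset> x"
    have "card (\<beta> s) \<noteq> n" "h s = \<beta> s" "h t = \<beta> t" using lower[OF sub(1)] lower[OF sub(2)] by auto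
    then show ?thesis using adj[OF st] unfolding comparable_def by simp
  next
    assume "\<beta> s \<subset> x" "\<not> \<beta> t \<subset> x"
    then show ?thesis using mixed st by blast
  next
    assume "\<not> \<beta> s \<subset> x" "\<beta> t \<subset> x"
    then show ?thesis using mixed[OF st(2,1)] Fsym[OF st] unfolding comparable_def by blast
  next
    assume ns: "\<not> \<beta> s \<subset> x" "\<not> \<beta> t \<subset> x"
    have s: "card (\<beta> s) = n" "card (h s) + 1 = n" using upper[OF st(1) ns(1)] by blast+
    have t: "card (\<beta> t) = n" "card (h t) + 1 = n" using upper[OF st(2) ns(2)] by blast+
    have "\<not> \<beta> s \<subset> \<beta> t" "\<not> \<beta> t \<subset> \<beta> s"
      using psubset_card_mono[OF fin[OF st(2)], of "\<beta> s"] psubset_card_mono[OF fin[OF st(1)], of "\<beta> t"] s t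
      by linarith+
    moreover have "card (\<beta> s \<inter> \<beta> t) + 1 \<noteq> n"
    proof
      assume m: "card (\<beta> s \<inter> \<beta> t) + 1 = n"
      then have "s \<noteq> t" using s(1) by auto
      then have "h s \<noteq> h t" using h_inj[OF st] by blast
      then have ne: "x \<inter> \<beta> s \<noteq> x \<inter> \<beta> t" unfolding h_def by blast
      have "\<exists>p\<in>V. p \<notin> x \<and> clique E V (insert p x)"
        by (rule clique_triangle[OF x(1) clique[OF st(1)] clique[OF st(2)] _ _ _ _ _ ne])
          (use s t m x(2) in \<open>simp_all add: h_def Int_commute\<close>)
      then show False using bound finx x(2) by fastforce
    qed
    moreover have "\<not> h s \<subset> h t" "\<not> h t \<subset> h s"
      using psubset_card_mono[of "h t" "h s"] psubset_card_mono[of "h s" "h t"] s(2) t(2)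
        finite_subset[OF psubset_imp_subset finx] h_in[OF st(1)] h_in[OF st(2)] by (metis less_irrefl add_right_cancel)+
    ultimately show ?thesis using adj[OF st] unfolding comparable_def by blast
  qed
  then have "graph_iso h F L comparable {y. y \<noteq> {} \<and> y \<subset> x}" using bij unfolding graph_iso_def by blast
  then show ?thesis unfolding h_def .
qed

text \<open>
  The case \<open>n = m\<close> is the soft refinement, the case \<open>m + 2 \<le> n\<close> the ordinary one.  The latter
  enters the induction for the former through the unit sphere of \<open>{v}\<close>.  No cell of a sphere is bare,
  since in the case \<open>n = m\<close> every simplex of size \<open>n - 1\<close> lies in two facets.
\<close>
lemma sph_refinement:
  assumes "sph E m V" "sgraph E" "sgraph F" "n = m \<or> m + 2 \<le> n" "model F P \<beta> E V n v"
  shows "sph F m P"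
  using assms(1,4,5)
proof (induction m arbitrary: V n v P \<beta> rule: less_induct)
  case (less m)
  interpret sgraph E by fact
  interpret Fg: sgraph F by fact
  interpret refinement E F P \<beta> V n v
  proof unfold_locales
    show "finite V" using sph_finite[OF less.prems(1)] .
    show "card x \<le> n" if "clique E V x" for x
      using sph_clique[OF less.prems(1) that] less.prems(2) by linarith
  qed (rule less.prems(3))
  note link = sph_clique[OF less.prems(1)]
  show ?case
  proof (cases m)
    case 0
    then have "V = {}" using less.prems(1) by simp
    then have "\<not> cel x" for x using cliqueD(1,2)[OF cell_clique] by blast
    then show ?thesis using bij 0 by (simp add: bij_betw_def)
  next
    case m: (Suc m')
    have two: "\<exists>c d. link E V x = {c, d} \<and> c \<noteq> d" if "K x" "card x + 1 = n"
      and "n = m" for x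
    proof -
      have "m - card x = 1" using that by linarith
      then show ?thesis using link[OF that(1)] sph_1 by metis
    qed
    have nm: "n = m" if "K x" "card x + 1 = n \<or> card x = n" for x
      using less.prems(2) link[OF that(1)] that(2) by linarith
    have nobare: "\<not> bar x" for x
    proof
      assume b: "bar x"
      have Kx: "K x" and c: "card x + 1 = n" using bareD[OF b] by blast+
      obtain w where w: "w \<in> link E V x" using two[OF Kx c nm[OF Kx]] c by blast
      then have "w \<in> V" "w \<notin> x" unfolding link_def by blast+
      then show False using bareD(4)[OF b, of w] clique_insert_link[OF Kx, of w] w by blast
    qed
    have F_iff: "F s t \<longleftrightarrow> adj (\<beta> s) (\<beta> t)" if "s \<in> P" "t \<in> P" for s t
      using adj_iff[OF that] nobare by blast
    have "P \<noteq> {}"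
    proof -
      obtain x where x: "K x" "card x = m" using sph_facet less.prems(1) m by blast
      have "\<exists>y. cel y"
      proof (cases "v \<in> V")
        case True then show ?thesis unfolding cell_def by blast
      next
        case False
        then have "v \<notin> x" using cliqueD(1)[OF x(1)] by blast
        then show ?thesis using facet_cell small_cell x less.prems(2) by metis
      qed
      then show ?thesis using ex_cell by blast
    qed
    moreover have "sph F m' (nbrs F P s)" if s: "s \<in> P" for s
    proof -
      define x where "x = \<beta> s"
      have Kx: "K x" and cx: "cel x" using clique_of[OF s] cell_of[OF s] unfolding x_def by blast+
      have finx: "finite x" "x \<noteq> {}" using cliqueD(2,3)[OF Kx] by blast+
      have cx0: "card x > 0" using finx by (simp add: card_gt_0_iff)
      have cxm: "card x \<le> m" using link[OF Kx] by blast
      consider "x = {v}" | "v \<notin> x" "card x < n" | "v \<notin> x" "card x = n"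
        using cell_v[OF cx] bound[OF Kx] by linarith
      then show ?thesis
      proof cases
        case 1
        then have sv: "\<beta> s = {v}" unfolding x_def .
        have vV: "v \<in> V" using cliqueD(1)[OF Kx] 1 by blast
        have "sph E m' (nbrs E V v)" using less.prems(1) m vV by simp
        then show ?thesis
          using apex_link_model(1)[OF s sv] less.prems(2) m
          by (intro less.IH[of m' "nbrs E V v" "n + 1" _ \<beta> v]) auto
      next
        case 2
        have single: "p = q" if pq: "card x + 1 = n" "p \<in> link E V x" "q \<in> link E V x" "p \<noteq> v" "q \<noteq> v" for p q
        proof -
          have "K (insert v x)" using cx 2(1) nobare pq(1) unfolding cell_def by auto
          then have "v \<in> link E V x" using clique_insert_link[OF Kx 2(1)] by blast
          moreover obtain c d where "link E V x = {c, d}" using two[OF Kx pq(1)] nm[OF Kx] pq(1) by blast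
          ultimately show ?thesis using pq by auto
        qed
        note ls = link_split[OF s x_def[symmetric] 2(1) nobare 2(2)]
        note lm = link_model(1)[OF s x_def[symmetric] 2(1) nobare 2(2) single]
        have "sph F (m - card x) (upper x)"
        proof (rule less.IH[OF _ _ _ lm])
          show "m - card x < m" using cx0 m by linarith
          show "sph E (m - card x) (link E V x)" using link[OF Kx] by blast
          show "n - card x = m - card x \<or> m - card x + 2 \<le> n - card x"
            using less.prems(2) cxm by linarith
        qed
        then have "sph F (card x - 1 + (m - card x)) (lower x \<union> upper x)"
          using ls by (intro Fg.sph_join) blast+
        moreover have "card x - 1 + (m - card x) = m'" using cx0 cxm m by linarith
        ultimately show ?thesis using ls(1) by simp
      next
        case 3
        have n: "n = m" using nm[OF Kx] 3 by blast
        have L: "\<beta> t \<subset> x \<or> card (\<beta> t) = n \<and> \<beta> t \<inter> x \<noteq> {} \<and> card (\<beta> t \<inter> x) + 1 = n"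
          if t: "t \<in> nbrs F P s" for t
        proof -
          have tP: "t \<in> P" and st: "F s t" using t by (auto simp: nbrs_def)
          have "adj x (\<beta> t)" using F_iff[OF s tP] st unfolding x_def by blast
          moreover have "\<not> x \<subset> \<beta> t" using facet_maximal[OF Kx clique_of[OF tP] 3(2)] .
          moreover have "\<not> K (insert v x)" using no_bigger[OF Kx 3(2,1)] .
          moreover have "x \<noteq> {v}" using 3(1) by blast
          ultimately show ?thesis unfolding cell_adj_def by (simp add: Int_commute) blast
        qed
        have LP: "t \<in> P" if "t \<in> nbrs F P s" for t using that by (simp add: nbrs_def)
        have LI: "t \<in> nbrs F P s" if "t \<in> P" "adj x (\<beta> t)" for t
          using that F_iff[OF s that(1)] unfolding x_def by (simp add: nbrs_def)
        have nv: "\<beta> t \<noteq> {v}" "v \<notin> \<beta> t" if t: "t \<in> nbrs F P s" for t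
        proof -
          show 1: "\<beta> t \<noteq> {v}" using L[OF t] 3(1) by auto
          show "v \<notin> \<beta> t" using cell_v[OF cell_of[OF LP[OF t]]] 1 by blast
        qed
        have "graph_iso (\<lambda>t. \<beta> t \<inter> x) F (nbrs F P s) comparable {y. y \<noteq> {} \<and> y \<subset> x}"
        proof (rule facet_iso[OF Kx 3(2) bound])
          show "t = r" if "t \<in> nbrs F P s" "r \<in> nbrs F P s" "\<beta> t = \<beta> r" for t r
            using inj LP that by blast
          show "K (\<beta> t)" if "t \<in> nbrs F P s" for t using clique_of LP that by blast
          show "\<exists>t\<in>nbrs F P s. \<beta> t = y" if y: "y \<noteq> {}" "y \<subseteq> x" "card y + 2 \<le> n" for y
          proof -
            have "K y" using clique_subset[OF Kx y(2,1)] .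
            moreover have "v \<notin> y" using y(2) 3(1) by blast
            ultimately obtain t where t: "t \<in> P" "\<beta> t = y" using ex_cell[OF small_cell] y(3) by blast
            have "y \<noteq> x" using y(3) 3(2) by auto
            then have "adj x (\<beta> t)" using y(2) t(2) by (intro adjI_sub) blast
            then show ?thesis using LI[OF t(1)] t(2) by blast
          qed
          show "F t r \<longleftrightarrow> \<beta> t \<subset> \<beta> r \<or> \<beta> r \<subset> \<beta> t \<or>
              (card (\<beta> t) = n \<and> card (\<beta> r) = n \<and> \<beta> t \<inter> \<beta> r \<noteq> {} \<and> card (\<beta> t \<inter> \<beta> r) + 1 = n)"
            if "t \<in> nbrs F P s" "r \<in> nbrs F P s" for t r
            using F_iff[OF LP[OF that(1)] LP[OF that(2)]] nv(1)[OF that(1)] nv(1)[OF that(2)]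
            unfolding cell_adj_def by simp
          show "\<exists>!t. t \<in> nbrs F P s \<and> \<beta> t \<inter> x = f" if f: "f \<noteq> {}" "f \<subseteq> x" "card f + 1 = n" for f
          proof -
            have Kf: "K f" using clique_subset[OF Kx f(2,1)] .
            have finf: "finite f" using cliqueD(3)[OF Kf] .
            have vf: "v \<notin> f" using f(2) 3(1) by blast
            have "card (x - f) = 1" using f 3(2) finf by (simp add: card_Diff_subset)
            then obtain w where "x - f = {w}" by (rule card_1_singletonE)
            then have w: "w \<notin> f" "x = insert w f" using f(2) by blast+
            have wl: "w \<in> link E V f" using clique_insert_link[OF Kf w(1)] Kx w(2) by simp
            obtain w' where w': "link E V f = {w, w'}" "w' \<noteq> w"
            proof -
              obtain c d where "link E V f = {c, d}" "c \<noteq> d" using two[OF Kf f(3) n] by blast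
              then show ?thesis using wl that[of c] that[of d] by (metis insert_commute insertE singletonD)
            qed
            have w'f: "w' \<notin> f" using w'(1) unfolding link_def by blast
            have Kw': "K (insert w' f)" using clique_insert_link[OF Kf w'f] w'(1) by blast
            have wv: "w \<noteq> v" using w(2) 3(1) by blast
            have facet: "\<beta> t = insert w' f" if t: "t \<in> nbrs F P s" "\<beta> t \<inter> x = f" "\<not> \<beta> t \<subset> x" for t
            proof -
              have "card (\<beta> t) = n" using L[OF t(1)] t(3) by blast
              then show ?thesis
                using facet_across[OF Kf w'(1) clique_of[OF LP[OF t(1)]]] f(3) t(2) w(2) by simp
            qed
            have face: "\<beta> t = f" if "\<beta> t \<inter> x = f" "\<beta> t \<subset> x" for t using that by blast
            show ?thesis
            proof (cases "w' = v")
              case True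
              have "cel f" using bdry_cell[OF Kf vf f(3)] Kw' True by blast
              then obtain t where t: "t \<in> P" "\<beta> t = f" using ex_cell by blast
              have fx: "f \<subset> x" using w by blast
              then have "adj x (\<beta> t)" using t(2) by (intro adjI_sub) blast
              then have "t \<in> nbrs F P s \<and> \<beta> t \<inter> x = f" using LI[OF t(1)] t(2) fx by blast
              moreover have "r = t" if r: "r \<in> nbrs F P s \<and> \<beta> r \<inter> x = f" for r
              proof -
                have "\<beta> r \<subset> x" using facet[of r] nv(2)[of r] r True by blast
                then have "\<beta> r = \<beta> t" using face[of r] r t(2) by blast
                then show ?thesis using inj LP t(1) r by blast
              qed
              ultimately show ?thesis by blast
            next
              case False
              define y where "y = insert w' f"
              have Ky: "K y" and vy: "v \<notin> y" and cy: "card y = n"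
                using Kw' False vf w'f finf f(3) unfolding y_def by auto
              obtain t where t: "t \<in> P" "\<beta> t = y" using ex_cell[OF facet_cell[OF Ky vy cy]] by blast
              have yx: "y \<inter> x = f" using w(2) w'(2) w'f w(1) unfolding y_def by blast
              have "adj x (\<beta> t)" using t(2) yx cy 3(2) f unfolding cell_adj_def by (simp add: Int_commute)
              then have "t \<in> nbrs F P s \<and> \<beta> t \<inter> x = f" using LI[OF t(1)] t(2) yx by blast
              moreover have "r = t" if r: "r \<in> nbrs F P s \<and> \<beta> r \<inter> x = f" for r
              proof -
                have "\<not> cel f"
                proof
                  assume "cel f"
                  then have "K (insert v f)" using nobare f(3) vf unfolding cell_def by auto
                  then have "v \<in> link E V f" using clique_insert_link[OF Kf vf] by blast
                  then show False using w'(1) wv False by simp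
                qed
                then have "\<not> \<beta> r \<subset> x" using face[of r] cell_of[OF LP[of r]] r by metis
                then have "\<beta> r = \<beta> t" using facet[of r] r t(2) unfolding y_def by blast
                then show ?thesis using inj LP t(1) r by blast
              qed
              ultimately show ?thesis by blast
            qed
          qed
        qed (use L in blast)+
        then have "sph F (card x - 1) (nbrs F P s)" using sph_boundary finx by blast
        then show ?thesis using 3(2) n m by simp
      qed
    qed
    \<comment> \<open>Let the deletion of \<open>u\<close> make \<open>V\<close> contractible.  The cell to delete is \<open>{u}\<close> if there is such
      a cell.  Otherwise \<open>n = 2\<close>, so that \<open>V\<close> is one-dimensional, and an edge at \<open>u\<close> is deleted instead.\<close>
    moreover have "\<exists>s\<in>P. contractible F (P - {s})"
    proof -
      obtain u where u: "u \<in> V" "contractible E (V - {u})" using less.prems(1) m by auto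
      have bd: "card x \<le> n" if "clique E (V - {u}) x" for x using bound that clique_delete by metis
      show ?thesis
      proof (cases "u = v")
        case True
        then obtain ap where ap: "ap \<in> P" "\<beta> ap = {v}" using ex_cell[of "{v}"] u(1) by (auto simp: cell_def)
        have "contractible F {s \<in> P. v \<notin> \<beta> s \<and> \<not> two_sided (\<beta> s)}"
          using contr_refinement[OF u(2) assms(2,3) bd] unmark_model True by blast
        then show ?thesis using unmark_contr[OF ap] ap(1) by blast
      next
        case uv: False
        have B: "contractible F {s\<in>P. u \<notin> \<beta> s \<or> proxy u (\<beta> s)}"
          by (rule contr_refinement[OF u(2) assms(2,3) bd delete_model[OF u(1) uv]])
        have Ku: "K {u}" using u(1) by (rule clique_singleton)
        have pair: "\<exists>a b. n = 2 \<and> \<beta> s = {u, a} \<and> \<beta> t = {u, b} \<and> a \<noteq> b \<and> a \<noteq> v \<and> b \<noteq> v \<and>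
            a \<in> link E V {u} \<and> b \<in> link E V {u}"
          if st: "s \<in> P" "t \<in> P" "F s t" and card: "card (\<beta> s) = card (\<beta> t)"
            and us: "u \<in> \<beta> s" "u \<in> \<beta> t" and e: "\<beta> s \<inter> \<beta> t = {u}" for s t
        proof -
          have fin: "finite (\<beta> s)" "finite (\<beta> t)" using cliqueD(3) clique_of st by blast+
          have "\<not> \<beta> s \<subset> \<beta> t" "\<not> \<beta> t \<subset> \<beta> s"
            using psubset_card_mono[OF fin(2), of "\<beta> s"] psubset_card_mono[OF fin(1), of "\<beta> t"] card by linarith+
          moreover have nv: "\<beta> s \<noteq> {v}" "\<beta> t \<noteq> {v}" using us uv by blast+
          ultimately have "card (\<beta> s) = n" "card (\<beta> s \<inter> \<beta> t) + 1 = n"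
            using F_iff[OF st(1,2)] st(3) unfolding cell_adj_def by blast+
          then have c: "n = 2" "card (\<beta> s) = 2" "card (\<beta> t) = 2" using e card by simp_all
          have other: "\<exists>a. \<beta> r = {u, a} \<and> a \<noteq> v \<and> a \<in> link E V {u} \<and> a \<noteq> u"
            if r: "r \<in> P" "u \<in> \<beta> r" "card (\<beta> r) = 2" for r
          proof -
            have "card (\<beta> r - {u}) = 1" using r by simp
            then obtain a where "\<beta> r - {u} = {a}" by (rule card_1_singletonE)
            then have a: "\<beta> r = {u, a}" "a \<noteq> u" using r(2) by blast+
            have "v \<notin> \<beta> r" using cell_v[OF cell_of[OF r(1)]] r(2) uv by blast
            then have "a \<noteq> v" using a(1) by blast
            moreover have "a \<in> link E V {u}"
              using clique_insert_link[OF Ku, of a] a clique_of[OF r(1)] by (simp add: insert_commute)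
            ultimately show ?thesis using a by blast
          qed
          obtain a b where a: "\<beta> s = {u, a}" "a \<noteq> v" "a \<in> link E V {u}" "a \<noteq> u"
            and b: "\<beta> t = {u, b}" "b \<noteq> v" "b \<in> link E V {u}"
            using other[OF st(1) us(1) c(2)] other[OF st(2) us(2) c(3)] by blast
          have "a \<noteq> b" using a(1,4) b(1) e by blast
          then show ?thesis using a b c(1) by blast
        qed
        show ?thesis
        proof (cases "cel {u}")
          case True
          then obtain ap where ap: "ap \<in> P" "\<beta> ap = {u}" using ex_cell by blast
          have np: "\<not> proxy u {u}" using cliqueD(2)[OF bareD(2)] unfolding proxy_def by fastforce
          have "contractible F (P - {ap})"
          proof (rule delete_contr[OF u(1) uv _ _ _ _ B])
            show "{s\<in>P. u \<notin> \<beta> s \<or> proxy u (\<beta> s)} \<subseteq> P - {ap}" using ap(2) np by auto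
            show "\<beta> s \<noteq> {u}" if "s \<in> P - {ap}" for s using inj[OF _ ap(1)] that ap(2) by auto
            fix s t assume st: "s \<in> P - {ap}" "t \<in> P - {ap}" "F s t" "card (\<beta> s) = card (\<beta> t)"
              "u \<in> \<beta> s" "u \<in> \<beta> t"
            show "\<beta> s \<inter> \<beta> t \<noteq> {u}"
            proof
              assume "\<beta> s \<inter> \<beta> t = {u}"
              then obtain a b where ab: "n = 2" "a \<noteq> b" "a \<noteq> v" "b \<noteq> v" "a \<in> link E V {u}" "b \<in> link E V {u}"
                using pair[of s t] st by blast
              have "K (insert v {u})" using True nobare ab(1) uv unfolding cell_def by auto
              then have "v \<in> link E V {u}" using clique_insert_link[OF Ku, of v] uv by blast
              moreover obtain c d where "link E V {u} = {c, d}" using two[OF Ku] nm[OF Ku] ab(1) by auto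
              ultimately show False using ab by auto
            qed
          qed simp
          then show ?thesis using ap(1) by blast
        next
          case nc: False
          have cu: "card {u} = 1" by simp
          have "n \<ge> 1" using bound[OF Ku] cu by linarith
          moreover have "n \<noteq> 1" "\<not> 3 \<le> n" using facet_cell[OF Ku] small_cell[OF Ku] nc uv cu by auto
          ultimately have n2: "n = 2" by linarith
          then have n: "n = m" using nm[OF Ku] cu by linarith
          obtain p p' where p: "link E V {u} = {p, p'}" "p \<noteq> p'" using two[OF Ku] n2 n by auto
          have pV: "p \<in> V" "p \<noteq> u" using p(1) unfolding link_def by blast+
          have Kup: "K {u, p}" using clique_insert_link[OF Ku, of p] p(1) pV by (simp add: insert_commute)
          have "\<not> K (insert v {u})" using bdry_cell[OF Ku] n2 nc uv by auto
          then have "v \<notin> link E V {u}" using clique_insert_link[OF Ku, of v] uv by auto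
          then have "v \<notin> {u, p}" using uv p(1) by blast
          moreover have "card {u, p} = n" using pV n2 by simp
          ultimately obtain w where w: "w \<in> P" "\<beta> w = {u, p}" using ex_cell[OF facet_cell[OF Kup]] by blast
          have Kp: "K {p}" using pV(1) by (rule clique_singleton)
          have np: "\<not> proxy u {u, p}"
          proof
            assume "proxy u {u, p}"
            then have b: "bare E (V - {u}) n v {p}" using pV unfolding proxy_def by (simp add: insert_Diff_if)
            obtain c d where cd: "link E V {p} = {c, d}" "c \<noteq> d" using two[OF Kp] n2 n by auto
            then obtain q where q: "q \<in> link E V {p}" "q \<noteq> u" by blast
            then have q': "q \<in> V" "q \<noteq> p" unfolding link_def by blast+
            have "K {q, p}" using clique_insert_link[OF Kp, of q] q q' by simp
            then have "clique E (V - {u}) {q, p}" using clique_delete[of E V u "{q, p}"] q pV by simp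
            then show False using bareD(4)[OF b, of q] q q' by simp
          qed
          have "contractible F (P - {w})"
          proof (rule delete_contr[OF u(1) uv _ _ _ _ B])
            show "{s\<in>P. u \<notin> \<beta> s \<or> proxy u (\<beta> s)} \<subseteq> P - {w}" using w(2) np by auto
            show "\<beta> s \<noteq> {u}" if "s \<in> P - {w}" for s using nc cell_of[of s] that by auto
            fix s t assume st: "s \<in> P - {w}" "t \<in> P - {w}" "F s t" "card (\<beta> s) = card (\<beta> t)"
              "u \<in> \<beta> s" "u \<in> \<beta> t"
            show "\<beta> s \<inter> \<beta> t \<noteq> {u}"
            proof
              assume "\<beta> s \<inter> \<beta> t = {u}"
              then obtain a b where ab: "\<beta> s = {u, a}" "\<beta> t = {u, b}" "a \<noteq> b"
                "a \<in> link E V {u}" "b \<in> link E V {u}"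
                using pair[of s t] st by blast
              have "a \<noteq> p" "b \<noteq> p" using inj[OF _ w(1)] st(1,2) ab(1,2) w(2) by auto
              then show False using ab p(1) by blast
            qed
          qed simp
          then show ?thesis using w(1) by blast
        qed
      qed
    qed
    ultimately show ?thesis using finP m by simp
  qed
qed

section \<open>Refining a manifold\<close>
text \<open>
  The flag \<open>b\<close> says whether balls are admitted.  A sphere arises as \<open>H - {v}\<close> with \<open>v \<notin> H\<close>, so that
  manifolds without and with boundary can be treated by the same argument.
\<close>
definition sphere_or_ball :: "bool \<Rightarrow> ('a \<Rightarrow> 'a \<Rightarrow> bool) \<Rightarrow> nat \<Rightarrow> 'a set \<Rightarrow> bool" where
  "sphere_or_ball b E k V \<longleftrightarrow> (\<exists>(F :: nat \<Rightarrow> nat \<Rightarrow> bool) H v h. sgraph F \<and> sph F k H \<and>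
     graph_iso h E V F (H - {v}) \<and> (v \<in> H \<longrightarrow> b))"

definition manifold_on :: "bool \<Rightarrow> ('a \<Rightarrow> 'a \<Rightarrow> bool) \<Rightarrow> nat \<Rightarrow> 'a set \<Rightarrow> bool" where
  "manifold_on b E m V \<longleftrightarrow> m > 0 \<and> finite V \<and> V \<noteq> {} \<and> (\<forall>v\<in>V. sphere_or_ball b E (m - 1) (nbrs E V v))"

lemma sgraph_pullback:
  assumes "sgraph G" "inj_on i W"
  shows "sgraph (\<lambda>a b. \<exists>x\<in>W. \<exists>y\<in>W. a = i x \<and> b = i y \<and> G x y)"
proof
  interpret G: sgraph G by fact
  show "\<exists>x\<in>W. \<exists>y\<in>W. b = i x \<and> a = i y \<and> G x y" if "\<exists>x\<in>W. \<exists>y\<in>W. a = i x \<and> b = i y \<and> G x y" for a b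
    using that G.sym by blast
  show "\<not> (\<exists>x\<in>W. \<exists>y\<in>W. a = i x \<and> a = i y \<and> G x y)" for a
    using G.irr inj_onD[OF assms(2)] by metis
qed

text \<open>
  The enclosing sphere may live on any type, since finite graphs have copies on the natural numbers.
\<close>
lemma sphere_or_ballI:
  assumes "sgraph G" "sph G k W" "graph_iso h E V G (W - {c})" "c \<in> W \<longrightarrow> b"
  shows "sphere_or_ball b E k V"
proof -
  have "finite (insert c W)" using sph_finite[OF assms(2)] by simp
  then obtain i :: "_ \<Rightarrow> nat" where i: "inj_on i (insert c W)"
    using finite_imp_inj_to_nat_seg by metis
  have iW: "inj_on i W" using i by (rule inj_on_subset) blast
  define F where "F = (\<lambda>a b. \<exists>x\<in>W. \<exists>y\<in>W. a = i x \<and> b = i y \<and> G x y)"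
  have F: "sgraph F" unfolding F_def by (rule sgraph_pullback[OF assms(1) iW])
  have isoW: "graph_iso i G W F (i ` W)"
    unfolding graph_iso_def F_def using iW inj_onD[OF iW] by (auto simp: bij_betw_def)
  have "i ` (W - {c}) = i ` W - {i c}" using inj_on_image_set_diff[OF i, of W "{c}"] by auto
  then have "graph_iso (i \<circ> h) E V F (i ` W - {i c})"
    using graph_iso_trans[OF assms(3) graph_iso_subset[OF isoW, of "W - {c}"]] by simp
  moreover have "i c \<in> i ` W \<longrightarrow> b" using assms(4) inj_onD[OF i, of c] by auto
  ultimately show ?thesis
    unfolding sphere_or_ball_def using F graph_iso_sph[OF assms(2) isoW] by blast
qed

lemma sphere_or_ball_sph: assumes "sgraph E" "sph E k V" shows "sphere_or_ball b E k V"
proof -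
  have fin: "finite V" using sph_finite[OF assms(2)] .
  obtain i :: "_ \<Rightarrow> nat" where i: "inj_on i V" using finite_imp_inj_to_nat_seg[OF fin] by metis
  obtain c where c: "c \<notin> i ` V" using ex_new_if_finite[of "i ` V"] fin by auto
  define F where "F = (\<lambda>a b. \<exists>x\<in>V. \<exists>y\<in>V. a = i x \<and> b = i y \<and> E x y)"
  have F: "sgraph F" unfolding F_def by (rule sgraph_pullback[OF assms(1) i])
  have isoW: "graph_iso i E V F (i ` V)"
    unfolding graph_iso_def F_def using i inj_onD[OF i] by (auto simp: bij_betw_def)
  then show ?thesis using F graph_iso_sph[OF assms(2) isoW] c unfolding sphere_or_ball_def by (metis Diff_empty Diff_insert0)
qed

lemma sphere_or_ball_False: "sphere_or_ball False E k V \<Longrightarrow> sph E k V"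
  unfolding sphere_or_ball_def using graph_iso_sph[OF _ graph_iso_inv] by (metis Diff_empty Diff_insert0)

lemma sphere_or_ball_nbrs:
  assumes "sphere_or_ball b E (Suc k) V" "w \<in> V" shows "sphere_or_ball b E k (nbrs E V w)"
proof -
  obtain F :: "nat \<Rightarrow> nat \<Rightarrow> bool" and H v h where
    H: "sgraph F" "sph F (Suc k) H" "graph_iso h E V F (H - {v})" "v \<in> H \<longrightarrow> b"
    using assms(1) unfolding sphere_or_ball_def by blast
  have hw: "h w \<in> H" using H(3) assms(2) unfolding graph_iso_def by (auto dest: bij_betwE)
  have "nbrs F (H - {v}) (h w) = nbrs F H (h w) - {v}" by (auto simp: nbrs_def)
  then have "graph_iso h E (nbrs E V w) F (nbrs F H (h w) - {v})"
    using graph_iso_nbrs[OF H(3) assms(2)] by simp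
  moreover have "sph F k (nbrs F H (h w))" using H(2) hw by simp
  moreover have "v \<in> nbrs F H (h w) \<longrightarrow> b" using H(4) by (auto simp: nbrs_def)
  ultimately show ?thesis unfolding sphere_or_ball_def using H(1) by blast
qed

lemma sph_Suc_two: "sph E (Suc k) H \<Longrightarrow> H - {v} \<noteq> {}"
proof -
  assume "sph E (Suc k) H"
  then obtain w where w: "w \<in> H" "contractible E (H - {w})" by auto
  then obtain a where "a \<in> H" "a \<noteq> w" using contr_nonempty[OF w(2)] by blast
  then show ?thesis using w(1) by blast
qed

lemma sphere_or_ball_nonempty:
  assumes "sphere_or_ball b E (Suc k) V" shows "V \<noteq> {}"
proof
  assume "V = {}"
  moreover obtain F :: "nat \<Rightarrow> nat \<Rightarrow> bool" and H v h where
    H: "sph F (Suc k) H" "graph_iso h E V F (H - {v})" using assms unfolding sphere_or_ball_def by blast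
  ultimately have "H - {v} = {}" unfolding graph_iso_def bij_betw_def by blast
  then show False using sph_Suc_two[OF H(1)] by blast
qed

lemma sphere_or_ball_0: "sphere_or_ball b E 0 V \<Longrightarrow> V = {}"
  by (auto simp: sphere_or_ball_def graph_iso_def bij_betw_def)

lemma sphere_or_ball_1:
  assumes "sphere_or_ball b E 1 V" shows "\<exists>c d. V = {c, d}"
proof -
  obtain F :: "nat \<Rightarrow> nat \<Rightarrow> bool" and H v h where
    H: "sgraph F" "sph F 1 H" "graph_iso h E V F (H - {v})" using assms unfolding sphere_or_ball_def by blast
  interpret F: sgraph F by fact
  obtain p q where pq: "H = {p, q}" using F.sph_1[OF H(2)] by blast
  have bij: "bij_betw h V (H - {v})" using H(3) unfolding graph_iso_def by blast
  have "V \<noteq> {}" using sphere_or_ball_nonempty[of b E 0 V] assms by simp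
  moreover have "card V \<le> 2" "finite V"
    using bij_betw_same_card[OF bij] bij_betw_finite[OF bij] pq
      card_mono[of "{p, q}" "H - {v}"] card_insert_le_m1[of 2 "{q}" p] by auto
  ultimately have "card V = 1 \<or> card V = 2" using card_0_eq[of V] by linarith
  then show ?thesis using card_1_singletonE[of V] card_2_iff[of V] by (metis insert_absorb2)
qed

lemma (in sgraph) sphere_or_ball_clique:
  "sphere_or_ball b E m V \<Longrightarrow> clique E V x \<Longrightarrow> card x \<le> m \<and> sphere_or_ball b E (m - card x) (link E V x)"
  by (rule clique_descent) (simp_all add: sphere_or_ball_nbrs sphere_or_ball_0)

lemma (in sgraph) manifold_clique:
  assumes "manifold_on b E m V" "clique E V x"
  shows "card x \<le> m \<and> sphere_or_ball b E (m - card x) (link E V x)"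
proof -
  obtain m' where m: "m = Suc m'" using assms(1) unfolding manifold_on_def by (metis gr0_implies_Suc)
  obtain a where a: "a \<in> x" using cliqueD(2)[OF assms(2)] by blast
  have "a \<in> V" using a cliqueD(1)[OF assms(2)] by blast
  then have S: "sphere_or_ball b E m' (nbrs E V a)" using assms(1) m unfolding manifold_on_def by simp
  show ?thesis
  proof (cases "x = {a}")
    case True then show ?thesis using S m by (simp add: link_singleton)
  next
    case False
    note peel = clique_peel[OF assms(2) a False]
    show ?thesis using sphere_or_ball_clique[OF S peel(1)] peel(2,3) m by simp
  qed
qed

fun join_adj :: "('a \<Rightarrow> 'a \<Rightarrow> bool) \<Rightarrow> ('b \<Rightarrow> 'b \<Rightarrow> bool) \<Rightarrow> 'a + 'b \<Rightarrow> 'a + 'b \<Rightarrow> bool" where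
  "join_adj E F (Inl a) (Inl b) = E a b" | "join_adj E F (Inr a) (Inr b) = F a b"
| "join_adj E F (Inl _) (Inr _) = True" | "join_adj E F (Inr _) (Inl _) = True"

lemma sgraph_join_adj: assumes "sgraph E" "sgraph F" shows "sgraph (join_adj E F)"
proof
  interpret E: sgraph E by fact
  interpret F: sgraph F by fact
  show "join_adj E F y x" if "join_adj E F x y" for x y
    using that E.sym F.sym by (cases x; cases y) auto
  show "\<not> join_adj E F x x" for x using E.irr F.irr by (cases x) auto
qed

text \<open>
  If the sphere \<open>H\<close> minus a vertex gives the second factor, then the join of the first factor with
  \<open>H\<close>, minus the same vertex, gives the join.
\<close>
lemma sphere_or_ball_join:
  assumes "sgraph E" "sph E i A" "sphere_or_ball b E j B" "A \<inter> B = {}" "\<And>a c. a \<in> A \<Longrightarrow> c \<in> B \<Longrightarrow> E a c"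
  shows "sphere_or_ball b E (i + j) (A \<union> B)"
proof -
  interpret E: sgraph E by fact
  obtain F :: "nat \<Rightarrow> nat \<Rightarrow> bool" and H v h where
    H: "sgraph F" "sph F j H" "graph_iso h E B F (H - {v})" "v \<in> H \<longrightarrow> b"
    using assms(3) unfolding sphere_or_ball_def by blast
  interpret J: sgraph "join_adj E F" using sgraph_join_adj[OF assms(1) H(1)] .
  have "graph_iso Inl E A (join_adj E F) (Inl ` A)" "graph_iso Inr F H (join_adj E F) (Inr ` H)"
    by (auto simp: graph_iso_def bij_betw_def)
  then have "sph (join_adj E F) (i + j) (Inl ` A \<union> Inr ` H)"
    using graph_iso_sph[OF assms(2)] graph_iso_sph[OF H(2)] by (intro J.sph_join) auto
  moreover have "graph_iso (\<lambda>x. if x \<in> A then Inl x else Inr (h x)) E (A \<union> B) (join_adj E F)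
    (Inl ` A \<union> Inr ` H - {Inr v})"
  proof -
    let ?g = "\<lambda>x. if x \<in> A then Inl x else Inr (h x)"
    have B: "x \<in> B \<Longrightarrow> x \<notin> A" for x using assms(4) by blast
    have inj: "inj_on h B" and im: "h ` B = H - {v}" and ad: "\<And>x y. x \<in> B \<Longrightarrow> y \<in> B \<Longrightarrow> F (h x) (h y) \<longleftrightarrow> E x y"
      using H(3) unfolding graph_iso_def bij_betw_def by blast+
    have g1: "inj_on ?g (A \<union> B)" using inj by (auto simp: inj_on_def B)
    have "?g ` (A \<union> B) = Inl ` A \<union> Inr ` (h ` B)" using B by (auto simp: image_iff)
    then have g2: "?g ` (A \<union> B) = Inl ` A \<union> Inr ` H - {Inr v}" unfolding im by auto
    have g3: "join_adj E F (?g x) (?g y) \<longleftrightarrow> E x y" if "x \<in> A \<union> B" "y \<in> A \<union> B" for x y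
    proof (cases "x \<in> A"; cases "y \<in> A")
      assume "x \<in> A" "y \<notin> A"
      then show ?thesis using that assms(5)[of x y] by simp
    next
      assume "x \<notin> A" "y \<in> A"
      then show ?thesis using that E.sym[OF assms(5)[of y x]] by simp
    next
      assume "x \<notin> A" "y \<notin> A"
      then show ?thesis using that ad[of x y] by simp
    qed simp
    show ?thesis unfolding graph_iso_def bij_betw_def by (intro conjI ballI g1 g2 g3)
  qed
  moreover have "Inr v \<in> Inl ` A \<union> Inr ` H \<longrightarrow> b" using H(4) by auto
  ultimately show ?thesis by (rule sphere_or_ballI[OF J.sgraph_axioms])
qed

lemma canonical_model: "model (cell_adj E V n v) {x. cell E V n v x} (\<lambda>x. x) E V n v"
proof -
  have "\<not> cell_adj E V n v x y" if b: "bare E V n v x" "bare E V n v y" for x y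
  proof -
    have c: "card x = card y" "card x \<noteq> n" using bareD(3)[OF b(1)] bareD(3)[OF b(2)] by simp_all
    have "x \<noteq> {v}" "y \<noteq> {v}" using bareD(1)[OF b(1)] bareD(1)[OF b(2)] by blast+
    moreover have "\<not> x \<subset> y" "\<not> y \<subset> x"
      using psubset_card_mono[OF cliqueD(3)[OF bareD(2)[OF b(2)]], of x]
        psubset_card_mono[OF cliqueD(3)[OF bareD(2)[OF b(1)]], of y] c(1) by linarith+
    ultimately show ?thesis unfolding cell_adj_def using c(2) by blast
  qed
  then show ?thesis unfolding model_def by (simp add: bij_betw_def)
qed

lemma sgraph_cell_adj: "sgraph (cell_adj E V n v)"
proof
  show "cell_adj E V n v y x" if "cell_adj E V n v x y" for x y
    using that cell_adj_sym[of E V n v x y] by blast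
  show "\<not> cell_adj E V n v x x" for x by (auto simp: cell_adj_def)
qed

text \<open>
  If a simplex of size \<open>m - 1\<close> lies in one or two facets, then it is a boundary face iff its link
  is a single vertex.
\<close>
definition soft_cells :: "('a \<Rightarrow> 'a \<Rightarrow> bool) \<Rightarrow> nat \<Rightarrow> 'a set \<Rightarrow> 'a set set" where
  "soft_cells E m V = {x. clique E V x \<and> (card x + 2 \<le> m \<or> card x = m \<or> card x + 1 = m \<and> card (link E V x) = 1)}"

definition soft_adj :: "nat \<Rightarrow> 'a set \<Rightarrow> 'a set \<Rightarrow> bool" where
  "soft_adj m x y \<longleftrightarrow> x \<subset> y \<or> y \<subset> x \<or> (card x = m \<and> card y = m \<and> x \<inter> y \<noteq> {} \<and> card (x \<inter> y) + 1 = m)"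

lemma sgraph_soft_adj: "sgraph (soft_adj m)"
proof
  show "soft_adj m y x" if "soft_adj m x y" for x y
    using that unfolding soft_adj_def by (simp only: Int_commute[of y x]) blast
  show "\<not> soft_adj m x x" for x by (auto simp: soft_adj_def)
qed

lemma graph_iso_clique:
  assumes "graph_iso h E U F W" "x \<subseteq> U" "finite x"
  shows "clique F W (h ` x) \<longleftrightarrow> clique E U x"
proof -
  have inj: "inj_on h U" and im: "h ` U = W" and ad: "\<And>a b. a \<in> U \<Longrightarrow> b \<in> U \<Longrightarrow> F (h a) (h b) \<longleftrightarrow> E a b"
    using assms(1) unfolding graph_iso_def bij_betw_def by blast+
  have "F (h a) (h b) \<longleftrightarrow> E a b" "h a = h b \<longleftrightarrow> a = b" if "a \<in> x" "b \<in> x" for a b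
    using that ad[of a b] inj_onD[OF inj, of a b] assms(2) by blast+
  moreover have "h ` x \<subseteq> W" using im assms(2) by blast
  ultimately show ?thesis using assms(2,3) unfolding clique_def by auto
qed

lemma graph_iso_link:
  assumes "graph_iso h E U F W" "x \<subseteq> U"
  shows "h ` link E U x = link F W (h ` x)"
proof -
  have inj: "inj_on h U" and im: "h ` U = W" and ad: "\<And>a b. a \<in> U \<Longrightarrow> b \<in> U \<Longrightarrow> F (h a) (h b) \<longleftrightarrow> E a b"
    using assms(1) unfolding graph_iso_def bij_betw_def by blast+
  have "w \<in> link E U x \<longleftrightarrow> h w \<in> link F W (h ` x)" if w: "w \<in> U" for w
  proof -
    have "h w \<in> h ` x \<longleftrightarrow> w \<in> x" using inj_on_image_mem_iff[OF inj w assms(2)] .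
    moreover have "F (h a) (h w) \<longleftrightarrow> E a w" if "a \<in> x" for a using ad[of a w] that w assms(2) by blast
    moreover have "h w \<in> W" using im w by blast
    ultimately show ?thesis using w unfolding link_def by auto
  qed
  moreover have "link E U x \<subseteq> U" "link F W (h ` x) \<subseteq> h ` U" using im unfolding link_def by auto
  ultimately show ?thesis by blast
qed

text \<open>
  If the link of \<open>x\<close> is \<open>H - {v}\<close>, then the cells above \<open>x\<close> are the cells of \<open>H\<close> with mark
  \<open>v\<close>, except for \<open>{v}\<close> itself.  The cells of size \<open>m - 1\<close> match because the link in \<open>H\<close> of a
  simplex of codimension one has two vertices: if \<open>v\<close> is one of them, then the simplex is a
  boundary face of \<open>H - {v}\<close>, and otherwise it is an interior face.
\<close>
lemma (in sgraph) upper_iso: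
  assumes x: "clique E V x" and xS: "x \<in> soft_cells E m V" and cx: "card x < m"
    and H: "sgraph F" "sph F (m - card x) H" "graph_iso h E (link E V x) F (H - {v})"
  shows "graph_iso (\<lambda>y. h ` (y - x)) (soft_adj m) {y \<in> soft_cells E m V. x \<subset> y}
     (cell_adj F H (m - card x) v) ({z. cell F H (m - card x) v z} - {{v}})"
proof -
  interpret F: sgraph F by fact
  define k where "k = m - card x"
  define L where "L = link E V x"
  have finx: "finite x" and xne: "x \<noteq> {}" using cliqueD(2,3)[OF x] by blast+
  have mk: "m = card x + k" "k > 0" using cx unfolding k_def by linarith+
  have iso: "graph_iso h E L F (H - {v})" using H(3) unfolding L_def .
  have injh: "inj_on h L" and imh: "h ` L = H - {v}"
    using iso unfolding graph_iso_def bij_betw_def by blast+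
  have finL: "finite L"
    using bij_betw_finite[of h L "H - {v}"] sph_finite[OF H(2)] injh imh unfolding bij_betw_def by simp
  have KL: "clique E L z \<longleftrightarrow> z \<noteq> {} \<and> z \<inter> x = {} \<and> clique E V (x \<union> z)" for z
    unfolding L_def by (rule clique_link[OF x])
  have nobare: "\<not> bare F H k v z" for z
  proof
    assume b: "bare F H k v z"
    have z: "clique F H z" "card z + 1 = k" using bareD[OF b] by blast+
    then have "sph F 1 (link F H z)" using F.sph_clique[OF H(2) z(1)] k_def by (metis add_diff_cancel_left')
    then obtain w where w: "w \<in> link F H z" using F.sph_1 by blast
    then have "w \<in> H" "w \<notin> z" unfolding link_def by blast+
    then show False using bareD(4)[OF b, of w] F.clique_insert_link[OF z(1), of w] w by blast
  qed
  have clique_iso: "clique F H (h ` z) \<and> v \<notin> h ` z \<and> card (h ` z) = card z" if z: "clique E L z" for z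
  proof -
    have zL: "z \<subseteq> L" "finite z" using cliqueD(1,3)[OF z] .
    have "clique F (H - {v}) (h ` z)" using graph_iso_clique[OF iso zL] z by blast
    then show ?thesis using clique_delete card_image[OF inj_on_subset[OF injh zL(1)]] by metis
  qed
  have cell_iff: "cell F H k v (h ` z) \<longleftrightarrow> x \<union> z \<in> soft_cells E m V" if z: "clique E L z" for z
  proof -
    have z': "z \<noteq> {}" "z \<inter> x = {}" "clique E V (x \<union> z)" using z KL by blast+
    have finz: "finite z" using cliqueD(3)[OF z] .
    have hz: "clique F H (h ` z)" "v \<notin> h ` z" "card (h ` z) = card z" using clique_iso[OF z] by blast+
    have c: "card (x \<union> z) = card x + card z" using z'(2) finx finz by (intro card_Un_disjoint) auto
    have nv: "h ` z \<noteq> {v}" using hz(2) by blast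
    have lkeq: "link E V (x \<union> z) = link E L z" unfolding L_def link_def by auto
    have "link E L z \<subseteq> L" by (rule link_subset)
    then have "card (link E L z) = card (h ` link E L z)" using card_image[OF inj_on_subset[OF injh]] by metis
    also have "h ` link E L z = link F (H - {v}) (h ` z)" using graph_iso_link[OF iso cliqueD(1)[OF z]] .
    also have "link F (H - {v}) (h ` z) = link F H (h ` z) - {v}" unfolding link_def by auto
    finally have cl: "card (link E V (x \<union> z)) = card (link F H (h ` z) - {v})" unfolding lkeq .
    \<comment> \<open>boundary face above \<open>x\<close> versus face opposite to \<open>v\<close>\<close>
    have bd: "card (link E V (x \<union> z)) = 1 \<longleftrightarrow> clique F H (insert v (h ` z))" if k: "card z + 1 = k"
    proof -
      have "k - card (h ` z) = 1" using k hz(3) by linarith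
      then have "sph F 1 (link F H (h ` z))" using F.sph_clique[OF H(2) hz(1)] unfolding k_def by simp
      then obtain p q where ab: "link F H (h ` z) = {p, q}" "p \<noteq> q" using F.sph_1 by blast
      have "card ({p, q} - {v}) = 1 \<longleftrightarrow> v \<in> {p, q}" using ab(2)
        by (cases "v = p"; cases "v = q") (auto simp: insert_Diff_if)
      then show ?thesis unfolding cl ab(1) F.clique_insert_link[OF hz(1,2)] .
    qed
    have e: "card z + 2 \<le> k \<longleftrightarrow> card (x \<union> z) + 2 \<le> m" "card z = k \<longleftrightarrow> card (x \<union> z) = m"
      "card z + 1 = k \<longleftrightarrow> card (x \<union> z) + 1 = m" unfolding c mk(1) by auto
    show ?thesis unfolding cell_def soft_cells_def hz(3) using nobare hz(1,2) nv z'(3) bd e by auto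
  qed
  let ?U = "{y \<in> soft_cells E m V. x \<subset> y}"
  have U: "clique E L (y - x) \<and> x \<union> (y - x) = y" if y: "y \<in> ?U" for y
  proof -
    have "clique E V y" "x \<subset> y" using y unfolding soft_cells_def by blast+
    moreover from this have "x \<union> (y - x) = y" by blast
    ultimately show ?thesis unfolding KL by auto
  qed
  have im: "(\<lambda>y. h ` (y - x)) ` ?U = {z. cell F H k v z} - {{v}}"
  proof (intro equalityI subsetI)
    fix z assume "z \<in> (\<lambda>y. h ` (y - x)) ` ?U"
    then obtain y where y: "y \<in> ?U" "z = h ` (y - x)" by blast
    have K: "clique E L (y - x)" and e: "x \<union> (y - x) = y" using U[OF y(1)] by blast+
    have "cell F H k v z" using cell_iff[OF K] y unfolding e by simp
    moreover have "z \<noteq> {v}" using clique_iso[OF K] y(2) by auto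
    ultimately show "z \<in> {z. cell F H k v z} - {{v}}" by simp
  next
    fix z assume "z \<in> {z. cell F H k v z} - {{v}}"
    then have cz: "cell F H k v z" and nz: "z \<noteq> {v}" by simp_all
    then have vz: "v \<notin> z" and Kz: "clique F H z" using nobare unfolding cell_def by blast+
    define w where "w = {a \<in> L. h a \<in> z}"
    have hw: "h ` w = z"
    proof -
      have "z \<subseteq> h ` L" using cliqueD(1)[OF Kz] vz imh by blast
      then show ?thesis unfolding w_def by blast
    qed
    have wL: "w \<subseteq> L" "finite w" using finL unfolding w_def by auto
    have "clique F (H - {v}) (h ` w)" using Kz vz clique_delete hw by metis
    then have Kw: "clique E L w" using graph_iso_clique[OF iso wL] by blast
    have d: "w \<noteq> {}" "w \<inter> x = {}" using Kw KL by blast+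
    have "x \<union> w \<in> soft_cells E m V" using cell_iff[OF Kw] cz unfolding hw by blast
    moreover have "x \<subset> x \<union> w" "x \<union> w - x = w" using d by blast+
    ultimately show "z \<in> (\<lambda>y. h ` (y - x)) ` ?U" using hw by (intro image_eqI[of _ _ "x \<union> w"]) auto
  qed
  have inj: "y = y'" if y: "y \<in> ?U" "y' \<in> ?U" "h ` (y - x) = h ` (y' - x)" for y y'
  proof -
    have "y - x \<subseteq> L" "y' - x \<subseteq> L" using cliqueD(1) U y(1,2) by metis+
    then have "y - x = y' - x" using inj_on_image_eq_iff[OF injh] y(3) by blast
    then show ?thesis using U y(1,2) by metis
  qed
  have ad: "cell_adj F H k v (h ` (y - x)) (h ` (y' - x)) \<longleftrightarrow> soft_adj m y y'"
    if y: "y \<in> ?U" "y' \<in> ?U" for y y'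
  proof -
    define z z' where "z = y - x" and "z' = y' - x"
    have K: "clique E L z" "clique E L z'" and e: "y = x \<union> z" "y' = x \<union> z'"
      using U[OF y(1)] U[OF y(2)] unfolding z_def z'_def by auto
    have sub: "z \<subseteq> L" "z' \<subseteq> L" using cliqueD(1) K by blast+
    have fin: "finite z" "finite z'" using cliqueD(3) K by blast+
    have dz: "z \<inter> x = {}" "z' \<inter> x = {}" using K KL by blast+
    have hz: "v \<notin> h ` z" "card (h ` z) = card z" "v \<notin> h ` z'" "card (h ` z') = card z'"
      using clique_iso K by blast+
    have nv: "h ` z \<noteq> {v}" "h ` z' \<noteq> {v}" using hz by blast+
    have "h ` z \<inter> h ` z' = h ` (z \<inter> z')" using inj_on_image_Int[OF injh sub] by simp
    moreover have "card (h ` (z \<inter> z')) = card (z \<inter> z')"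
      using card_image inj_on_subset[OF injh] sub by (metis inf.coboundedI1)
    ultimately have hi: "card (h ` z \<inter> h ` z') = card (z \<inter> z')" "h ` z \<inter> h ` z' = {} \<longleftrightarrow> z \<inter> z' = {}" by auto
    have le: "h ` a \<subset> h ` b \<longleftrightarrow> a \<subset> b" if "a \<subseteq> L" "b \<subseteq> L" for a b
    proof -
      have "h ` a \<subseteq> h ` b \<longleftrightarrow> a \<subseteq> b"
        using inj_on_image_mem_iff[OF injh _ that(2)] that(1) by blast
      then show ?thesis using inj_on_image_eq_iff[OF injh that] by blast
    qed
    have c: "card y = card x + card z" "card y' = card x + card z'"
      unfolding e using dz finx fin by (auto intro: card_Un_disjoint)
    have i: "y \<inter> y' = x \<union> (z \<inter> z')" unfolding e by blast
    have ci: "card (y \<inter> y') = card x + card (z \<inter> z')"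
      unfolding i using dz finx fin by (intro card_Un_disjoint) auto
    have s: "y \<subset> y' \<longleftrightarrow> z \<subset> z'" "y' \<subset> y \<longleftrightarrow> z' \<subset> z" unfolding e using dz by blast+
    \<comment> \<open>for \<open>k = 1\<close> the cell \<open>x\<close> is itself a boundary face, and only one facet lies above it\<close>
    have meet: "z \<inter> z' \<noteq> {}" if t: "card y = m" "card y' = m" "card (y \<inter> y') + 1 = m"
    proof
      assume em: "z \<inter> z' = {}"
      then have cx1: "card x + 1 = m" using t ci by simp
      then have "card L = 1" using xS unfolding soft_cells_def L_def by simp
      then obtain p where p: "L = {p}" by (rule card_1_singletonE)
      have "z = {p}" "z' = {p}" using sub p cliqueD(2)[OF K(1)] cliqueD(2)[OF K(2)] by blast+
      then show False using em by blast
    qed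
    have ine: "y \<inter> y' \<noteq> {}" unfolding i using xne by blast
    have top: "(card z = k \<and> card z' = k \<and> z \<inter> z' \<noteq> {} \<and> card (z \<inter> z') + 1 = k) \<longleftrightarrow>
      (card y = m \<and> card y' = m \<and> y \<inter> y' \<noteq> {} \<and> card (y \<inter> y') + 1 = m)"
      using meet ine unfolding c ci mk(1) by auto
    show ?thesis unfolding z_def[symmetric] z'_def[symmetric] cell_adj_def soft_adj_def le[OF sub] le[OF sub(2,1)] s
        hz(2,4) hi(1) hi(2) using nv top by (simp only: simp_thms)
  qed
  show ?thesis unfolding graph_iso_def bij_betw_def k_def[symmetric]
    by (intro conjI ballI inj_onI im ad) (rule inj)
qed

lemma (in sgraph) manifold_facet:
  assumes "manifold_on b E m V" "clique E V x" shows "\<exists>y. clique E V y \<and> card y = m"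
  using assms(2)
proof (induction "m - card x" arbitrary: x rule: less_induct)
  case less
  show ?case
  proof (cases "card x = m")
    case True then show ?thesis using less.prems by blast
  next
    case False
    then obtain j where j: "m - card x = Suc j" using manifold_clique[OF assms(1) less.prems] by (metis diff_is_0_eq le_antisym not0_implies_Suc)
    then obtain w where w: "w \<in> link E V x" using manifold_clique[OF assms(1) less.prems] sphere_or_ball_nonempty by (metis all_not_in_conv)
    have wx: "w \<notin> x" using w unfolding link_def by blast
    have K: "clique E V (insert w x)" using clique_insert_link[OF less.prems wx] w by blast
    have "card (insert w x) = Suc (card x)" using wx cliqueD(3)[OF less.prems] by simp
    then have "m - card (insert w x) < m - card x" using j by linarith
    then show ?thesis using less.hyps[OF _ K] by blast
  qed
qed

lemma graph_iso_manifold: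
  assumes "manifold_on b E m V" "graph_iso h E V F W" shows "manifold_on b F m W"
proof -
  have bij: "bij_betw h V W" using assms(2) unfolding graph_iso_def by blast
  have sphere_or_ball: "sphere_or_ball b F k (h ` U)" if U: "sphere_or_ball b E k U" "U \<subseteq> V" for k U
  proof -
    obtain G :: "nat \<Rightarrow> nat \<Rightarrow> bool" and H v g where
      H: "sgraph G" "sph G k H" "graph_iso g E U G (H - {v})" "v \<in> H \<longrightarrow> b"
      using U(1) unfolding sphere_or_ball_def by blast
    show ?thesis
      using graph_iso_trans[OF graph_iso_inv[OF graph_iso_subset[OF assms(2) U(2)]] H(3)] H(1,2,4)
      unfolding sphere_or_ball_def by blast
  qed
  have "sphere_or_ball b F (m - 1) (nbrs F W w)" if w: "w \<in> W" for w
  proof -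
    obtain v where v: "v \<in> V" "w = h v" using w bij unfolding bij_betw_def by blast
    have "h ` nbrs E V v = nbrs F W w"
      using graph_iso_nbrs[OF assms(2) v(1)] v(2) unfolding graph_iso_def bij_betw_def by blast
    then show ?thesis using sphere_or_ball[OF _ nbrs_subset] assms(1) v(1) unfolding manifold_on_def by metis
  qed
  moreover have "finite W" "W \<noteq> {}" using bij bij_betw_finite[OF bij] assms(1) unfolding manifold_on_def bij_betw_def by auto
  ultimately show ?thesis using assms(1) unfolding manifold_on_def by blast
qed

lemma (in sgraph) soft_manifold:
  assumes M: "manifold_on b E m V"
  shows "manifold_on b (soft_adj m) m (soft_cells E m V)"
proof -
  let ?S = "soft_cells E m V" and ?F = "soft_adj m"
  interpret F: sgraph ?F by (rule sgraph_soft_adj)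
  have m0: "m > 0" and finV: "finite V" and neV: "V \<noteq> {}" using M unfolding manifold_on_def by blast+
  note link = manifold_clique[OF M]
  have SK: "clique E V x" if "x \<in> ?S" for x using that unfolding soft_cells_def by blast
  have finS: "finite ?S" using finV by (rule finite_subset[rotated, OF finite_Pow_iff[THEN iffD2]])
    (use SK cliqueD(1) in blast)
  have "?S \<noteq> {}"
  proof -
    obtain w where "w \<in> V" using neV by blast
    then have "clique E V {w}" by (simp add: clique_def)
    then show ?thesis using manifold_facet[OF M] unfolding soft_cells_def by blast
  qed
  moreover have "sphere_or_ball b ?F (m - 1) (nbrs ?F ?S x)" if x: "x \<in> ?S" for x
  proof -
    have Kx: "clique E V x" using SK[OF x] .
    have finx: "finite x" and xne: "x \<noteq> {}" using cliqueD(2,3)[OF Kx] by blast+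
    have cx0: "card x > 0" using finx xne by (simp add: card_gt_0_iff)
    show ?thesis
    proof (cases "card x = m")
      case True
      have no_bigger: "\<not> x \<subset> y" if "clique E V y" for y
        using psubset_card_mono[OF cliqueD(3)[OF that], of x] link[OF that] True by linarith
      have "graph_iso (\<lambda>t. t \<inter> x) ?F (nbrs ?F ?S x) comparable {y. y \<noteq> {} \<and> y \<subset> x}"
      proof (rule facet_iso[OF Kx True])
        show "card y \<le> m" if "clique E V y" for y using link[OF that] by blast
        show "clique E V t" if "t \<in> nbrs ?F ?S x" for t using SK that by (simp add: nbrs_def)
        show "t \<subset> x \<or> card t = m \<and> t \<inter> x \<noteq> {} \<and> card (t \<inter> x) + 1 = m" if t: "t \<in> nbrs ?F ?S x" for t
        proof -
          have "t \<in> ?S" "?F x t" using t by (auto simp: nbrs_def)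
          then show ?thesis using no_bigger[OF SK] unfolding soft_adj_def by (simp only: Int_commute[of t x]) blast
        qed
        show "\<exists>t\<in>nbrs ?F ?S x. t = y" if y: "y \<noteq> {}" "y \<subseteq> x" "card y + 2 \<le> m" for y
        proof -
          have "clique E V y" using clique_subset[OF Kx y(2,1)] .
          moreover have "y \<noteq> x" using y(3) True by auto
          ultimately show ?thesis using y unfolding nbrs_def soft_cells_def soft_adj_def by blast
        qed
        show "?F s t \<longleftrightarrow> s \<subset> t \<or> t \<subset> s \<or> (card s = m \<and> card t = m \<and> s \<inter> t \<noteq> {} \<and> card (s \<inter> t) + 1 = m)" for s t
          by (rule soft_adj_def)
        show "\<exists>!t. t \<in> nbrs ?F ?S x \<and> t \<inter> x = f" if f: "f \<noteq> {}" "f \<subseteq> x" "card f + 1 = m" for f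
        proof -
          have Kf: "clique E V f" using clique_subset[OF Kx f(2,1)] .
          have finf: "finite f" using cliqueD(3)[OF Kf] .
          have fx: "f \<subset> x" using f True by auto
          have "card (x - f) = 1" using f True finf by (simp add: card_Diff_subset)
          then obtain w where "x - f = {w}" by (rule card_1_singletonE)
          then have w: "w \<notin> f" "x = insert w f" using f(2) by blast+
          have wl: "w \<in> link E V f" using clique_insert_link[OF Kf w(1)] Kx w(2) by simp
          have "m - card f = 1" using f(3) by linarith
          then obtain c d where cd: "link E V f = {c, d}" using link[OF Kf] sphere_or_ball_1 by metis
          then obtain w' where w': "link E V f = {w, w'}" using wl by (metis insert_commute insertE singletonD)
          have facet: "t = insert w' f \<and> w' \<noteq> w" if t: "t \<in> nbrs ?F ?S x" "t \<inter> x = f" "\<not> t \<subset> x" for t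
          proof -
            have ts: "t \<in> ?S" "?F x t" using t by (auto simp: nbrs_def)
            then have ct: "card t = m" using no_bigger[OF SK[OF ts(1)]] t(3) unfolding soft_adj_def by blast
            then show ?thesis
              using facet_across[OF Kf w' SK[OF ts(1)]] f(3) t(2) w(2) by simp
          qed
          show ?thesis
          proof (cases "w' = w")
            case True
            then have "card (link E V f) = 1" using w' by simp
            then have "f \<in> ?S" using Kf f(3) unfolding soft_cells_def by blast
            then have "f \<in> nbrs ?F ?S x \<and> f \<inter> x = f"
              using fx unfolding nbrs_def soft_adj_def by blast
            moreover have "t = f" if "t \<in> nbrs ?F ?S x \<and> t \<inter> x = f" for t
              using facet[of t] that True by blast
            ultimately show ?thesis by blast
          next
            case False
            have w'f: "w' \<notin> f" using w' unfolding link_def by blast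
            have Ky: "clique E V (insert w' f)" using clique_insert_link[OF Kf w'f] w' by blast
            have cy: "card (insert w' f) = m" using w'f finf f(3) by simp
            have yx: "insert w' f \<inter> x = f" using w False w'f by blast
            have "insert w' f \<in> ?S" using Ky cy unfolding soft_cells_def by blast
            moreover have "?F x (insert w' f)"
              using yx cy True f unfolding soft_adj_def by (simp add: Int_commute)
            ultimately have y: "insert w' f \<in> nbrs ?F ?S x \<and> insert w' f \<inter> x = f"
              using yx by (simp add: nbrs_def)
            have un: "t = insert w' f" if t: "t \<in> nbrs ?F ?S x \<and> t \<inter> x = f" for t
            proof -
              have "\<not> t \<subset> x"
              proof
                assume "t \<subset> x"
                then have "t = f" using t by blast
                then have "card (link E V f) = 1" using t f(3) unfolding nbrs_def soft_cells_def by auto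
                then show False using w' False by simp
              qed
              then show ?thesis using facet[of t] t by blast
            qed
            show ?thesis by (rule ex1I[of "\<lambda>t. t \<in> nbrs ?F ?S x \<and> t \<inter> x = f", OF y un])
          qed
        qed
      qed
      then have "sph ?F (m - 1) (nbrs ?F ?S x)" using sph_boundary finx xne True by blast
      then show ?thesis by (rule sphere_or_ball_sph[OF F.sgraph_axioms])
    next
      case False
      then have cx: "card x < m" using link[OF Kx] by linarith
      obtain G :: "nat \<Rightarrow> nat \<Rightarrow> bool" and H v h where
        H: "sgraph G" "sph G (m - card x) H" "graph_iso h E (link E V x) G (H - {v})" "v \<in> H \<longrightarrow> b"
        using link[OF Kx] unfolding sphere_or_ball_def by blast
      let ?U = "{y \<in> ?S. x \<subset> y}" and ?D = "{y. y \<noteq> {} \<and> y \<subset> x}"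
      have "sph (cell_adj G H (m - card x) v) (m - card x) {z. cell G H (m - card x) v z}"
        by (rule sph_refinement[OF H(2,1) sgraph_cell_adj _ canonical_model]) simp
      moreover have "{v} \<in> {z. cell G H (m - card x) v z} \<longrightarrow> b"
        using H(4) unfolding cell_def bare_def clique_def by auto
      ultimately have U: "sphere_or_ball b ?F (m - card x) ?U"
        by (intro sphere_or_ballI[OF sgraph_cell_adj _ upper_iso[OF Kx x cx H(1-3)]])
      have DS: "y \<in> ?S" if "y \<in> ?D" for y
      proof -
        have y: "y \<noteq> {}" "y \<subset> x" using that by blast+
        have "clique E V y" using clique_subset[OF Kx _ y(1)] y(2) by blast
        moreover have "card y + 2 \<le> m" using psubset_card_mono[OF finx y(2)] cx by linarith
        ultimately show ?thesis unfolding soft_cells_def by blast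
      qed
      have "graph_iso (\<lambda>y. y) ?F ?D comparable ?D"
      proof -
        have "?F y z \<longleftrightarrow> comparable y z" if "y \<subset> x" for y z
          using psubset_card_mono[OF finx that] cx unfolding soft_adj_def comparable_def by auto
        then show ?thesis unfolding graph_iso_def by (auto simp: bij_betw_def)
      qed
      then have D: "sph ?F (card x - 1) ?D" using sph_boundary finx xne by blast
      have "sphere_or_ball b ?F (card x - 1 + (m - card x)) (?D \<union> ?U)"
        by (rule sphere_or_ball_join[OF F.sgraph_axioms D U]) (auto simp: soft_adj_def)
      moreover have "nbrs ?F ?S x = ?D \<union> ?U"
      proof -
        have Fx: "?F x y \<longleftrightarrow> y \<subset> x \<or> x \<subset> y" for y using False unfolding soft_adj_def by blast
        have ne: "y \<noteq> {}" if "y \<in> ?S" for y using cliqueD(2)[OF SK[OF that]] .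
        show ?thesis
        proof (intro set_eqI iffI)
          fix y assume "y \<in> nbrs ?F ?S x"
          then have "y \<in> ?S" "?F x y" by (simp_all add: nbrs_def)
          then show "y \<in> ?D \<union> ?U" using Fx[of y] ne[of y] by auto
        next
          fix y assume "y \<in> ?D \<union> ?U"
          then have "y \<in> ?S \<and> (y \<subset> x \<or> x \<subset> y)" using DS[of y] by blast
          then show "y \<in> nbrs ?F ?S x" using Fx[of y] by (simp add: nbrs_def)
        qed
      qed
      moreover have "card x - 1 + (m - card x) = m - 1" using cx cx0 by linarith
      ultimately show ?thesis by simp
    qed
  qed
  ultimately show ?thesis unfolding manifold_on_def using m0 finS by blast
qed

section \<open>Manifolds and soft refinements of digraphs\<close>
abbreviation adjacent :: "'a pair_pre_digraph \<Rightarrow> 'a \<Rightarrow> 'a \<Rightarrow> bool" where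
  "adjacent G x y \<equiv> (x, y) \<in> parcs G"

lemma sgraph_adjacent: assumes "pair_graph G" shows "sgraph (adjacent G)"
proof
  interpret pair_graph G by fact
  show "adjacent G y x" if "adjacent G x y" for x y using arcs_symmetric that .
  show "\<not> adjacent G x x" for x using no_loops' by blast
qed

lemma pair_graphI:
  assumes "finite V" "A \<subseteq> V \<times> V" "sgraph (\<lambda>x y. (x, y) \<in> A)"
  shows "pair_graph \<lparr> pverts = V, parcs = A \<rparr>"
proof -
  interpret sgraph "\<lambda>x y. (x, y) \<in> A" by fact
  have "finite A" using assms(1,2) finite_subset by blast
  then show ?thesis using assms(1,2) sym irr
    by unfold_locales (auto simp: symmetric_def intro: symI)
qed

lemma pair_graph_induced:
  assumes "pair_graph G" "S \<subseteq> pverts G" shows "pair_graph (induced G S)"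
proof -
  interpret pair_graph G by fact
  interpret sgraph "adjacent G" by (rule sgraph_adjacent[OF assms(1)])
  show ?thesis unfolding induced_def
  proof (rule pair_graphI)
    show "finite S" using assms(2) pair_finite_verts finite_subset by blast
  qed (auto simp: sgraph_def sym irr)
qed

lemma unit_sphere_graph:
  assumes "pair_graph G"
  shows "pverts (unit_sphere G v) = nbrs (adjacent G) (pverts G) v"
    and "pair_graph (unit_sphere G v)"
    and "\<And>x y. x \<in> pverts (unit_sphere G v) \<Longrightarrow> y \<in> pverts (unit_sphere G v) \<Longrightarrow>
      adjacent (unit_sphere G v) x y \<longleftrightarrow> adjacent G x y"
proof -
  interpret pair_graph G by fact
  have V: "{u. adjacent G v u} = nbrs (adjacent G) (pverts G) v"
    unfolding nbrs_def using in_arcsD2 by blast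
  show "pverts (unit_sphere G v) = nbrs (adjacent G) (pverts G) v"
    unfolding unit_sphere_def induced_def V by simp
  show "pair_graph (unit_sphere G v)"
    unfolding unit_sphere_def V by (rule pair_graph_induced[OF assms nbrs_subset])
  show "adjacent (unit_sphere G v) x y \<longleftrightarrow> adjacent G x y"
    if "x \<in> pverts (unit_sphere G v)" "y \<in> pverts (unit_sphere G v)" for x y
    using that unfolding unit_sphere_def induced_def by simp
qed

lemma delete_vertex_graph:
  assumes "pair_graph G"
  shows "pverts (delete_vertex G v) = pverts G - {v}"
    and "pair_graph (delete_vertex G v)"
    and "\<And>x y. x \<in> pverts (delete_vertex G v) \<Longrightarrow> y \<in> pverts (delete_vertex G v) \<Longrightarrow>
      adjacent (delete_vertex G v) x y \<longleftrightarrow> adjacent G x y"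
proof -
  interpret pair_graph G by fact
  have "delete_vertex G v = induced G (pverts G - {v})"
    unfolding delete_vertex_def induced_def using in_arcsD1 in_arcsD2 by auto
  then show "pair_graph (delete_vertex G v)" using pair_graph_induced[OF assms, of "pverts G - {v}"] by simp
qed (simp_all add: delete_vertex_def)

lemma graph_iso_id:
  assumes "\<And>x y. x \<in> V \<Longrightarrow> y \<in> V \<Longrightarrow> F x y \<longleftrightarrow> E x y" shows "graph_iso (\<lambda>x. x) E V F V"
  using assms by (simp add: graph_iso_def bij_betw_def)

lemma graph_iso_cong:
  assumes "graph_iso h E V F W" "\<And>x y. x \<in> W \<Longrightarrow> y \<in> W \<Longrightarrow> F' x y \<longleftrightarrow> F x y"
  shows "graph_iso h E V F' W"
proof -
  have "h x \<in> W" if "x \<in> V" for x using assms(1) that bij_betwE unfolding graph_iso_def by blast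
  then show ?thesis using assms unfolding graph_iso_def by simp
qed

lemma unit_sphere_iso:
  assumes "pair_graph G"
  shows "graph_iso (\<lambda>x. x) (adjacent (unit_sphere G v)) (pverts (unit_sphere G v))
    (adjacent G) (nbrs (adjacent G) (pverts G) v)"
  unfolding unit_sphere_graph(1)[OF assms, symmetric]
  by (rule graph_iso_id) (simp add: unit_sphere_graph(3)[OF assms])

lemma delete_vertex_iso:
  assumes "pair_graph G"
  shows "graph_iso (\<lambda>x. x) (adjacent (delete_vertex G v)) (pverts (delete_vertex G v))
    (adjacent G) (pverts G - {v})"
  unfolding delete_vertex_graph(1)[OF assms, symmetric]
  by (rule graph_iso_id) (simp add: delete_vertex_graph(3)[OF assms])

lemma graph_iso_unit_sphere:
  assumes "graph_iso h E V (adjacent G) (pverts G)" "pair_graph G" "v \<in> V"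
  shows "graph_iso h E (nbrs E V v) (adjacent (unit_sphere G (h v))) (pverts (unit_sphere G (h v)))"
  unfolding unit_sphere_graph(1)[OF assms(2)]
  by (rule graph_iso_cong[OF graph_iso_nbrs[OF assms(1,3)]])
    (rule unit_sphere_graph(3)[OF assms(2)]; simp add: unit_sphere_graph(1)[OF assms(2)])

lemma graph_iso_delete_vertex:
  assumes "graph_iso h E V (adjacent G) (pverts G)" "pair_graph G" "v \<in> V"
  shows "graph_iso h E (V - {v}) (adjacent (delete_vertex G (h v))) (pverts (delete_vertex G (h v)))"
  unfolding delete_vertex_graph(1)[OF assms(2)]
  by (rule graph_iso_cong[OF graph_iso_delete[OF assms(1,3)]])
    (rule delete_vertex_graph(3)[OF assms(2)]; simp add: delete_vertex_graph(1)[OF assms(2)])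

lemma contractible_graph_contr: "contractible_graph G \<Longrightarrow> contractible (adjacent G) (pverts G)"
proof (induction rule: contractible_graph.induct)
  case (single G)
  then have "card (pverts G) = 1" unfolding complete_digraph_pair_def by simp
  then obtain v where "pverts G = {v}" by (rule card_1_singletonE)
  then show ?case by (simp add: contractible.single)
next
  case (step G v)
  interpret pair_graph G by fact
  show ?case
    using graph_iso_contr[OF step.IH(1) unit_sphere_iso[OF step.hyps(1)]]
      graph_iso_contr[OF step.IH(2) delete_vertex_iso[OF step.hyps(1)]]
    by (rule contractible.step[OF pair_finite_verts step.hyps(2)])
qed

lemma contr_contractible_graph:
  "contractible E V \<Longrightarrow> graph_iso h E V (adjacent G) (pverts G) \<Longrightarrow> pair_graph G \<Longrightarrow> contractible_graph G"
proof (induction arbitrary: G rule: contractible.induct)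
  case (single v)
  interpret pair_graph G by fact
  have V: "pverts G = {h v}" using single.prems(1) by (simp add: graph_iso_def bij_betw_def)
  have "parcs G = {}"
  proof (rule equals0I)
    fix e assume e: "e \<in> parcs G"
    then have "fst e = h v" "snd e = h v" using arc_fst_in_verts arc_snd_in_verts V by auto
    then show False using pair_no_loops[OF e] by simp
  qed
  then have "K\<^bsub>1\<^esub> (with_proj G)"
    using V unfolding complete_digraph_pair_def by auto
  then show ?case by (rule contractible_graph.single)
next
  case (step V v)
  have "contractible_graph (unit_sphere G (h v))"
    using graph_iso_unit_sphere[OF step.prems step.hyps(2)] unit_sphere_graph(2)[OF step.prems(2)]
    by (rule step.IH(1))
  moreover have "contractible_graph (delete_vertex G (h v))"
    using graph_iso_delete_vertex[OF step.prems step.hyps(2)] delete_vertex_graph(2)[OF step.prems(2)]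
    by (rule step.IH(2))
  moreover have "h v \<in> pverts G"
    using step.prems(1) step.hyps(2) bij_betwE unfolding graph_iso_def by blast
  ultimately show ?case using contractible_graph.step[OF step.prems(2)] by blast
qed

lemma q_sphere_manifold_sph:
  shows "q_sphere q G \<Longrightarrow> pair_graph G \<and> q \<ge> -1 \<and> sph (adjacent G) (nat (q + 1)) (pverts G)"
    and "q_manifold q G \<Longrightarrow> pair_graph G \<and> q \<ge> 0 \<and> pverts G \<noteq> {} \<and>
      (\<forall>v\<in>pverts G. sph (adjacent G) (nat q) (nbrs (adjacent G) (pverts G) v))"
proof (induction rule: q_sphere_q_manifold.inducts)
  case (empty_sphere G)
  then show ?case by simp
next
  case (manifold G q)
  have "sph (adjacent G) (nat q) (nbrs (adjacent G) (pverts G) v)" if "v \<in> pverts G" for v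
  proof -
    have "sph (adjacent (unit_sphere G v)) (nat q) (pverts (unit_sphere G v))" using manifold.IH[OF that] by simp
    then show ?thesis using unit_sphere_iso[OF manifold.hyps(1)] by (rule graph_iso_sph)
  qed
  then show ?case using manifold.hyps(1-3) by blast
next
  case (sphere q G v)
  then have G: "pair_graph G" and q: "q \<ge> 0" and ne: "pverts G \<noteq> {}"
    and S: "\<forall>v\<in>pverts G. sph (adjacent G) (nat q) (nbrs (adjacent G) (pverts G) v)" by blast+
  interpret pair_graph G by fact
  have "contractible (adjacent G) (pverts G - {v})"
    by (rule graph_iso_contr[OF contractible_graph_contr[OF sphere.hyps(3)] delete_vertex_iso[OF G]])
  then have "sph (adjacent G) (Suc (nat q)) (pverts G)"
    unfolding sph.simps using pair_finite_verts ne S sphere.hyps(2) by blast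
  moreover have "nat (q + 1) = Suc (nat q)" using q by simp
  ultimately show ?case using G q by simp
qed

lemma sph_q_sphere:
  "sph E m V \<Longrightarrow> graph_iso h E V (adjacent G) (pverts G) \<Longrightarrow> pair_graph G \<Longrightarrow> q_sphere (int m - 1) G"
proof (induction m arbitrary: V G)
  case 0
  then have "pverts G = {}" by (simp add: graph_iso_def bij_betw_def)
  then show ?case using empty_sphere[OF 0(3)] by simp
next
  case (Suc m)
  note iso = Suc.prems(2) and G = Suc.prems(3)
  have im: "h ` V = pverts G" using iso unfolding graph_iso_def bij_betw_def by blast
  have S: "V \<noteq> {}" "\<forall>v\<in>V. sph E m (nbrs E V v)" "\<exists>v\<in>V. contractible E (V - {v})"
    using Suc.prems(1) by simp_all
  have "q_sphere (int m - 1) (unit_sphere G w)" if w: "w \<in> pverts G" for w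
  proof -
    obtain v where v: "v \<in> V" "w = h v" using w im by blast
    show ?thesis
      unfolding v(2) using S(2) v(1) graph_iso_unit_sphere[OF iso G v(1)] unit_sphere_graph(2)[OF G]
      by (intro Suc.IH[of "nbrs E V v"]) blast+
  qed
  moreover have "pverts G \<noteq> {}" using im S(1) by blast
  ultimately have M: "q_manifold (int m) G" using G by (intro manifold) simp_all
  obtain v where v: "v \<in> V" "contractible E (V - {v})" using S(3) by blast
  have "contractible_graph (delete_vertex G (h v))"
    using v(2) graph_iso_delete_vertex[OF iso G v(1)] delete_vertex_graph(2)[OF G]
    by (rule contr_contractible_graph)
  moreover have "h v \<in> pverts G" using im v(1) by blast
  ultimately show ?case using sphere[OF M] by simp
qed

lemma q_sphere_iff:
  assumes "pair_graph G" "q \<ge> -1"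
  shows "q_sphere q G \<longleftrightarrow> sph (adjacent G) (nat (q + 1)) (pverts G)"
proof
  assume "sph (adjacent G) (nat (q + 1)) (pverts G)"
  then have "q_sphere (int (nat (q + 1)) - 1) G"
    using graph_iso_id[of "pverts G" "adjacent G" "adjacent G"] assms(1) by (intro sph_q_sphere) simp_all
  then show "q_sphere q G" using assms(2) by simp
qed (use q_sphere_manifold_sph(1) in blast)

lemma digraph_iso_graph_iso:
  assumes "digraph_iso (with_proj G) (with_proj D)"
  shows "\<exists>h. graph_iso h (adjacent G) (pverts G) (adjacent D) (pverts D)"
proof -
  obtain f where f: "pre_digraph.digraph_isomorphism (with_proj G) f" "with_proj D = app_iso f (with_proj G)"
    using assms unfolding digraph_iso_def by blast
  define h where "h = iso_verts f"
  have wf: "pair_wf_digraph G" and inj: "inj_on h (pverts G)"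
    and arc: "\<And>a. a \<in> parcs G \<Longrightarrow> h (fst a) = iso_tail f (iso_arcs f a) \<and> h (snd a) = iso_head f (iso_arcs f a)"
    using f(1) unfolding pre_digraph.digraph_isomorphism_def h_def wf_digraph_wp_iff by auto
  have D: "pverts D = h ` pverts G" "parcs D = iso_arcs f ` parcs G" "fst = iso_tail f" "snd = iso_head f"
    using f(2) unfolding app_iso_def h_def with_proj_def by auto
  have "iso_arcs f (x, y) = (h x, h y)" if "(x, y) \<in> parcs G" for x y
    using arc[OF that] D(3,4) by (metis fst_conv snd_conv surjective_pairing)
  then have parcs: "parcs D = (\<lambda>(x, y). (h x, h y)) ` parcs G"
    unfolding D(2) by (intro image_cong refl) auto
  have "adjacent D (h x) (h y) \<longleftrightarrow> adjacent G x y" if xy: "x \<in> pverts G" "y \<in> pverts G" for x y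
  proof
    assume "adjacent D (h x) (h y)"
    then obtain a b where ab: "(a, b) \<in> parcs G" "h x = h a" "h y = h b" unfolding parcs by auto
    have "a \<in> pverts G" "b \<in> pverts G" using pair_wf_digraph.wellformed'[OF wf ab(1)] .
    then show "adjacent G x y" using inj_onD[OF inj] ab xy by metis
  next
    assume "adjacent G x y"
    then show "adjacent D (h x) (h y)" using parcs by force
  qed
  then show ?thesis using inj D(1) unfolding graph_iso_def bij_betw_def by blast
qed

lemma graph_iso_digraph_iso:
  assumes "graph_iso h (adjacent G) (pverts G) (adjacent D) (pverts D)" "pair_graph G" "pair_graph D"
  shows "digraph_iso (with_proj G) (with_proj D)"
proof -
  interpret G: pair_graph G by fact
  interpret D: pair_graph D by fact
  have inj: "inj_on h (pverts G)" and im: "h ` pverts G = pverts D"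
    and ad: "\<And>x y. x \<in> pverts G \<Longrightarrow> y \<in> pverts G \<Longrightarrow> adjacent D (h x) (h y) \<longleftrightarrow> adjacent G x y"
    using assms(1) unfolding graph_iso_def bij_betw_def by blast+
  define f where "f = \<lparr> iso_verts = h, iso_arcs = map_prod h h, iso_head = snd, iso_tail = fst \<rparr>"
  have "inj_on (map_prod h h) (parcs G)"
    by (rule inj_on_subset[OF map_prod_inj_on[OF inj inj]]) (auto dest: G.in_arcsD1 G.in_arcsD2)
  then have "pre_digraph.digraph_isomorphism (with_proj G) f"
    using inj G.wf_digraph_axioms unfolding pre_digraph.digraph_isomorphism_def f_def by simp
  moreover have "parcs D = map_prod h h ` parcs G"
  proof (intro equalityI subsetI)
    fix e assume e: "e \<in> parcs D"
    obtain a b where ab: "e = (a, b)" by (cases e)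
    then have "a \<in> h ` pverts G" "b \<in> h ` pverts G" using e D.wellformed' im by auto
    then obtain x y where "x \<in> pverts G" "y \<in> pverts G" "a = h x" "b = h y" by blast
    then show "e \<in> map_prod h h ` parcs G" using e ab ad by (intro image_eqI[of _ _ "(x, y)"]) auto
  next
    fix e assume "e \<in> map_prod h h ` parcs G"
    then show "e \<in> parcs D" using ad G.wellformed' by auto
  qed
  then have "with_proj D = app_iso f (with_proj G)"
    unfolding app_iso_def f_def with_proj_def using im by simp
  ultimately show ?thesis unfolding digraph_iso_def by blast
qed

text \<open>
  The sphere that contains a ball is on the natural numbers on both sides, so the two notions differ
  only in how graphs and isomorphisms are represented.
\<close>
lemma sphere_or_ball_iff:
  assumes G: "pair_graph G" and q: "q \<ge> -1"
  shows "q_sphere q G \<or> q_ball q G \<longleftrightarrow> sphere_or_ball True (adjacent G) (nat (q + 1)) (pverts G)"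
proof
  assume "q_sphere q G \<or> q_ball q G"
  then show "sphere_or_ball True (adjacent G) (nat (q + 1)) (pverts G)"
  proof
    assume "q_sphere q G"
    then show ?thesis using sphere_or_ball_sph[OF sgraph_adjacent[OF G]] q_sphere_iff[OF G q] by blast
  next
    assume "q_ball q G"
    then obtain H :: "nat pair_pre_digraph" and v where
      H: "q_sphere q H" "v \<in> pverts H" "digraph_iso (with_proj G) (with_proj (delete_vertex H v))"
      unfolding q_ball_def by blast
    have PH: "pair_graph H" and S: "sph (adjacent H) (nat (q + 1)) (pverts H)"
      using q_sphere_manifold_sph(1)[OF H(1)] by blast+
    obtain h where h: "graph_iso h (adjacent G) (pverts G) (adjacent (delete_vertex H v)) (pverts H - {v})"
      using digraph_iso_graph_iso[OF H(3)] delete_vertex_graph(1)[OF PH] by auto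
    have "graph_iso h (adjacent G) (pverts G) (adjacent H) (pverts H - {v})"
      by (rule graph_iso_cong[OF h]) (simp add: delete_vertex_graph(1,3)[OF PH])
    then show ?thesis unfolding sphere_or_ball_def using sgraph_adjacent[OF PH] S by blast
  qed
next
  assume "sphere_or_ball True (adjacent G) (nat (q + 1)) (pverts G)"
  then obtain F :: "nat \<Rightarrow> nat \<Rightarrow> bool" and H v h where
    H: "sgraph F" "sph F (nat (q + 1)) H" "graph_iso h (adjacent G) (pverts G) F (H - {v})"
    unfolding sphere_or_ball_def by blast
  interpret F: sgraph F by fact
  show "q_sphere q G \<or> q_ball q G"
  proof (cases "v \<in> H")
    case False
    then have "sph (adjacent G) (nat (q + 1)) (pverts G)"
      using graph_iso_sph[OF H(2) graph_iso_inv] H(3) by simp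
    then show ?thesis using q_sphere_iff[OF G q] by blast
  next
    case True
    define A where "A = {(x, y). x \<in> H \<and> y \<in> H \<and> F x y}"
    define D where "D = \<lparr> pverts = H, parcs = A \<rparr>"
    have PD: "pair_graph D" unfolding D_def
      using sph_finite[OF H(2)] by (rule pair_graphI) (auto simp: A_def sgraph_def F.sym F.irr)
    have D: "pverts D = H" "\<And>x y. x \<in> H \<Longrightarrow> y \<in> H \<Longrightarrow> adjacent D x y \<longleftrightarrow> F x y"
      unfolding D_def A_def by simp_all
    have "graph_iso (\<lambda>x. x) F H (adjacent D) (pverts D)"
      unfolding D(1) by (rule graph_iso_id) (simp add: D(2))
    then have "q_sphere q D" using sph_q_sphere[OF H(2) _ PD] q by simp
    moreover have "graph_iso h (adjacent G) (pverts G) (adjacent (delete_vertex D v)) (pverts (delete_vertex D v))"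
      unfolding delete_vertex_graph(1)[OF PD] D(1)
      by (rule graph_iso_cong[OF H(3)]) (simp add: delete_vertex_graph(1,3)[OF PD] D)
    then have "digraph_iso (with_proj G) (with_proj (delete_vertex D v))"
      using graph_iso_digraph_iso[OF _ G delete_vertex_graph(2)[OF PD]] by blast
    ultimately show ?thesis unfolding q_ball_def using True D(1) by blast
  qed
qed

lemma q_manifold_iff:
  assumes G: "pair_graph G" and q: "q \<ge> 0"
  shows "q_manifold q G \<longleftrightarrow> manifold_on False (adjacent G) (nat (q + 1)) (pverts G)"
proof -
  interpret pair_graph G by fact
  have n: "nat (q + 1) > 0" "nat (q + 1) - 1 = nat q" using q by simp_all
  have sp: "q_sphere (q - 1) (unit_sphere G v) \<longleftrightarrow>
      sph (adjacent G) (nat q) (nbrs (adjacent G) (pverts G) v)" for v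
  proof -
    have "sph (adjacent (unit_sphere G v)) (nat q) (pverts (unit_sphere G v)) \<longleftrightarrow>
        sph (adjacent G) (nat q) (nbrs (adjacent G) (pverts G) v)"
      using graph_iso_sph[OF _ unit_sphere_iso[OF G]] graph_iso_sph[OF _ graph_iso_inv[OF unit_sphere_iso[OF G]]]
      by blast
    then show ?thesis using q_sphere_iff[OF unit_sphere_graph(2)[OF G], of "q - 1"] q by simp
  qed
  have "q_manifold q G \<longleftrightarrow> pverts G \<noteq> {} \<and> (\<forall>v\<in>pverts G. q_sphere (q - 1) (unit_sphere G v))"
    using G q by (subst q_manifold.simps) blast
  then show ?thesis
    unfolding manifold_on_def n sp using n(1) pair_finite_verts sphere_or_ball_sph[OF sgraph_adjacent[OF G]] sphere_or_ball_False by metis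
qed

lemma q_manifold_with_boundary_iff:
  assumes G: "pair_graph G" and q: "q \<ge> 0"
  shows "q_manifold_with_boundary q G \<longleftrightarrow> manifold_on True (adjacent G) (nat (q + 1)) (pverts G)"
proof -
  interpret pair_graph G by fact
  have n: "nat (q + 1) > 0" "nat (q + 1) - 1 = nat q" using q by simp_all
  have sp: "q_sphere (q - 1) (unit_sphere G v) \<or> q_ball (q - 1) (unit_sphere G v) \<longleftrightarrow>
      sphere_or_ball True (adjacent G) (nat q) (nbrs (adjacent G) (pverts G) v)" for v
  proof -
    note U = unit_sphere_graph[OF G, where v = v]
    have "graph_iso h (adjacent (unit_sphere G v)) (pverts (unit_sphere G v)) F W \<longleftrightarrow>
        graph_iso h (adjacent G) (pverts (unit_sphere G v)) F W" for h and F :: "nat \<Rightarrow> nat \<Rightarrow> bool" and W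
      using U(3) unfolding graph_iso_def by auto
    then show ?thesis using sphere_or_ball_iff[OF U(2), of "q - 1"] q unfolding sphere_or_ball_def U(1) by simp
  qed
  show ?thesis
    unfolding q_manifold_with_boundary_def manifold_on_def n sp using n(1) G q pair_finite_verts by blast
qed

text \<open>
  In a manifold, with or without boundary, the facets have \<open>q + 1\<close> vertices, and the facets above a
  simplex of size \<open>q\<close> correspond to the one or two vertices of its link.  So two cells that are not
  comparable meet in an interior face iff both are facets and share all but one vertex.
\<close>
lemma soft_refinement_cells:
  assumes G: "pair_graph G" and q: "q \<ge> 0" and M: "manifold_on b (adjacent G) (nat (q + 1)) (pverts G)"
  shows "pverts (soft_refinement G) = soft_cells (adjacent G) (nat (q + 1)) (pverts G)"
    and "\<And>x y. x \<in> pverts (soft_refinement G) \<Longrightarrow> y \<in> pverts (soft_refinement G) \<Longrightarrow>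
      adjacent (soft_refinement G) x y \<longleftrightarrow> soft_adj (nat (q + 1)) x y"
proof -
  interpret pair_graph G by fact
  interpret sgraph "adjacent G" by (rule sgraph_adjacent[OF G])
  define E V m where "E = adjacent G" and "V = pverts G" and "m = nat (q + 1)"
  have mq: "int m = q + 1" "m > 0" using q unfolding m_def by simp_all
  note link = manifold_clique[OF M, folded E_def V_def m_def]
  have finV: "finite V" unfolding V_def by (rule pair_finite_verts)
  have simp: "simplices G k = {x. clique E V x \<and> int (card x) = k + 1}" for k
    unfolding simplices_eq[OF G] clique_def E_def V_def using finite_subset[OF _ pair_finite_verts] by blast
  have "V \<noteq> {}" using M unfolding manifold_on_def V_def by blast
  then obtain w where "w \<in> V" by blast
  then have Kw: "clique E V {w}" by (simp add: clique_def)
  have facet: "\<exists>y. clique E V y \<and> card y = m"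
    using manifold_facet[OF M, folded E_def V_def m_def] Kw by blast
  have dim: "max_dim G = q"
    unfolding max_dim_def
  proof (rule Greatest_equality)
    show "simplices G q \<noteq> {}" using facet mq unfolding simp by auto
    show "k \<le> q" if "simplices G k \<noteq> {}" for k
      using that link mq unfolding simp by fastforce
  qed
  have facets: "facets G = {y. clique E V y \<and> card y = m}"
    unfolding facets_def dim simp using mq by auto
  have count: "card {f \<in> facets G. x \<subseteq> f} = card (link E V x)" if x: "clique E V x" "card x + 1 = m" for x
  proof -
    have finx: "finite x" using cliqueD(3)[OF x(1)] .
    have "bij_betw (\<lambda>w. insert w x) (link E V x) {f \<in> facets G. x \<subseteq> f}"
      unfolding bij_betw_def
    proof
      show "inj_on (\<lambda>w. insert w x) (link E V x)" unfolding inj_on_def link_def by blast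
      show "(\<lambda>w. insert w x) ` link E V x = {f \<in> facets G. x \<subseteq> f}"
      proof (intro equalityI subsetI)
        fix f assume "f \<in> (\<lambda>w. insert w x) ` link E V x"
        then obtain w where w: "w \<in> link E V x" "f = insert w x" by blast
        have "w \<notin> x" using w(1) unfolding link_def by blast
        then show "f \<in> {f \<in> facets G. x \<subseteq> f}"
          using clique_insert_link[folded E_def, OF x(1)] w x(2) finx unfolding facets by auto
      next
        fix f assume "f \<in> {f \<in> facets G. x \<subseteq> f}"
        then have f: "clique E V f" "card f = m" "x \<subseteq> f" unfolding facets by blast+
        have "card (f - x) = 1" using f x(2) finx by (simp add: card_Diff_subset)
        then obtain w where "f - x = {w}" by (rule card_1_singletonE)
        then have w: "w \<notin> x" "f = insert w x" using f(3) by blast+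
        then show "f \<in> (\<lambda>w. insert w x) ` link E V x"
          using clique_insert_link[folded E_def, OF x(1) w(1)] f(1) by blast
      qed
    qed
    then show ?thesis by (simp add: bij_betw_same_card)
  qed
  have bnd: "boundary_faces G = {x. clique E V x \<and> card x + 1 = m \<and> card (link E V x) = 1}"
    unfolding boundary_faces_def dim simp using count mq by auto
  have int: "interior_faces G = {x. clique E V x \<and> card x + 1 = m \<and> card (link E V x) = 2}"
    unfolding interior_faces_def dim simp using count mq by auto
  have cells: "soft_complex G = soft_cells E m V"
  proof (intro set_eqI)
    fix x
    have "x \<in> (\<Union>k \<in> - {q - 1}. simplices G k) \<longleftrightarrow> clique E V x \<and> card x + 1 \<noteq> m"
    proof -
      have "x \<in> simplices G (int (card x) - 1) \<longleftrightarrow> clique E V x" unfolding simp by simp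
      moreover have "int (card x) - 1 \<noteq> q - 1 \<longleftrightarrow> card x + 1 \<noteq> m" using mq by linarith
      moreover have "x \<in> simplices G k \<Longrightarrow> k = int (card x) - 1" for k unfolding simp by simp
      ultimately show ?thesis by (metis ComplD ComplI UN_iff singletonD singletonI)
    qed
    moreover have "card x \<le> m" if "clique E V x" using link[OF that] by blast
    ultimately show "x \<in> soft_complex G \<longleftrightarrow> x \<in> soft_cells E m V"
      unfolding soft_complex_def dim bnd soft_cells_def by auto
  qed
  then show "pverts (soft_refinement G) = soft_cells (adjacent G) (nat (q + 1)) (pverts G)"
    unfolding soft_refinement_def E_def V_def m_def by simp
  show "adjacent (soft_refinement G) x y \<longleftrightarrow> soft_adj (nat (q + 1)) x y"
    if xy: "x \<in> pverts (soft_refinement G)" "y \<in> pverts (soft_refinement G)" for x y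
  proof -
    have S: "x \<in> soft_complex G" "y \<in> soft_complex G" using xy unfolding soft_refinement_def by simp_all
    then have K: "clique E V x" "clique E V y" unfolding cells soft_cells_def by blast+
    have fin: "finite x" "finite y" using cliqueD(3) K by blast+
    have "x \<inter> y \<in> interior_faces G \<longleftrightarrow> card x = m \<and> card y = m \<and> x \<inter> y \<noteq> {} \<and> card (x \<inter> y) + 1 = m"
      if ns: "\<not> x \<subseteq> y" "\<not> y \<subseteq> x"
    proof
      assume "x \<inter> y \<in> interior_faces G"
      then have i: "clique E V (x \<inter> y)" "card (x \<inter> y) + 1 = m" unfolding int by blast+
      have "x \<inter> y \<subset> x" "x \<inter> y \<subset> y" using ns by blast+
      then have "card (x \<inter> y) < card x" "card (x \<inter> y) < card y" using psubset_card_mono fin by blast+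
      then show "card x = m \<and> card y = m \<and> x \<inter> y \<noteq> {} \<and> card (x \<inter> y) + 1 = m"
        using i cliqueD(2)[OF i(1)] link[OF K(1)] link[OF K(2)] by linarith
    next
      assume t: "card x = m \<and> card y = m \<and> x \<inter> y \<noteq> {} \<and> card (x \<inter> y) + 1 = m"
      have i: "clique E V (x \<inter> y)" using clique_subset[OF K(1)] t by blast
      have "m - card (x \<inter> y) = 1" using t by linarith
      then obtain c d where cd: "link E V (x \<inter> y) = {c, d}" using link[OF i] sphere_or_ball_1 by metis
      obtain a c where a: "a \<in> x" "a \<notin> y" and c: "c \<in> y" "c \<notin> x" using ns by blast
      have "clique E V (insert a (x \<inter> y))" using a by (intro clique_subset[OF K(1)]) auto
      moreover have "clique E V (insert c (x \<inter> y))" using c by (intro clique_subset[OF K(2)]) auto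
      ultimately have "a \<in> link E V (x \<inter> y)" "c \<in> link E V (x \<inter> y)"
        using clique_insert_link[folded E_def, OF i] a c by blast+
      moreover have "a \<noteq> c" using a c by blast
      ultimately have "card (link E V (x \<inter> y)) = 2" unfolding cd by auto
      then show "x \<inter> y \<in> interior_faces G" unfolding int using i t by blast
    qed
    moreover have "\<not> (card x = m \<and> card y = m \<and> card (x \<inter> y) + 1 = m)" if "x = y" using that by auto
    moreover have "adjacent (soft_refinement G) x y \<longleftrightarrow>
        x \<noteq> y \<and> (x \<subseteq> y \<or> y \<subseteq> x \<or> x \<inter> y \<in> interior_faces G)"
      using S unfolding soft_refinement_def by simp
    ultimately show ?thesis unfolding soft_adj_def m_def[symmetric] by blast
  qed
qed

theorem lemma1:
  fixes q :: int and G :: "'a pair_pre_digraph"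
  assumes "q \<ge> 0" and "pair_graph G"
  shows "(q_manifold q G \<longrightarrow> q_manifold q (soft_refinement G)) \<and>
         (q_manifold_with_boundary q G \<longrightarrow> q_manifold_with_boundary q (soft_refinement G))"
proof -
  let ?R = "soft_refinement G" and ?m = "nat (q + 1)"
  interpret sgraph "adjacent G" by (rule sgraph_adjacent[OF assms(2)])
  have R: "pair_graph ?R \<and> manifold_on b (adjacent ?R) ?m (pverts ?R)"
    if M: "manifold_on b (adjacent G) ?m (pverts G)" for b
  proof -
    note cells = soft_refinement_cells[OF assms(2,1) M]
    have S: "manifold_on b (soft_adj ?m) ?m (pverts ?R)" using soft_manifold[OF M] unfolding cells(1) .
    interpret S: sgraph "soft_adj ?m" by (rule sgraph_soft_adj)
    have fin: "finite (pverts ?R)" using S unfolding manifold_on_def by blast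
    have arcs: "parcs ?R \<subseteq> pverts ?R \<times> pverts ?R" unfolding soft_refinement_def by auto
    have "sgraph (adjacent ?R)"
      using arcs cells(2) S.sym S.irr by unfold_locales blast+
    then have "pair_graph \<lparr> pverts = pverts ?R, parcs = parcs ?R \<rparr>" by (rule pair_graphI[OF fin arcs])
    then have P: "pair_graph ?R" by (cases ?R) simp
    have "graph_iso (\<lambda>x. x) (soft_adj ?m) (pverts ?R) (adjacent ?R) (pverts ?R)"
      by (rule graph_iso_id) (simp add: cells(2))
    then have "manifold_on b (adjacent ?R) ?m (pverts ?R)" using graph_iso_manifold[OF S] by blast
    then show ?thesis using P by blast
  qed
  show ?thesis
    using R[of False] R[of True] q_manifold_iff[OF assms(2,1)] q_manifold_iff[OF _ assms(1), of ?R]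
      q_manifold_with_boundary_iff[OF assms(2,1)] q_manifold_with_boundary_iff[OF _ assms(1), of ?R] by blast
qed

end
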